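(* Let $B=(b_{ij})$ be a skew-symmetric integer $n\times n$ matrix which is invertible over $\mathbb{Q}$ and whose associated quiver is acyclic. Write $B^{-1}=((b^{-1})_{ij})$ and assume that for all $i\in\{1,\dots,n\}$ $$\sum_{j=1}^n (b^{-1})_{ij}\bigl(\max(b_{ij},0)+\min(b_{ij},0)\bigr)\neq 0 .$$ Let $\mathfrak{A}$ be the cluster algebra over $\mathbb{C}$ (without frozen variables) with initial seed $(\mathbf{x},B)$, $\mathbf{x}=(x_1,\dots,x_n)$. Suppose that $\mathfrak{A}=\mathbb{C}[X]$ is the coordinate ring of a complex affine variety $X$ and that $(B,\Lambda)$ is a compatible pair. Then $X$ has the structure of a (holomorphic) symplectic manifold whose symplectic form is the Poisson bivector $u$ of the Poisson bracket $\{\cdot,\cdot\}_\Lambda$ on $\mathfrak{A}$; that is, $X$ is smooth and the skew-symmetric form $u_p$ on $T_p^*X$ is non-degenerate at every point $p\in X$.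
   Context: Quiver of $B$: it has vertices $1,\dots,n$ and, whenever $b_{ij}>0$, $b_{ij}$ arrows from $i$ to $j$; it is acyclic if it has no oriented cycles. Cluster algebra: let $\mathfrak{F}=\mathbb{C}(x_1,\dots,x_n)$. A seed is a pair $(\mathbf{y},B)$ with $\mathbf{y}=(y_1,\dots,y_n)$ a transcendence basis generating $\mathfrak{F}$ (a cluster) and $B$ a skew-symmetric integer matrix. Its exchange polynomials are $P_k=\prod_{j} y_j^{\max(b_{kj},0)}+\prod_{j} y_j^{-\min(b_{kj},0)}$. Mutation in direction $k$ replaces $y_k$ by $y_k'$, where $y_ky_k'=P_k$, and replaces $B$ by $B'$ with $b'_{ij}=-b_{ij}$ if $i=k$ or $j=k$, and $b'_{ij}=b_{ij}+\frac{|b_{ik}|b_{kj}+b_{ik}|b_{kj}|}{2}$ otherwise. The cluster algebra $\mathfrak{A}\subset\mathfrak{F}$ with initial seed $(\mathbf{x},B)$ is the $\mathbb{C}$-subalgebra generated by the elements of all clusters of seeds obtained from $(\mathbf{x},B)$ by finite sequences of mutations. Compatible pair: $(B,\Lambda)$ with $\Lambda=(\lambda_{ij})$ a skew-symmetric integer $n\times n$ matrix such that $B\Lambda$ is a diagonal matrix with positive integer diagonal entries. Poisson bracket: $\{\cdot,\cdot\}_\Lambda$ is the Poisson bracket on $\mathfrak{F}$ determined by $\{x_i,x_j\}=\lambda_{ij}x_ix_j$; in the present acyclic situation it restricts to a Poisson bracket on $\mathfrak{A}$. Poisson bivector: for $p\in X$ with maximal ideal $\mathfrak{m}_p\subset\mathfrak{A}$,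 and $\alpha,\beta\in\mathfrak{m}_p/\mathfrak{m}_p^2=T_p^*X$ with lifts $f,g\in\mathfrak{m}_p$, one sets $u_p(\alpha,\beta)=\{f,g\}_\Lambda(p)$. The bivector $u$ is called symplectic if $u_p$ is non-degenerate at every point. *)

theory Defs
  imports
    "HOL-Analysis.Cartesian_Space"
    "HOL-Library.Poly_Mapping"
    "HOL-Library.FuncSet"
    "HOL-Computational_Algebra.Fraction_Field"
begin

section \<open>Polynomials and rational functions\<close>

text \<open>
  Multivariate polynomials are finitely supported maps from monomials to coefficients.
  The variables of the ambient field are indexed by a finite type, whose cardinality is the
  rank $n$; the linear order on it is needed only because the library proves that the polynomial
  ring is an integral domain under this assumption.
\<close>

type_synonym 'i cpoly = "('i \<Rightarrow>\<^sub>0 nat) \<Rightarrow>\<^sub>0 complex"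

type_synonym 'n ratfun = "'n cpoly fract"

definition const :: "complex \<Rightarrow> ('n::{finite,linorder}) ratfun" where
  "const c = Fract (Poly_Mapping.single 0 c) 1"

definition var :: "'n \<Rightarrow> ('n::{finite,linorder}) ratfun" where
  "var i = Fract (Poly_Mapping.single (Poly_Mapping.single i 1) 1) 1"

text \<open>Evaluation at \<open>z\<close>, with \<open>h\<close> the structure map of the target \<open>\<complex>\<close>-algebra.\<close>

definition cpoly_eval :: "(complex \<Rightarrow> 'r::comm_ring_1) \<Rightarrow> ('i \<Rightarrow> 'r) \<Rightarrow> 'i cpoly \<Rightarrow> 'r" where
  "cpoly_eval h z q =
     (\<Sum>m\<in>Poly_Mapping.keys q. h (Poly_Mapping.lookup q m) *
        (\<Prod>i\<in>Poly_Mapping.keys m. z i ^ Poly_Mapping.lookup m i))"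


section \<open>Exchange matrices, quivers and compatible pairs\<close>

type_synonym 'n int_matrix = "((int, 'n) vec, 'n) vec"

definition skew_symmetric :: "('n::finite) int_matrix \<Rightarrow> bool" where
  "skew_symmetric B \<longleftrightarrow> transpose B = - B"

abbreviation rat_matrix :: "('n::finite) int_matrix \<Rightarrow> ((rat, 'n) vec, 'n) vec" where
  "rat_matrix B \<equiv> map_matrix of_int B"

text \<open>The triple \<open>(i, j, k)\<close> is the \<open>k\<close>-th arrow from \<open>i\<close> to \<open>j\<close>.\<close>

definition quiver_arrows :: "('n::finite) int_matrix \<Rightarrow> ('n \<times> 'n \<times> nat) set" where
  "quiver_arrows B = {(i, j, k). k < nat (B $ i $ j)}"

definition acyclic_quiver :: "('n::finite) int_matrix \<Rightarrow> bool" where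
  "acyclic_quiver B \<longleftrightarrow> acyclic ((\<lambda>(i, j, k). (i, j)) ` quiver_arrows B)"

definition compatible_pair :: "('n::finite) int_matrix \<Rightarrow> 'n int_matrix \<Rightarrow> bool" where
  "compatible_pair B \<Lambda> \<longleftrightarrow> skew_symmetric \<Lambda> \<and>
     (\<forall>i j. i \<noteq> j \<longrightarrow> (B ** \<Lambda>) $ i $ j = 0) \<and> (\<forall>i. (B ** \<Lambda>) $ i $ i > 0)"


section \<open>Seeds and the cluster algebra\<close>

definition exchange_poly ::
    "('n \<Rightarrow> ('n::{finite,linorder}) ratfun) \<Rightarrow> 'n int_matrix \<Rightarrow> 'n \<Rightarrow> 'n ratfun" where
  "exchange_poly y B k =
     (\<Prod>j\<in>UNIV. y j ^ nat (max (B $ k $ j) 0)) + (\<Prod>j\<in>UNIV. y j ^ nat (- min (B $ k $ j) 0))"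

text \<open>The numerator is always even, so \<open>div\<close> is exact.\<close>

definition mutate_matrix :: "'n::finite \<Rightarrow> 'n int_matrix \<Rightarrow> 'n int_matrix" where
  "mutate_matrix k B = (\<chi> i j. if i = k \<or> j = k then - B $ i $ j
     else B $ i $ j + (\<bar>B $ i $ k\<bar> * B $ k $ j + B $ i $ k * \<bar>B $ k $ j\<bar>) div 2)"

definition mutate_cluster ::
    "'n \<Rightarrow> ('n \<Rightarrow> ('n::{finite,linorder}) ratfun) \<Rightarrow> 'n int_matrix \<Rightarrow> 'n \<Rightarrow> 'n ratfun" where
  "mutate_cluster k y B = y(k := exchange_poly y B k / y k)"

text \<open>
  Mutation preserves the property that the cluster is a transcendence basis generating the field
  and that the matrix is skew-symmetric, so every pair reached from the initial seed is a seed.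
\<close>

inductive mutation_equivalent ::
    "('n::{finite,linorder}) int_matrix \<Rightarrow> ('n \<Rightarrow> 'n ratfun) \<Rightarrow> 'n int_matrix \<Rightarrow> bool"
  for B :: "('n::{finite,linorder}) int_matrix" where
  initial: "mutation_equivalent B var B"
| mutate: "mutation_equivalent B y C \<Longrightarrow>
     mutation_equivalent B (mutate_cluster k y C) (mutate_matrix k C)"

definition is_subalgebra :: "('n::{finite,linorder}) ratfun set \<Rightarrow> bool" where
  "is_subalgebra S \<longleftrightarrow> range const \<subseteq> S \<and> (\<forall>f\<in>S. \<forall>g\<in>S. f + g \<in> S \<and> f * g \<in> S)"

definition cluster_algebra :: "('n::{finite,linorder}) int_matrix \<Rightarrow> 'n ratfun set" where
  "cluster_algebra B = is_subalgebra hull {y i | y C i. mutation_equivalent B y C}"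


section \<open>The Poisson bracket\<close>

definition is_poisson_bracket ::
    "(('n::{finite,linorder}) ratfun \<Rightarrow> 'n ratfun \<Rightarrow> 'n ratfun) \<Rightarrow> bool" where
  "is_poisson_bracket br \<longleftrightarrow>
     (\<forall>f g h. br (f + g) h = br f h + br g h) \<and>
     (\<forall>c f g. br (const c * f) g = const c * br f g) \<and>
     (\<forall>f g. br f g = - br g f) \<and>
     (\<forall>f g h. br f (g * h) = br f g * h + g * br f h) \<and>
     (\<forall>f g h. br f (br g h) + br g (br h f) + br h (br f g) = 0)"

definition poisson_bracket ::
    "('n::{finite,linorder}) int_matrix \<Rightarrow> 'n ratfun \<Rightarrow> 'n ratfun \<Rightarrow> 'n ratfun" where
  "poisson_bracket \<Lambda> = (THE br. is_poisson_bracket br \<and>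
     (\<forall>i j. br (var i) (var j) = of_int (\<Lambda> $ i $ j) * var i * var j))"


section \<open>Affine varieties\<close>

definition affine_variety :: "(complex^'m) set \<Rightarrow> bool" where
  "affine_variety X \<longleftrightarrow>
     (\<exists>Q :: 'm cpoly set. X = {z. \<forall>q\<in>Q. cpoly_eval id (($) z) q = 0})"

definition coordinate_ring :: "(complex^'m) set \<Rightarrow> (complex^'m \<Rightarrow> complex) set" where
  "coordinate_ring X = range (\<lambda>q. \<lambda>z\<in>X. cpoly_eval id (($) z) q)"

text \<open>
  \<open>\<phi>\<close> is an isomorphism of \<open>\<complex>\<close>-algebras from \<open>A\<close> onto the coordinate ring of \<open>X\<close>.  Under this
  identification \<open>\<phi> f p\<close> is the value of \<open>f \<in> A\<close> at the point \<open>p \<in> X\<close>.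
\<close>

definition coordinate_ring_iso ::
    "('n::{finite,linorder}) ratfun set \<Rightarrow> (complex^'m) set \<Rightarrow>
     ('n ratfun \<Rightarrow> complex^'m \<Rightarrow> complex) \<Rightarrow> bool" where
  "coordinate_ring_iso A X \<phi> \<longleftrightarrow>
     bij_betw \<phi> A (coordinate_ring X) \<and>
     (\<forall>c. \<forall>p\<in>X. \<phi> (const c) p = c) \<and>
     (\<forall>f\<in>A. \<forall>g\<in>A. \<forall>p\<in>X. \<phi> (f + g) p = \<phi> f p + \<phi> g p \<and> \<phi> (f * g) p = \<phi> f p * \<phi> g p)"

definition max_ideal ::
    "('n::{finite,linorder}) ratfun set \<Rightarrow> ('n ratfun \<Rightarrow> complex^'m \<Rightarrow> complex) \<Rightarrow>
     complex^'m \<Rightarrow> 'n ratfun set" where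
  "max_ideal A \<phi> p = {f \<in> A. \<phi> f p = 0}"

definition ideal_square :: "'r::comm_ring_1 set \<Rightarrow> 'r set" where
  "ideal_square I = {\<Sum>i<k. f i * g i | (k::nat) f g. \<forall>i<k. f i \<in> I \<and> g i \<in> I}"

text \<open>
  The elements of \<open>cotangent_space A \<phi> p\<close> are the cosets of $\mathfrak{m}_p^2$ in
  $\mathfrak{m}_p$; the zero vector is the coset containing \<open>0\<close>.
\<close>

definition cotangent_space ::
    "('n::{finite,linorder}) ratfun set \<Rightarrow> ('n ratfun \<Rightarrow> complex^'m \<Rightarrow> complex) \<Rightarrow>
     complex^'m \<Rightarrow> 'n ratfun set set" where
  "cotangent_space A \<phi> p = (let I = max_ideal A \<phi> p in
     I // {(f, g). f \<in> I \<and> g \<in> I \<and> f - g \<in> ideal_square I})"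

text \<open>
  The cotangent space has a basis of \<open>d\<close> elements: the classes of \<open>e 0, \<dots>, e (d - 1)\<close>.
  Coefficient vectors are made extensional so that they can be unique.
\<close>

definition has_cotangent_dim ::
    "('n::{finite,linorder}) ratfun set \<Rightarrow> ('n ratfun \<Rightarrow> complex^'m \<Rightarrow> complex) \<Rightarrow>
     complex^'m \<Rightarrow> nat \<Rightarrow> bool" where
  "has_cotangent_dim A \<phi> p d \<longleftrightarrow> (\<exists>e. (\<forall>i<d. e i \<in> max_ideal A \<phi> p) \<and>
     (\<forall>\<alpha>\<in>cotangent_space A \<phi> p.
        \<exists>!c. c \<in> extensional {..<d} \<and> (\<Sum>i<d. const (c i) * e i) \<in> \<alpha>))"

definition algebraically_independent ::
    "nat \<Rightarrow> (nat \<Rightarrow> ('n::{finite,linorder}) ratfun) \<Rightarrow> bool" where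
  "algebraically_independent d f \<longleftrightarrow>
     (\<forall>q :: nat cpoly. (\<forall>m\<in>Poly_Mapping.keys q. Poly_Mapping.keys m \<subseteq> {..<d}) \<longrightarrow>
        cpoly_eval const f q = 0 \<longrightarrow> q = 0)"

text \<open>
  The dimension of an irreducible affine variety with coordinate ring \<open>A\<close>, as the
  transcendence degree over \<open>\<complex>\<close> of its function field: the maximal number of algebraically
  independent elements of \<open>A\<close>.  Since \<open>A\<close> is contained in a field, the variety is irreducible,
  so its local dimension at every point is this number.
\<close>

definition has_dimension :: "('n::{finite,linorder}) ratfun set \<Rightarrow> nat \<Rightarrow> bool" where
  "has_dimension A d \<longleftrightarrow>
     (\<exists>f. (\<forall>i<d. f i \<in> A) \<and> algebraically_independent d f) \<and>
     (\<forall>d' f. (\<forall>i<d'. f i \<in> A) \<and> algebraically_independent d' f \<longrightarrow> d' \<le> d)"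

definition smooth_variety ::
    "('n::{finite,linorder}) ratfun set \<Rightarrow> (complex^'m) set \<Rightarrow>
     ('n ratfun \<Rightarrow> complex^'m \<Rightarrow> complex) \<Rightarrow> bool" where
  "smooth_variety A X \<phi> \<longleftrightarrow>
     (\<exists>d. has_dimension A d \<and> (\<forall>p\<in>X. has_cotangent_dim A \<phi> p d))"


section \<open>The Poisson bivector\<close>

text \<open>
  The value at a pair of cotangent vectors is the common value over all lifts;
  \<open>the_elem\<close> is determined only if that value does not depend on the lifts.
\<close>

definition bivector ::
    "('n::{finite,linorder} ratfun \<Rightarrow> complex^'m \<Rightarrow> complex) \<Rightarrow>
     ('n ratfun \<Rightarrow> 'n ratfun \<Rightarrow> 'n ratfun) \<Rightarrow>
     complex^'m \<Rightarrow> 'n ratfun set \<Rightarrow> 'n ratfun set \<Rightarrow> complex" where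
  "bivector \<phi> br p \<alpha> \<beta> = the_elem {\<phi> (br f g) p | f g. f \<in> \<alpha> \<and> g \<in> \<beta>}"

definition symplectic ::
    "('n::{finite,linorder}) ratfun set \<Rightarrow> (complex^'m) set \<Rightarrow>
     ('n ratfun \<Rightarrow> complex^'m \<Rightarrow> complex) \<Rightarrow>
     (complex^'m \<Rightarrow> 'n ratfun set \<Rightarrow> 'n ratfun set \<Rightarrow> complex) \<Rightarrow> bool" where
  "symplectic A X \<phi> u \<longleftrightarrow> (\<forall>p\<in>X.
     (\<forall>\<alpha>\<in>cotangent_space A \<phi> p. \<forall>\<beta>\<in>cotangent_space A \<phi> p. u p \<alpha> \<beta> = - u p \<beta> \<alpha>) \<and>
     (\<forall>\<alpha>\<in>cotangent_space A \<phi> p.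
        (\<forall>\<beta>\<in>cotangent_space A \<phi> p. u p \<alpha> \<beta> = 0) \<longrightarrow> 0 \<in> \<alpha>))"

end

theory Submission
  imports Defs
begin

text \<open>
  Write \<open>x\<^sub>i'\<close> for the variable that replaces \<open>x\<^sub>i\<close> in the initial seed, so that
  \<open>x\<^sub>i x\<^sub>i' = P\<^sub>i\<close>, where \<open>P\<^sub>i = x\<^sup>u + x\<^sup>v\<close> with \<open>u - v\<close> the \<open>i\<close>-th row of \<open>B\<close>.  The proof rests on the
  fact that these \<open>2n\<close> elements generate the cluster algebra (\<open>cluster_algebra_eq_lower\<close>); with it,
  the geometry is a computation in coordinates.

  That all cluster variables lie in \<open>\<complex>[x\<^sub>1, x\<^sub>1', \<dots>, x\<^sub>n, x\<^sub>n']\<close> is proved by way of the upper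
  bound, the ring of functions that are Laurent polynomials in a given seed and in its neighbours.
  For an acyclic seed the upper bound is contained in the ring of the \<open>x\<^sub>i, x\<^sub>i'\<close>
  (\<open>acyclic_in_lower\<close>): a source \<open>i\<close> of the quiver and a neighbour \<open>j\<close> have comaximal variables
  \<open>x\<^sub>i\<close> and \<open>x\<^sub>j\<close>, so one may invert either of them and thereby remove a vertex, until no arrows
  are left; then the exchange binomials do not involve the remaining variables and are pairwise
  coprime, because the rows of \<open>B\<close> are linearly independent.  Applied to two directions only, the
  same statement shows that the upper bound does not change under mutation
  (\<open>upper_subset_mutate\<close>), and a cluster variable lies in the upper bound of its own seed.

  The Poisson bracket is \<open>\<Sum>\<^sub>i\<^sub>j \<lambda>\<^sub>i\<^sub>j E\<^sub>i f E\<^sub>j g\<close> with \<open>E\<^sub>i = x\<^sub>i \<partial>/\<partial>x\<^sub>i\<close>.  Compatibility means that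
  \<open>x\<close> to the power of the \<open>i\<close>-th row of \<open>B\<close> brackets to zero with every variable except \<open>x\<^sub>i\<close>.
  From this the brackets of the generators are computed explicitly; they lie in the algebra.

  At a point \<open>p\<close>, acyclicity implies that there are no arrows between the indices \<open>i\<close> with
  \<open>x\<^sub>i(p) = 0\<close>, and that for such \<open>i\<close> the two monomials of \<open>P\<^sub>i\<close> have opposite nonzero values at
  \<open>p\<close> (\<open>vanishing_independent\<close>).  The differentials of the relations \<open>x\<^sub>i x\<^sub>i' = P\<^sub>i\<close> then show that
  \<open>n\<close> explicit elements span the cotangent space (\<open>centred_in_span\<close>).  A combination of these
  elements whose brackets with all generators vanish at \<open>p\<close> has zero coefficients
  (\<open>radical_trivial\<close>).  Since elements of the square of the maximal ideal have such brackets, this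
  one computation gives both that the \<open>n\<close> elements are a basis, hence smoothness, and that the
  bivector is non-degenerate.
\<close>

section \<open>Laurent polynomials and their gradings\<close>

lemma const_0 [simp]: "const 0 = 0"
  by (simp add: const_def Zero_fract_def)

lemma const_1 [simp]: "const 1 = 1"
  by (simp add: const_def One_fract_def)

lemma const_add: "const (a + b) = const a + const b"
  by (simp add: const_def single_add)

lemma const_mult: "const (a * b) = const a * const b"
  by (simp add: const_def mult_single)

lemma const_minus: "const (- a) = - const a"
  using const_add[of a "- a"] by (simp add: eq_neg_iff_add_eq_0 add.commute)

lemma const_diff: "const (a - b) = const a - const b"
  using const_add[of a "- b"] by (simp add: const_minus)

lemma const_eq_0_iff [simp]: "const c = (0 :: 'n::{finite,linorder} ratfun) \<longleftrightarrow> c = 0"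
  by (simp add: const_def Zero_fract_def eq_fract) (metis lookup_single_eq lookup_zero single_zero)

lemma const_of_nat: "const (of_nat k) = of_nat k"
  by (induction k) (simp_all add: const_add)

lemma const_of_int: "const (of_int k) = of_int k"
  by (cases k) (simp_all add: const_of_nat const_minus const_add const_diff)

lemma const_sum: "const (sum f S) = (\<Sum>i\<in>S. const (f i))"
  by (induction S rule: infinite_finite_induct) (simp_all add: const_add)

global_interpretation cvs: vector_space "\<lambda>c (f :: 'n::{finite,linorder} ratfun). const c * f"
  by unfold_locales (simp_all add: const_add const_mult algebra_simps)

definition lmon :: "('n::finite \<Rightarrow> 'a::field) \<Rightarrow> (int, 'n) vec \<Rightarrow> 'a" where
  "lmon y e = (\<Prod>j\<in>UNIV. y j powi (e $ j))"

lemma lmon_0 [simp]: "lmon y 0 = 1"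
  by (simp add: lmon_def)

lemma lmon_add:
  assumes "\<And>j. y j \<noteq> 0"
  shows "lmon y (e + e') = lmon y e * lmon y e'"
  using assms by (simp add: lmon_def power_int_add prod.distrib)

lemma lmon_minus: "lmon y (- e) = inverse (lmon y e)"
  by (simp add: lmon_def power_int_minus flip: prod_inversef)

lemma lmon_axis: "lmon y (axis j m) = y j powi m"
proof -
  have "lmon y (axis j m) = (\<Prod>i\<in>UNIV. if i = j then y j powi m else 1)"
    unfolding lmon_def by (rule prod.cong) (auto simp: axis_def)
  then show ?thesis by simp
qed

lemma lmon_nonzero: "(\<And>j. y j \<noteq> 0) \<Longrightarrow> lmon y e \<noteq> 0"
  by (simp add: lmon_def)

definition laurent ::
    "('n::{finite,linorder} \<Rightarrow> 'n ratfun) \<Rightarrow> (int, 'n) vec set \<Rightarrow> 'n ratfun set" where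
  "laurent y E = cvs.span (lmon y ` E)"

lemma laurent_lmon: "e \<in> E \<Longrightarrow> lmon y e \<in> laurent y E"
  by (simp add: laurent_def cvs.span_base)

lemma laurent_0 [simp]: "0 \<in> laurent y E"
  by (simp add: laurent_def cvs.span_zero)

lemma laurent_add: "f \<in> laurent y E \<Longrightarrow> g \<in> laurent y E \<Longrightarrow> f + g \<in> laurent y E"
  by (simp add: laurent_def cvs.span_add)

lemma laurent_diff: "f \<in> laurent y E \<Longrightarrow> g \<in> laurent y E \<Longrightarrow> f - g \<in> laurent y E"
  by (simp add: laurent_def cvs.span_diff)

lemma laurent_scale: "f \<in> laurent y E \<Longrightarrow> const c * f \<in> laurent y E"
  by (simp add: laurent_def cvs.span_scale)

lemma laurent_sum: "(\<And>i. i \<in> S \<Longrightarrow> f i \<in> laurent y E) \<Longrightarrow> sum f S \<in> laurent y E"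
  by (simp add: laurent_def cvs.span_sum)

lemma laurent_mono: "E \<subseteq> E' \<Longrightarrow> laurent y E \<subseteq> laurent y E'"
  unfolding laurent_def by (intro cvs.span_mono image_mono)

lemma laurent_1: "0 \<in> E \<Longrightarrow> 1 \<in> laurent y E"
  using laurent_lmon[of 0 E y] by simp

lemma laurent_explicit:
  "f \<in> laurent y E \<longleftrightarrow>
     (\<exists>S c. finite S \<and> S \<subseteq> E \<and> f = (\<Sum>e\<in>S. const (c e) * lmon y e))"
proof
  assume "f \<in> laurent y E"
  then obtain t r where t: "finite t" "t \<subseteq> lmon y ` E" and f: "f = (\<Sum>a\<in>t. const (r a) * a)"
    unfolding laurent_def cvs.span_explicit by blast
  obtain S where S: "S \<subseteq> E" "inj_on (lmon y) S" "t = lmon y ` S"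
    using t(2) by (auto simp: subset_image_inj)
  have "finite S" using t S finite_imageD by blast
  moreover have "f = (\<Sum>e\<in>S. const (r (lmon y e)) * lmon y e)"
    unfolding f S(3) by (simp add: sum.reindex[OF S(2)])
  ultimately show "\<exists>S c. finite S \<and> S \<subseteq> E \<and> f = (\<Sum>e\<in>S. const (c e) * lmon y e)"
    using S(1) by (intro exI[of _ S] exI[of _ "\<lambda>e. r (lmon y e)"]) auto
next
  assume "\<exists>S c. finite S \<and> S \<subseteq> E \<and> f = (\<Sum>e\<in>S. const (c e) * lmon y e)"
  then show "f \<in> laurent y E"
    by (auto intro!: laurent_sum laurent_scale laurent_lmon)
qed

lemma laurent_mult:
  assumes y: "\<And>j. y j \<noteq> 0" and f: "f \<in> laurent y E" and g: "g \<in> laurent y E'"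
    and EE: "\<And>e e'. e \<in> E \<Longrightarrow> e' \<in> E' \<Longrightarrow> e + e' \<in> E''"
  shows "f * g \<in> laurent y E''"
proof -
  obtain S c where S: "finite S" "S \<subseteq> E" "f = (\<Sum>e\<in>S. const (c e) * lmon y e)"
    using f laurent_explicit[of f y E] by blast
  obtain S' c' where S': "finite S'" "S' \<subseteq> E'" "g = (\<Sum>e\<in>S'. const (c' e) * lmon y e)"
    using g laurent_explicit[of g y E'] by blast
  have "f * g = (\<Sum>e\<in>S. \<Sum>e'\<in>S'. const (c e * c' e') * lmon y (e + e'))"
    unfolding S(3) S'(3) sum_product
    by (intro sum.cong refl) (simp only: const_mult lmon_add[OF y] mult_ac)
  then show ?thesis
    using S S' EE by (auto intro!: laurent_sum laurent_scale laurent_lmon)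
qed

text \<open>
  Algebraic independence of a cluster, in the form that is used: the coefficients of Laurent
  polynomials in \<open>y\<close> can be compared.
\<close>

definition torus :: "('n::{finite,linorder} \<Rightarrow> 'n ratfun) \<Rightarrow> bool" where
  "torus y \<longleftrightarrow> (\<forall>j. y j \<noteq> 0) \<and>
     (\<forall>S c. finite S \<longrightarrow> (\<Sum>e\<in>S. const (c e) * lmon y e) = 0 \<longrightarrow> (\<forall>e\<in>S. c e = 0))"

lemma torus_nonzero: "torus y \<Longrightarrow> y j \<noteq> 0"
  by (simp add: torus_def)

lemma torusD:
  "torus y \<Longrightarrow> finite S \<Longrightarrow> (\<Sum>e\<in>S. const (c e) * lmon y e) = 0 \<Longrightarrow> e \<in> S \<Longrightarrow> c e = 0"
  by (auto simp: torus_def)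

abbreviation grade :: "((int, 'n::finite) vec \<Rightarrow> 'g) \<Rightarrow> 'g \<Rightarrow> (int, 'n) vec set" where
  "grade w g \<equiv> {e. w e = g}"

text \<open>
  Every additive weight \<open>w\<close> on exponents grades the Laurent polynomials.  The family of components
  is defined for all weights, with value 0 outside a finite set, so that components can be shifted
  and families with different supports can be compared.
\<close>

lemma laurent_decompose:
  assumes "f \<in> laurent y E"
  obtains G \<phi> where "finite G" "\<And>g. g \<notin> G \<Longrightarrow> \<phi> g = 0"
    "\<And>g. \<phi> g \<in> laurent y (E \<inter> grade w g)" "f = (\<Sum>g\<in>G. \<phi> g)"
proof -
  obtain S c where S: "finite S" "S \<subseteq> E" and f: "f = (\<Sum>e\<in>S. const (c e) * lmon y e)"
    using assms laurent_explicit[of f y E] by blast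
  define \<phi> where "\<phi> g = (\<Sum>e\<in>{e\<in>S. w e = g}. const (c e) * lmon y e)" for g
  show thesis
  proof (rule that[of "w ` S" \<phi>])
    show "\<phi> g = 0" if "g \<notin> w ` S" for g
      unfolding \<phi>_def by (rule sum.neutral) (use that in auto)
    show "\<phi> g \<in> laurent y (E \<inter> grade w g)" for g
      unfolding \<phi>_def using S by (auto intro!: laurent_sum laurent_scale laurent_lmon)
    show "f = (\<Sum>g\<in>w ` S. \<phi> g)"
      unfolding f \<phi>_def by (rule sum.group[symmetric]) (use S in auto)
  qed (use S in auto)
qed

text \<open>
  Different weights have disjoint sets of monomials, so a linear relation between Laurent
  monomials splits by weight.
\<close>

lemma graded_sum_eq_0:
  assumes y: "torus y" and G: "finite G"
    and \<phi>: "\<And>g. g \<in> G \<Longrightarrow> \<phi> g \<in> laurent y (grade w g)"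
    and sum0: "(\<Sum>g\<in>G. \<phi> g) = 0" and g: "g \<in> G"
  shows "\<phi> g = 0"
proof -
  have "\<forall>g\<in>G. \<exists>S. \<exists>c. finite S \<and> S \<subseteq> grade w g \<and> \<phi> g = (\<Sum>e\<in>S. const (c e) * lmon y e)"
    using \<phi> unfolding laurent_explicit by blast
  then obtain S where "\<forall>g\<in>G. \<exists>c. finite (S g) \<and> S g \<subseteq> grade w g \<and>
      \<phi> g = (\<Sum>e\<in>S g. const (c e) * lmon y e)"
    by (rule bchoice[THEN exE])
  then obtain c where Sc: "\<forall>g\<in>G. finite (S g) \<and> S g \<subseteq> grade w g \<and>
      \<phi> g = (\<Sum>e\<in>S g. const (c g e) * lmon y e)"
    by (rule bchoice[THEN exE])
  then have S: "\<And>g. g \<in> G \<Longrightarrow> finite (S g)" "\<And>g. g \<in> G \<Longrightarrow> S g \<subseteq> grade w g"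
    and \<phi>_eq: "\<And>g. g \<in> G \<Longrightarrow> \<phi> g = (\<Sum>e\<in>S g. const (c g e) * lmon y e)"
    by blast+
  have "(\<Sum>e\<in>(\<Union>g\<in>G. S g). const (c (w e) e) * lmon y e)
      = (\<Sum>g\<in>G. \<Sum>e\<in>S g. const (c (w e) e) * lmon y e)"
  proof (rule sum.UNION_disjoint)
    show "\<forall>i\<in>G. \<forall>j\<in>G. i \<noteq> j \<longrightarrow> S i \<inter> S j = {}"
    proof (intro ballI impI)
      fix i j assume "i \<in> G" "j \<in> G" "i \<noteq> j"
      then show "S i \<inter> S j = {}" using S(2)[of i] S(2)[of j] by auto
    qed
  qed (use G S(1) in auto)
  also have "\<dots> = (\<Sum>g\<in>G. \<phi> g)"
    using S(2) by (intro sum.cong refl) (auto simp: \<phi>_eq intro!: sum.cong)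
  finally have "(\<Sum>e\<in>(\<Union>g\<in>G. S g). const (c (w e) e) * lmon y e) = 0"
    using sum0 by simp
  then have c0: "c (w e) e = 0" if "e \<in> (\<Union>g\<in>G. S g)" for e
    using torusD[OF y, of "\<Union>g\<in>G. S g" "\<lambda>e. c (w e) e" e] that G S(1) by blast
  have "const (c g e) * lmon y e = 0" if "e \<in> S g" for e
    using c0[of e] that g S(2)[OF g] by auto
  then show ?thesis
    unfolding \<phi>_eq[OF g] by (intro sum.neutral) blast
qed

lemma graded_unique:
  assumes y: "torus y" and G: "finite G"
    and "\<And>g. g \<in> G \<Longrightarrow> \<phi> g \<in> laurent y (grade w g)"
    and "\<And>g. g \<in> G \<Longrightarrow> \<psi> g \<in> laurent y (grade w g)"
    and "(\<Sum>g\<in>G. \<phi> g) = (\<Sum>g\<in>G. \<psi> g)" and g: "g \<in> G"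
  shows "\<phi> g = \<psi> g"
  using graded_sum_eq_0[OF y G, of "\<lambda>g. \<phi> g - \<psi> g" w g] assms
  by (simp add: laurent_diff sum_subtractf)

text \<open>
  A substitute for unique factorization: \<open>1 + y\<^sup>b\<close> is coprime to every \<open>Q\<close> of weight 0.  The
  components of weight \<open>m\<close> in the equation satisfy \<open>h\<^sub>m + y\<^sup>b h\<^sub>m\<^sub>-\<^sub>1 = Q g\<^sub>m\<close>, so \<open>Q\<close> divides \<open>h\<^sub>m\<close> if it
  divides \<open>h\<^sub>m\<^sub>-\<^sub>1\<close>, and \<open>h\<^sub>m\<^sub>-\<^sub>k = 0\<close> for some \<open>k\<close>, because \<open>h\<close> has only finitely many components.
\<close>

lemma graded_cancel:
  fixes w :: "(int, 'n::{finite,linorder}) vec \<Rightarrow> rat"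
  assumes y: "torus y" and w: "\<And>e e'. w (e + e') = w e + w e'"
    and Q: "Q \<in> laurent y (grade w 0)" and b: "w b = 1"
    and h: "h \<in> laurent y UNIV" and g: "g \<in> laurent y UNIV"
    and eq: "(1 + lmon y b) * h = Q * g"
  shows "\<exists>g'\<in>laurent y UNIV. h = Q * g'"
proof -
  note nz = torus_nonzero[OF y]
  obtain G \<phi> where G: "finite G" "\<And>m. m \<notin> G \<Longrightarrow> \<phi> m = 0"
    "\<And>m. \<phi> m \<in> laurent y (UNIV \<inter> grade w m)" "h = (\<Sum>m\<in>G. \<phi> m)"
    by (rule laurent_decompose[OF h, of w]) blast
  obtain G' \<gamma> where G': "finite G'" "\<And>m. m \<notin> G' \<Longrightarrow> \<gamma> m = 0"
    "\<And>m. \<gamma> m \<in> laurent y (UNIV \<inter> grade w m)" "g = (\<Sum>m\<in>G'. \<gamma> m)"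
    by (rule laurent_decompose[OF g, of w]) blast
  define H where "H = G \<union> G' \<union> (\<lambda>m. m + 1) ` G"
  have H: "finite H" using G G' by (simp add: H_def)
  have sum_h: "(\<Sum>m\<in>H. \<phi> m) = h"
    unfolding G(4) by (rule sum.mono_neutral_right) (use G(2) H in \<open>auto simp: H_def\<close>)
  have sum_g: "(\<Sum>m\<in>H. \<gamma> m) = g"
    unfolding G'(4) by (rule sum.mono_neutral_right) (use G'(2) H in \<open>auto simp: H_def\<close>)
  have "(\<Sum>m\<in>H. \<phi> (m - 1)) = (\<Sum>m\<in>(\<lambda>m. m + 1) ` G. \<phi> (m - 1))"
  proof (rule sum.mono_neutral_right)
    show "\<forall>m\<in>H - (\<lambda>m. m + 1) ` G. \<phi> (m - 1) = 0"
    proof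
      fix m assume "m \<in> H - (\<lambda>m. m + 1) ` G"
      then have "m - 1 \<notin> G" by (metis DiffE diff_add_cancel image_eqI)
      then show "\<phi> (m - 1) = 0" using G(2) by blast
    qed
  qed (use H in \<open>auto simp: H_def\<close>)
  also have "\<dots> = h"
    unfolding G(4) by (subst sum.reindex) auto
  finally have shift: "(\<Sum>m\<in>H. \<phi> (m - 1)) = h" .
  have total: "(\<Sum>m\<in>H. \<phi> m + lmon y b * \<phi> (m - 1)) = (\<Sum>m\<in>H. Q * \<gamma> m)"
    using eq by (simp add: sum.distrib sum_h sum_g shift algebra_simps flip: sum_distrib_left)
  have step: "\<phi> m + lmon y b * \<phi> (m - 1) = Q * \<gamma> m" for m
  proof (cases "m \<in> H")
    case True
    show ?thesis
    proof (rule graded_unique[OF y H _ _ total True])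
      fix m
      have "lmon y b * \<phi> (m - 1) \<in> laurent y (grade w m)"
        by (rule laurent_mult[OF nz laurent_lmon[of b "{b}"] G(3)[of "m - 1"]]) (auto simp: w b)
      then show "\<phi> m + lmon y b * \<phi> (m - 1) \<in> laurent y (grade w m)"
        using G(3)[of m] by (auto intro: laurent_add)
      show "Q * \<gamma> m \<in> laurent y (grade w m)"
        by (rule laurent_mult[OF nz Q G'(3)[of m]]) (auto simp: w)
    qed
  next
    case False
    then have "m - 1 \<notin> G" by (metis H_def UnCI diff_add_cancel image_eqI)
    then show ?thesis using False G(2) G'(2) by (auto simp: H_def)
  qed
  have *: "\<phi> (m - of_nat k) = 0 \<Longrightarrow> \<exists>t\<in>laurent y UNIV. \<phi> m = Q * t" for m k
  proof (induction k arbitrary: m)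
    case 0
    then show ?case by (auto intro!: bexI[of _ 0])
  next
    case (Suc k)
    have "\<phi> (m - 1 - of_nat k) = 0"
      using Suc.prems by (simp add: algebra_simps)
    then obtain t where t: "t \<in> laurent y UNIV" "\<phi> (m - 1) = Q * t"
      using Suc.IH[of "m - 1"] by blast
    have "lmon y b * t \<in> laurent y UNIV"
      by (rule laurent_mult[OF nz laurent_lmon[of b UNIV] t(1)]) auto
    moreover have "\<gamma> m \<in> laurent y UNIV" using G'(3)[of m] laurent_mono[of _ UNIV y] by blast
    moreover have "\<phi> m = Q * (\<gamma> m - lmon y b * t)"
      using step[of m] t(2) by (simp add: algebra_simps eq_diff_eq)
    ultimately show ?case by (blast intro: laurent_diff)
  qed
  have "\<exists>t\<in>laurent y UNIV. \<phi> m = Q * t" for m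
  proof -
    have "\<not> range (\<lambda>k::nat. m - of_nat k) \<subseteq> G"
      using G(1) finite_subset range_inj_infinite[of "\<lambda>k::nat. m - of_nat k"]
      by (auto simp: inj_def)
    then obtain k :: nat where "m - of_nat k \<notin> G" by blast
    then show ?thesis using G(2) * by blast
  qed
  then obtain t where t: "\<And>m. t m \<in> laurent y UNIV" "\<And>m. \<phi> m = Q * t m" by metis
  show ?thesis
    by (rule bexI[of _ "\<Sum>m\<in>G. t m"]) (auto simp: G(4) t(2) sum_distrib_left intro: laurent_sum t)
qed

section \<open>Mutation of seeds\<close>

lemma lmon_scale: "lmon y (m *s e) = lmon y e powi m"
proof -
  have "(\<Prod>j\<in>S. y j powi (m * e $ j)) = (\<Prod>j\<in>S. y j powi (e $ j)) powi m" for S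
    by (induction S rule: infinite_finite_induct)
      (simp_all add: power_int_mult_distrib mult.commute[of m] power_int_mult)
  then show ?thesis by (simp add: lmon_def)
qed

definition posp :: "(int, 'n::finite) vec \<Rightarrow> (int, 'n) vec" where
  "posp v = (\<chi> j. max (v $ j) 0)"

definition negp :: "(int, 'n::finite) vec \<Rightarrow> (int, 'n) vec" where
  "negp v = (\<chi> j. max (- v $ j) 0)"

lemma posp_nth [simp]: "posp v $ j = max (v $ j) 0"
  by (simp add: posp_def)

lemma negp_nth [simp]: "negp v $ j = max (- v $ j) 0"
  by (simp add: negp_def)

lemma posp_eq: "posp v = v + negp v"
  by (simp add: vec_eq_iff max_def)

lemma posp_uminus: "posp (- v) = negp v" and negp_uminus: "negp (- v) = posp v"
  by (simp_all add: vec_eq_iff)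

lemma exchange_poly_lmon:
  "exchange_poly y C k = lmon y (posp (C $ k)) + lmon y (negp (C $ k))"
proof -
  have "y j powi max b 0 = y j ^ nat (max b 0)" for b and j by (simp add: power_int_nonneg_exp)
  moreover have "- min b 0 = max (- b) (0::int)" for b by simp
  ultimately show ?thesis
    by (simp add: exchange_poly_def lmon_def)
qed

text \<open>
  Up to a monomial, which is a unit, the exchange polynomial is a binomial in the single Laurent
  monomial given by a row of the matrix.  All divisibility arguments use this binomial.
\<close>

lemma exchange_poly_factor:
  assumes "\<And>j. y j \<noteq> 0"
  shows "exchange_poly y C k = lmon y (negp (C $ k)) * (1 + lmon y (C $ k))"
  by (simp add: exchange_poly_lmon posp_eq lmon_add[OF assms] distrib_left)

lemma mutate_cluster_same: "mutate_cluster k y C k = exchange_poly y C k / y k"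
  by (simp add: mutate_cluster_def)

lemma mutate_cluster_other: "j \<noteq> k \<Longrightarrow> mutate_cluster k y C j = y j"
  by (simp add: mutate_cluster_def)

text \<open>
  The effect of mutation in direction \<open>k\<close> on the exponents of monomials when powers of the exchange
  binomial are disregarded; \<open>v\<close> is the \<open>k\<close>-th row of the matrix.
\<close>

definition reflect_exponent ::
    "'n::finite \<Rightarrow> (int, 'n) vec \<Rightarrow> (int, 'n) vec \<Rightarrow> (int, 'n) vec" where
  "reflect_exponent k v e = (\<chi> j. if j = k then - e $ k else e $ j + e $ k * max (- v $ j) 0)"

lemma reflect_exponent_same [simp]: "reflect_exponent k v e $ k = - e $ k"
  by (simp add: reflect_exponent_def)

lemma reflect_exponent_involutive [simp]:
  "reflect_exponent k v (reflect_exponent k v e) = e"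
  by (simp add: vec_eq_iff reflect_exponent_def)

text \<open>
  The mutated variable itself is a Laurent monomial times the exchange binomial; the formula
  collects the exponents.
\<close>

lemma lmon_mutate_cluster:
  assumes y: "\<And>j. y j \<noteq> 0" and k: "C $ k $ k = 0"
  shows "lmon (mutate_cluster k y C) e =
    lmon y (reflect_exponent k (C $ k) e) * (1 + lmon y (C $ k)) powi (e $ k)"
proof -
  let ?h = "1 + lmon y (C $ k)"
  define z where "z = lmon y (negp (C $ k) + axis k (- 2)) * ?h"
  have "lmon y (axis k (- 2)) = inverse (y k * y k)"
    by (simp add: lmon_axis power_int_minus power2_eq_square)
  then have z: "mutate_cluster k y C k = y k * z"
    using y[of k] unfolding mutate_cluster_same exchange_poly_factor[OF y] z_def lmon_add[OF y]
    by (simp add: divide_inverse mult_ac)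
  have "lmon (mutate_cluster k y C) e = (\<Prod>j\<in>UNIV. y j powi (e $ j) * (if j = k then z powi (e $ k) else 1))"
    unfolding lmon_def
    by (rule prod.cong) (auto simp: z mutate_cluster_other power_int_mult_distrib)
  also have "\<dots> = lmon y e * z powi (e $ k)"
    by (simp add: prod.distrib lmon_def)
  also have "\<dots> = lmon y e * lmon y ((e $ k) *s (negp (C $ k) + axis k (- 2))) * ?h powi (e $ k)"
    by (simp add: z_def power_int_mult_distrib lmon_scale)
  also have "lmon y e * lmon y ((e $ k) *s (negp (C $ k) + axis k (- 2)))
      = lmon y (e + (e $ k) *s (negp (C $ k) + axis k (- 2)))"
    by (simp add: lmon_add[OF y])
  also have "e + (e $ k) *s (negp (C $ k) + axis k (- 2)) = reflect_exponent k (C $ k) e"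
    using k by (auto simp: vec_eq_iff reflect_exponent_def axis_def)
  finally show ?thesis .
qed

lemma binomial_nonzero:
  assumes y: "torus y"
  shows "1 + lmon y b \<noteq> 0"
proof
  assume eq: "1 + lmon y b = 0"
  show False
  proof (cases "b = 0")
    case True
    then have "const (1 + 1) = (0 :: 'a ratfun)" using eq unfolding const_add by simp
    then show False unfolding const_eq_0_iff by simp
  next
    case False
    then have "(\<Sum>e\<in>{0, b}. const 1 * lmon y e) = 0" using eq by simp
    then show False using torusD[OF y, of "{0, b}" "\<lambda>_. 1" 0] by simp
  qed
qed

lemma exchange_poly_nonzero: "torus y \<Longrightarrow> exchange_poly y C k \<noteq> 0"
  using exchange_poly_factor[of y C k] binomial_nonzero[of y "C $ k"] lmon_nonzero[of y]
  by (simp add: torus_nonzero)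

lemma mutate_cluster_nonzero: "torus y \<Longrightarrow> mutate_cluster k y C j \<noteq> 0"
  by (simp add: mutate_cluster_def exchange_poly_nonzero torus_nonzero)

lemma binomial_power_grade:
  assumes y: "\<And>j. y j \<noteq> 0" and w: "\<And>e e'. w (e + e') = w e + (w e' :: 'g::ab_group_add)"
    and b: "w b = 0"
  shows "(1 + lmon y b) ^ n \<in> laurent y (grade w 0)"
proof (induction n)
  have w0: "w 0 = 0" using w[of 0 0] by simp
  {
    case 0
    then show ?case by (simp add: laurent_1 w0)
  next
    case (Suc n)
    have "1 + lmon y b \<in> laurent y (grade w 0)"
      using b w0 by (intro laurent_add laurent_1 laurent_lmon) auto
    then show ?case
      using laurent_mult[OF y _ Suc.IH, of "1 + lmon y b" "grade w 0" "grade w 0"] by (simp add: w)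
  }
qed

lemma laurent_mutate_explicit:
  assumes y: "\<And>j. y j \<noteq> 0" and k: "C $ k $ k = 0"
    and f: "f \<in> laurent (mutate_cluster k y C) UNIV"
  obtains S c where "finite S"
    "f = (\<Sum>e\<in>S. const (c e) * (lmon y e * (1 + lmon y (C $ k)) powi (- (e $ k))))"
proof -
  let ?r = "reflect_exponent k (C $ k)"
  obtain S c where S: "finite S" "f = (\<Sum>e\<in>S. const (c e) * lmon (mutate_cluster k y C) e)"
    using f unfolding laurent_explicit by blast
  have inj: "inj_on ?r S" by (rule inj_on_inverseI[of _ ?r]) simp
  show thesis
  proof (rule that[of "?r ` S" "\<lambda>e. c (?r e)"])
    show "f = (\<Sum>e\<in>?r ` S. const (c (?r e)) * (lmon y e * (1 + lmon y (C $ k)) powi (- (e $ k))))"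
      unfolding S(2) sum.reindex[OF inj] by (simp add: lmon_mutate_cluster[OF y k])
  qed (use S in simp)
qed

text \<open>
  Regularity in the chart mutated at \<open>k\<close> is a divisibility condition: the coefficient of \<open>y\<^sub>k\<close> to
  the power \<open>-m\<close> contains the \<open>m\<close>-th power of the exchange binomial.  The grading has to determine the
  exponent of \<open>y\<^sub>k\<close> (this is \<open>\<kappa>\<close>) and to give the binomial weight 0, so that multiplication by it does
  not mix components.
\<close>

lemma chart_component:
  fixes w :: "(int, 'n::{finite,linorder}) vec \<Rightarrow> 'g::ab_group_add"
  assumes y: "torus y" and k: "C $ k $ k = 0"
    and w: "\<And>e e'. w (e + e') = w e + w e'" and wb: "w (C $ k) = 0"
    and \<kappa>: "\<And>e. \<kappa> (w e) = e $ k"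
    and S: "finite S" "(\<Sum>g\<in>G. \<phi> g) =
      (\<Sum>e\<in>S. const (c e) * (lmon y e * (1 + lmon y (C $ k)) powi (- (e $ k))))"
    and G: "finite G" "\<And>g. g \<notin> G \<Longrightarrow> \<phi> g = 0" "\<And>g. \<phi> g \<in> laurent y (grade w g)"
  shows "\<phi> g = (1 + lmon y (C $ k)) powi (- \<kappa> g) *
    (\<Sum>e\<in>{e\<in>S. w e = g}. const (c e) * lmon y e)"
proof -
  note nz = torus_nonzero[OF y]
  let ?h = "1 + lmon y (C $ k)"
  have h: "?h \<noteq> 0" by (rule binomial_nonzero[OF y])
  define \<psi> where "\<psi> g = (\<Sum>e\<in>{e\<in>S. w e = g}. const (c e) * lmon y e)" for g
  \<comment> \<open>The \<open>N\<close>-th power of the binomial clears all denominators.\<close>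
  define N where "N = Max ((\<lambda>e. \<bar>e $ k\<bar>) ` S \<union> {0})"
  have N: "\<bar>e $ k\<bar> \<le> N" if "e \<in> S" for e
    unfolding N_def using S(1) that by (intro Max_ge) auto
  have N0: "N \<ge> 0" unfolding N_def using S(1) by (intro Max_ge) auto
  define H where "H = G \<union> w ` S"
  have H: "finite H" using G S by (simp add: H_def)
  have hN: "?h powi m \<in> laurent y (grade w 0)" if "m \<ge> 0" for m
    using binomial_power_grade[OF nz w wb] that by (simp add: power_int_nonneg_exp)
  have \<psi>_grade: "\<psi> g \<in> laurent y (grade w g)" for g
    unfolding \<psi>_def by (intro laurent_sum laurent_scale laurent_lmon) auto
  have \<psi>0: "\<psi> g = 0" if "g \<notin> w ` S" for g
    unfolding \<psi>_def by (rule sum.neutral) (use that in auto)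
  define \<rho> where "\<rho> g = (if g \<in> w ` S then ?h powi (N - \<kappa> g) * \<psi> g else 0)" for g
  have \<rho>_grade: "\<rho> g \<in> laurent y (grade w g)" for g
  proof (cases "g \<in> w ` S")
    case True
    then obtain e where "e \<in> S" "g = w e" by blast
    then have "N - \<kappa> g \<ge> 0" using N[of e] \<kappa>[of e] by simp
    from laurent_mult[OF nz hN[OF this] \<psi>_grade, of g] True show ?thesis
      by (simp add: \<rho>_def w)
  qed (simp add: \<rho>_def)
  have "(\<Sum>g\<in>H. ?h powi N * \<phi> g) = ?h powi N * (\<Sum>g\<in>G. \<phi> g)"
    unfolding sum_distrib_left
    by (rule sum.mono_neutral_right) (use G H in \<open>auto simp: H_def\<close>)
  also have "\<dots> = (\<Sum>e\<in>S. const (c e) * (lmon y e * (?h powi N * ?h powi (- (e $ k)))))"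
    unfolding S(2) sum_distrib_left by (simp only: mult_ac)
  also have "\<dots> = (\<Sum>e\<in>S. const (c e) * (lmon y e * (?h powi (N - e $ k))))"
    using h by (simp flip: power_int_add)
  also have "\<dots> = (\<Sum>g\<in>w ` S. \<Sum>e\<in>{e\<in>S. w e = g}. const (c e) * (lmon y e * (?h powi (N - e $ k))))"
    by (rule sum.group[symmetric]) (use S in auto)
  also have "\<dots> = (\<Sum>g\<in>w ` S. \<rho> g)"
    unfolding \<rho>_def \<psi>_def sum_distrib_left
    by (intro sum.cong refl) (auto simp: \<kappa>[symmetric] mult_ac sum_distrib_left intro!: sum.cong)
  also have "\<dots> = (\<Sum>g\<in>H. \<rho> g)"
    by (rule sum.mono_neutral_left) (use H in \<open>auto simp: H_def \<rho>_def\<close>)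
  finally have eq: "(\<Sum>g\<in>H. ?h powi N * \<phi> g) = (\<Sum>g\<in>H. \<rho> g)" .
  have "?h powi N * \<phi> g = \<rho> g"
  proof (cases "g \<in> H")
    case True
    show ?thesis
    proof (rule graded_unique[OF y H _ \<rho>_grade eq True])
      fix g show "?h powi N * \<phi> g \<in> laurent y (grade w g)"
        by (rule laurent_mult[OF nz hN[OF N0] G(3)]) (simp add: w)
    qed
  next
    case False
    then show ?thesis using G(2) by (auto simp: H_def \<rho>_def)
  qed
  also have "\<rho> g = ?h powi N * (?h powi (- \<kappa> g) * \<psi> g)"
    using h \<psi>0[of g] by (auto simp: \<rho>_def mult.assoc[symmetric] simp flip: power_int_add)
  finally show ?thesis
    using h by (simp add: \<psi>_def)
qed

text \<open>
  A relation between the new monomials, graded by the exponent of \<open>y\<^sub>k\<close>, becomes a family of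
  relations between the old ones, each multiplied by a power of the exchange binomial.
\<close>

lemma torus_mutate:
  assumes y: "torus y" and k: "C $ k $ k = 0"
  shows "torus (mutate_cluster k y C)"
  unfolding torus_def
proof (intro conjI allI impI ballI)
  let ?r = "reflect_exponent k (C $ k)"
  show "mutate_cluster k y C j \<noteq> 0" for j by (rule mutate_cluster_nonzero[OF y])
  fix S c e
  assume S: "finite S" "(\<Sum>e\<in>S. const (c e) * lmon (mutate_cluster k y C) e) = 0" and e: "e \<in> S"
  have inj: "inj_on ?r S" by (rule inj_on_inverseI[of _ ?r]) simp
  have "(\<Sum>g\<in>({} :: int set). 0) =
    (\<Sum>e\<in>?r ` S. const (c (?r e)) * (lmon y e * (1 + lmon y (C $ k)) powi (- (e $ k))))"
    using S(2) unfolding sum.reindex[OF inj] by (simp add: lmon_mutate_cluster[OF torus_nonzero[OF y] k])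
  from chart_component[OF y k _ _ _ _ this, of "\<lambda>e. e $ k" id "?r e $ k"] k S(1)
  have "(\<Sum>e\<in>{d \<in> ?r ` S. d $ k = ?r e $ k}. const (c (?r e)) * lmon y e) = 0"
    using binomial_nonzero[OF y] by simp
  from torusD[OF y _ this, of "?r e"] S(1) e show "c e = 0" by simp
qed


definition good_seed :: "('n::{finite,linorder} \<Rightarrow> 'n ratfun) \<Rightarrow> 'n int_matrix \<Rightarrow> bool" where
  "good_seed y C \<longleftrightarrow> skew_symmetric C \<and> invertible (rat_matrix C) \<and> torus y"

lemma skew_symmetric_iff: "skew_symmetric C \<longleftrightarrow> (\<forall>i j. C $ i $ j = - C $ j $ i)"
  by (auto simp: skew_symmetric_def vec_eq_iff transpose_def)

lemma skew_nth: "skew_symmetric C \<Longrightarrow> C $ i $ j = - C $ j $ i"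
  unfolding skew_symmetric_iff by blast

lemma skew_diag: "skew_symmetric C \<Longrightarrow> C $ i $ i = 0"
  using skew_nth[of C i i] by simp

text \<open>
  With positive parts instead of absolute values the division by 2 disappears, and mutation is seen
  to consist of row and column operations and a change of sign.
\<close>

lemma mutate_matrix_nth:
  "mutate_matrix k C $ i $ j = (if i = k \<or> j = k then - C $ i $ j
     else C $ i $ j + max (C $ i $ k) 0 * C $ k $ j + C $ i $ k * max (- C $ k $ j) 0)"
proof -
  have "(\<bar>a\<bar> * c + a * \<bar>c\<bar>) div 2 = max a 0 * c + a * max (- c) 0" for a c :: int
    by (cases "a \<ge> 0"; cases "c \<ge> 0") (auto simp: abs_if max_def)
  then show ?thesis by (simp add: mutate_matrix_def)
qed

lemma mutate_matrix_skew:
  assumes "skew_symmetric C"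
  shows "skew_symmetric (mutate_matrix k C)"
  unfolding skew_symmetric_iff mutate_matrix_nth
proof (intro allI)
  fix i j
  have "max (C $ i $ k) 0 * C $ k $ j + C $ i $ k * max (- C $ k $ j) 0
     = - (max (C $ j $ k) 0 * C $ k $ i + C $ j $ k * max (- C $ k $ i) 0)"
    using skew_nth[OF assms, of j k] skew_nth[OF assms, of k i]
    by (auto simp: max_def algebra_simps)
  then show "(if i = k \<or> j = k then - C $ i $ j
         else C $ i $ j + max (C $ i $ k) 0 * C $ k $ j + C $ i $ k * max (- C $ k $ j) 0) =
     - (if j = k \<or> i = k then - C $ j $ i
         else C $ j $ i + max (C $ j $ k) 0 * C $ k $ i + C $ j $ k * max (- C $ k $ i) 0)"
    using skew_nth[OF assms, of i j] by auto
qed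

lemma invertible_iff_rows:
  assumes "skew_symmetric C"
  shows "invertible (rat_matrix C) \<longleftrightarrow>
    (\<forall>x. (\<forall>i. (\<Sum>j\<in>UNIV. x j * of_int (C $ j $ i)) = 0) \<longrightarrow> (\<forall>j. x j = (0::rat)))"
proof -
  have eq: "(rat_matrix C *v x) $ i = - (\<Sum>j\<in>UNIV. x $ j * of_int (C $ j $ i))" for x i
    unfolding matrix_vector_mult_def using skew_nth[OF assms, of i]
    by (simp add: map_matrix_def mult.commute flip: sum_negf)
  have "invertible (rat_matrix C) \<longleftrightarrow> (\<forall>x. rat_matrix C *v x = 0 \<longrightarrow> x = 0)"
    unfolding invertible_left_inverse by (rule matrix_left_invertible_ker)
  also have "\<dots> \<longleftrightarrow> (\<forall>x::(rat,'a) vec. (\<forall>i. (\<Sum>j\<in>UNIV. x $ j * of_int (C $ j $ i)) = 0) \<longrightarrow> (\<forall>j. x $ j = 0))"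
    by (simp add: vec_eq_iff eq)
  also have "\<dots> \<longleftrightarrow> (\<forall>x. (\<forall>i. (\<Sum>j\<in>UNIV. x j * of_int (C $ j $ i)) = 0) \<longrightarrow> (\<forall>j. x j = (0::rat)))"
  proof (intro iffI allI impI)
    fix x :: "'a \<Rightarrow> rat" and j
    assume "\<forall>x::(rat,'a) vec. (\<forall>i. (\<Sum>j\<in>UNIV. x $ j * of_int (C $ j $ i)) = 0) \<longrightarrow> (\<forall>j. x $ j = 0)"
      and "\<forall>i. (\<Sum>j\<in>UNIV. x j * of_int (C $ j $ i)) = 0"
    then show "x j = 0" by (auto dest!: spec[of _ "\<chi> j. x j"])
  next
    fix x :: "(rat, 'a) vec" and j
    assume "\<forall>x. (\<forall>i. (\<Sum>j\<in>UNIV. x j * of_int (C $ j $ i)) = 0) \<longrightarrow> (\<forall>j. x j = (0::rat))"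
      and "\<forall>i. (\<Sum>j\<in>UNIV. x $ j * of_int (C $ j $ i)) = 0"
    then show "x $ j = 0" by blast
  qed
  finally show ?thesis .
qed

text \<open>
  Let \<open>x\<close> be a row vector annihilated by the mutated matrix.  Its column \<open>k\<close> says that the entries of
  \<open>x\<close> other than \<open>x\<^sub>k\<close> annihilate the old column \<open>k\<close>.  Hence one of the two correction terms drops out
  of the other columns, and the other one amounts to a change of the entry \<open>x\<^sub>k\<close>; the changed vector
  is annihilated by \<open>C\<close>.
\<close>

lemma mutate_matrix_invertible:
  assumes C: "skew_symmetric C" and inv: "invertible (rat_matrix C)"
  shows "invertible (rat_matrix (mutate_matrix k C))"
  unfolding invertible_iff_rows[OF mutate_matrix_skew[OF C]]
proof (intro allI impI)
  fix x :: "'a \<Rightarrow> rat" and j0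
  let ?c = "\<lambda>i j. rat_of_int (C $ i $ j)"
  assume "\<forall>i. (\<Sum>j\<in>UNIV. x j * of_int (mutate_matrix k C $ j $ i)) = 0"
  then have x: "(\<Sum>j\<in>UNIV. x j * of_int (mutate_matrix k C $ j $ i)) = 0" for i by blast
  have ckk: "C $ k $ k = 0" by (rule skew_diag[OF C])
  define s where "s = (\<Sum>j\<in>UNIV - {k}. x j * of_int (max (C $ j $ k) 0))"
  \<comment> \<open>The sign of \<open>x k\<close> changes because mutation negates row \<open>k\<close>.\<close>
  define x' where "x' = x(k := s - x k)"
  have split: "(\<Sum>j\<in>UNIV. f j) = f k + (\<Sum>j\<in>UNIV - {k}. f j)" for f :: "'a \<Rightarrow> rat"
    by (simp add: sum.remove[of UNIV k])
  have colk: "(\<Sum>j\<in>UNIV - {k}. x j * ?c j k) = 0"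
    using x[of k] ckk unfolding split by (simp add: mutate_matrix_nth sum_negf)
  have "(\<Sum>j\<in>UNIV. x' j * ?c j i) = 0" for i
  proof (cases "i = k")
    case True
    then show ?thesis unfolding split using colk ckk by (simp add: x'_def)
  next
    case False
    have "0 = (\<Sum>j\<in>UNIV. x j * of_int (mutate_matrix k C $ j $ i))" using x by simp
    also have "\<dots> = - x k * ?c k i + (\<Sum>j\<in>UNIV - {k}. x j * ?c j i
        + x j * of_int (max (C $ j $ k) 0) * ?c k i + x j * ?c j k * of_int (max (- C $ k $ i) 0))"
    proof -
      have "(\<Sum>j\<in>UNIV - {k}. x j * of_int (mutate_matrix k C $ j $ i)) = (\<Sum>j\<in>UNIV - {k}. x j * ?c j i
        + x j * of_int (max (C $ j $ k) 0) * ?c k i + x j * ?c j k * of_int (max (- C $ k $ i) 0))"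
        by (rule sum.cong) (use False in \<open>auto simp: mutate_matrix_nth algebra_simps\<close>)
      then show ?thesis unfolding split by (simp add: mutate_matrix_nth)
    qed
    also have "\<dots> = - x k * ?c k i + (\<Sum>j\<in>UNIV - {k}. x j * ?c j i) + s * ?c k i
        + (\<Sum>j\<in>UNIV - {k}. x j * ?c j k) * of_int (max (- C $ k $ i) 0)"
      unfolding sum.distrib s_def sum_distrib_right by simp
    also have "\<dots> = (\<Sum>j\<in>UNIV. x' j * ?c j i)"
      unfolding split colk by (simp add: x'_def algebra_simps)
    finally show ?thesis by simp
  qed
  then have x'0: "x' j = 0" for j
    using inv unfolding invertible_iff_rows[OF C] by blast
  have "x j = 0" if "j \<noteq> k" for j using x'0[of j] that by (simp add: x'_def)
  moreover from this have "s = 0" by (simp add: s_def)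
  then have "x k = 0" using x'0[of k] by (simp add: x'_def)
  ultimately show "x j0 = 0" by (cases "j0 = k") auto
qed

lemma good_seed_mutate:
  "good_seed y C \<Longrightarrow> good_seed (mutate_cluster k y C) (mutate_matrix k C)"
  by (simp add: good_seed_def mutate_matrix_skew mutate_matrix_invertible torus_mutate skew_diag)

lemma mutate_matrix_involutive:
  "C $ k $ k = 0 \<Longrightarrow> mutate_matrix k (mutate_matrix k C) = C"
  by (auto simp: vec_eq_iff mutate_matrix_nth max_def algebra_simps)

lemma mutate_cluster_involutive:
  assumes y: "torus y" and k: "C $ k $ k = 0"
  shows "mutate_cluster k (mutate_cluster k y C) (mutate_matrix k C) = y"
proof -
  have "mutate_matrix k C $ k = - C $ k" by (simp add: vec_eq_iff mutate_matrix_nth)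
  moreover have "lmon (mutate_cluster k y C) e = lmon y e" if "e $ k = 0" for e
    unfolding lmon_def by (rule prod.cong) (use that in \<open>auto simp: mutate_cluster_def\<close>)
  ultimately have "exchange_poly (mutate_cluster k y C) (mutate_matrix k C) k = exchange_poly y C k"
    using k by (simp add: exchange_poly_lmon posp_uminus negp_uminus add.commute)
  then show ?thesis
    using exchange_poly_nonzero[OF y, of C k] torus_nonzero[OF y, of k]
    by (auto simp: mutate_cluster_def)
qed

section \<open>Lower bounds of acyclic seeds\<close>

abbreviation alg :: "'n::{finite,linorder} ratfun set \<Rightarrow> 'n ratfun set" where
  "alg S \<equiv> is_subalgebra hull S"

lemma is_subalgebra_alg: "is_subalgebra (alg S)"
  by (rule hull_in) (fastforce simp: is_subalgebra_def)

lemma sub_const: "is_subalgebra R \<Longrightarrow> const c \<in> R"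
  and sub_add: "is_subalgebra R \<Longrightarrow> f \<in> R \<Longrightarrow> g \<in> R \<Longrightarrow> f + g \<in> R"
  and sub_mult: "is_subalgebra R \<Longrightarrow> f \<in> R \<Longrightarrow> g \<in> R \<Longrightarrow> f * g \<in> R"
  by (auto simp: is_subalgebra_def)

lemma sub_0: "is_subalgebra R \<Longrightarrow> 0 \<in> R" and sub_1: "is_subalgebra R \<Longrightarrow> 1 \<in> R"
  using sub_const[of R 0] sub_const[of R 1] by auto

lemma sub_minus: "is_subalgebra R \<Longrightarrow> f \<in> R \<Longrightarrow> - f \<in> R"
  using sub_mult[of R "const (- 1)" f] sub_const[of R "- 1"] by (simp add: const_minus)

lemma sub_diff: "is_subalgebra R \<Longrightarrow> f \<in> R \<Longrightarrow> g \<in> R \<Longrightarrow> f - g \<in> R"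
  using sub_add[of R f "- g"] sub_minus[of R g] by simp

lemma sub_power: "is_subalgebra R \<Longrightarrow> f \<in> R \<Longrightarrow> f ^ n \<in> R"
  by (induction n) (auto intro: sub_1 sub_mult)

lemma sub_sum: "is_subalgebra R \<Longrightarrow> (\<And>i. i \<in> S \<Longrightarrow> f i \<in> R) \<Longrightarrow> sum f S \<in> R"
  by (induction S rule: infinite_finite_induct) (auto intro: sub_0 sub_add)

lemma sub_prod: "is_subalgebra R \<Longrightarrow> (\<And>i. i \<in> S \<Longrightarrow> f i \<in> R) \<Longrightarrow> prod f S \<in> R"
  by (induction S rule: infinite_finite_induct) (auto intro: sub_1 sub_mult)

lemma is_subalgebra_laurent:
  assumes "\<And>j. y j \<noteq> 0"
  shows "is_subalgebra (laurent y UNIV)"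
  unfolding is_subalgebra_def
proof (intro conjI ballI)
  show "range const \<subseteq> laurent y UNIV"
    using laurent_scale[OF laurent_1[of UNIV y]] by auto
qed (auto intro: laurent_add laurent_mult[OF assms])

lemma lmon_in_subalgebra:
  assumes R: "is_subalgebra R" and y: "\<And>j. y j \<in> R"
    and inv: "\<And>j. e $ j < 0 \<Longrightarrow> inverse (y j) \<in> R"
  shows "lmon y e \<in> R"
  unfolding lmon_def
proof (rule sub_prod[OF R])
  fix j
  show "y j powi (e $ j) \<in> R"
    using y[of j] inv[of j] by (auto simp: power_int_def intro: sub_power[OF R])
qed

text \<open>
  The lower bound of a seed with mutable directions \<open>K\<close>; the other directions are frozen and their
  variables inverted.
\<close>

definition lower ::
    "('n::{finite,linorder} \<Rightarrow> 'n ratfun) \<Rightarrow> 'n int_matrix \<Rightarrow> 'n set \<Rightarrow> 'n ratfun set" where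
  "lower y C K = alg (range y \<union> (\<lambda>j. inverse (y j)) ` (- K) \<union> (\<lambda>i. mutate_cluster i y C i) ` K)"

lemma is_subalgebra_lower: "is_subalgebra (lower y C K)"
  by (simp add: lower_def is_subalgebra_alg)

lemma lower_gens:
  "y j \<in> lower y C K" "j \<notin> K \<Longrightarrow> inverse (y j) \<in> lower y C K"
  "j \<in> K \<Longrightarrow> mutate_cluster j y C j \<in> lower y C K"
  by (auto simp: lower_def intro!: hull_inc)

lemma lmon_in_lower:
  assumes "\<And>j. j \<in> K \<Longrightarrow> e $ j \<ge> 0"
  shows "lmon y e \<in> lower y C K"
  by (rule lmon_in_subalgebra[OF is_subalgebra_lower])
    (use assms in \<open>force intro: lower_gens\<close>)+

lemma graded_cancel_power:
  fixes w :: "(int, 'n::{finite,linorder}) vec \<Rightarrow> rat"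
  assumes y: "torus y" and w: "\<And>e e'. w (e + e') = w e + w e'"
    and Q: "Q \<in> laurent y (grade w 0)" and b: "w b = 1"
  shows "h \<in> laurent y UNIV \<Longrightarrow> g \<in> laurent y UNIV \<Longrightarrow>
    (1 + lmon y b) ^ n * h = Q * g \<Longrightarrow> \<exists>g'\<in>laurent y UNIV. h = Q * g'"
proof (induction n arbitrary: g)
  case 0
  then show ?case by auto
next
  case (Suc n)
  note nz = torus_nonzero[OF y]
  have "1 + lmon y b \<in> laurent y UNIV" by (intro laurent_add laurent_1 laurent_lmon) auto
  then have "(1 + lmon y b) ^ n * h \<in> laurent y UNIV"
    using Suc.prems(1) is_subalgebra_laurent[OF nz] by (intro sub_mult sub_power) auto
  moreover have "(1 + lmon y b) * ((1 + lmon y b) ^ n * h) = Q * g"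
    using Suc.prems(3) by (simp add: mult.assoc)
  ultimately obtain g' where "g' \<in> laurent y UNIV" "(1 + lmon y b) ^ n * h = Q * g'"
    using graded_cancel[OF y w Q b _ Suc.prems(2)] by blast
  then show ?case using Suc.IH[OF Suc.prems(1)] by blast
qed

lemma binomial_product_grade:
  assumes y: "\<And>j. y j \<noteq> 0" and w: "\<And>e e'. w (e + e') = w e + (w e' :: 'g::ab_group_add)"
    and b: "\<And>i. i \<in> S \<Longrightarrow> w (b i) = 0"
  shows "(\<Prod>i\<in>S. (1 + lmon y (b i)) ^ n i) \<in> laurent y (grade w 0)"
  using b
proof (induction S rule: infinite_finite_induct)
  case (insert i S)
  have "(1 + lmon y (b i)) ^ n i * (\<Prod>i\<in>S. (1 + lmon y (b i)) ^ n i) \<in> laurent y (grade w 0)"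
    by (rule laurent_mult[OF y binomial_power_grade[OF y w] insert.IH]) (use insert.prems in \<open>auto simp: w\<close>)
  then show ?case using insert by simp
qed (use w[of 0 0] in \<open>auto intro: laurent_1\<close>)

text \<open>
  Full rank of the matrix provides a grading that separates the \<open>k\<close>-th exchange binomial from all
  others: those are homogeneous of weight 0, while it has terms of weights 0 and 1.
\<close>

lemma dual_weights:
  assumes inv: "invertible (rat_matrix C)"
  obtains w :: "(int, 'n::finite) vec \<Rightarrow> rat"
  where "\<And>e e'. w (e + e') = w e + w e'" "\<And>i. w (C $ i) = (if i = k then 1 else 0)"
proof -
  obtain A where A: "rat_matrix C ** A = mat 1" using inv by (auto simp: invertible_def)
  define w where "w e = (\<Sum>j\<in>UNIV. of_int (e $ j) * A $ j $ k)" for e :: "(int, 'n) vec"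
  show thesis
  proof (rule that[of w])
    show "w (e + e') = w e + w e'" for e e'
      by (simp add: w_def sum.distrib distrib_right)
    have "w (C $ i) = (rat_matrix C ** A) $ i $ k" for i
      by (simp add: w_def matrix_matrix_mult_def map_matrix_def)
    then show "w (C $ i) = (if i = k then 1 else 0)" for i
      unfolding A by (simp add: mat_def)
  qed
qed

lemma mutated_variable_times:
  assumes "\<And>j. y j \<noteq> 0"
  shows "y k * mutate_cluster k y C k = lmon y (negp (C $ k)) * (1 + lmon y (C $ k))"
  by (simp add: mutate_cluster_same assms exchange_poly_factor)

text \<open>
  Without arrows inside \<open>I\<close>, the exchange binomials of \<open>I\<close> do not involve the variables \<open>y\<^sub>i\<close> with
  \<open>i \<in> I\<close>.  Expand \<open>f\<close> in monomials in these variables.  By \<open>chart_component\<close> the coefficient of a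
  monomial is divisible by a power of the \<open>i\<close>-th binomial for each \<open>i\<close> with a negative exponent.  The
  binomials are pairwise coprime by \<open>dual_weights\<close> and \<open>graded_cancel_power\<close>, so the coefficient is
  divisible by the product of these powers, and the product turns the negative powers of the \<open>y\<^sub>i\<close>
  into positive powers of the mutated variables.
\<close>

lemma isolated_in_lower:
  assumes good: "good_seed y C" and I: "\<And>i j. i \<in> I \<Longrightarrow> j \<in> I \<Longrightarrow> C $ i $ j = 0"
    and f: "f \<in> laurent y UNIV" and fi: "\<And>i. i \<in> I \<Longrightarrow> f \<in> laurent (mutate_cluster i y C) UNIV"
  shows "f \<in> lower y C I"
proof -
  have y: "torus y" and skew: "skew_symmetric C" and inv: "invertible (rat_matrix C)"
    using good by (auto simp: good_seed_def)
  note nz = torus_nonzero[OF y]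
  note sub = is_subalgebra_lower[of y C I]
  let ?h = "\<lambda>i. 1 + lmon y (C $ i)"
  define r :: "(int, 'a) vec \<Rightarrow> (int, 'a) vec" where "r e = (\<chi> j. if j \<in> I then e $ j else 0)" for e
  have r_add: "r (e + e') = r e + r e'" for e e' by (simp add: r_def vec_eq_iff)
  have r_row: "r (C $ i) = 0" if "i \<in> I" for i using I[OF that] by (simp add: r_def vec_eq_iff)
  obtain G \<phi> where G: "finite G" "\<And>g. g \<notin> G \<Longrightarrow> \<phi> g = 0"
      "\<And>g. \<phi> g \<in> laurent y (UNIV \<inter> grade r g)" "f = (\<Sum>g\<in>G. \<phi> g)"
    by (rule laurent_decompose[OF f, of r]) blast
  have G3: "\<phi> g \<in> laurent y (grade r g)" for g using G(3)[of g] by simp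
  have divides: "\<exists>t\<in>laurent y UNIV. \<phi> g = ?h i powi (- g $ i) * t" if i: "i \<in> I" for i g
  proof -
    obtain S c where S: "finite S"
      "f = (\<Sum>e\<in>S. const (c e) * (lmon y e * (1 + lmon y (C $ i)) powi (- (e $ i))))"
      using laurent_mutate_explicit[OF nz skew_diag[OF skew] fi[OF i]] by blast
    have "\<phi> g = ?h i powi (- g $ i) * (\<Sum>e\<in>{e\<in>S. r e = g}. const (c e) * lmon y e)"
      by (rule chart_component[where w = r and \<kappa> = "\<lambda>g. g $ i",
            OF y skew_diag[OF skew] r_add r_row[OF i] _ S(1) _ G(1,2) G3])
        (use i S(2) G(4) in \<open>auto simp: r_def\<close>)
    then show ?thesis by (blast intro: laurent_sum laurent_scale laurent_lmon)
  qed
  have prod_divides: "\<exists>t\<in>laurent y UNIV. \<phi> g = (\<Prod>i\<in>S. ?h i ^ nat (- g $ i)) * t"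
    if "finite S" "S \<subseteq> {i\<in>I. g $ i < 0}" for g S
    using that
  proof (induction S)
    case empty
    then show ?case using G3[of g] laurent_mono[of _ UNIV y] by auto
  next
    case (insert k S)
    let ?Q = "\<Prod>i\<in>S. ?h i ^ nat (- g $ i)"
    obtain t where t: "t \<in> laurent y UNIV" "\<phi> g = ?Q * t" using insert by auto
    obtain t' where t': "t' \<in> laurent y UNIV" "\<phi> g = ?h k powi (- g $ k) * t'"
      using divides[of k g] insert by auto
    obtain w :: "(int, 'a) vec \<Rightarrow> rat" where w: "\<And>e e'. w (e + e') = w e + w e'"
      "\<And>i. w (C $ i) = (if i = k then 1 else 0)" by (rule dual_weights[OF inv, of k]) blast
    have Q: "?Q \<in> laurent y (grade w 0)"
      by (rule binomial_product_grade[OF nz w(1)]) (use w(2) insert in auto)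
    have eq: "?h k powi (- g $ k) = ?h k ^ nat (- g $ k)"
      using insert by (simp add: power_int_nonneg_exp)
    then have "?h k ^ nat (- g $ k) * t' = ?Q * t" using t t' by simp
    then obtain t'' where "t'' \<in> laurent y UNIV" "t' = ?Q * t''"
      using graded_cancel_power[of y w ?Q "C $ k" t' t, OF y w(1) Q _ t'(1) t(1)] w(2)[of k] by auto
    then show ?case
      using t'(2) insert eq by (auto simp: mult_ac)
  qed
  \<comment> \<open>The \<open>k\<close>-th binomial is the mutated variable times a monomial in which \<open>y\<^sub>k\<close> is the only variable of \<open>I\<close>.\<close>
  have clear: "lmon y e * (\<Prod>i\<in>S. ?h i ^ n i) \<in> lower y C I"
    if "finite S" "S \<subseteq> I" "\<And>i. i \<in> I \<Longrightarrow> i \<in> S \<Longrightarrow> e $ i + int (n i) \<ge> 0"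
      "\<And>i. i \<in> I \<Longrightarrow> i \<notin> S \<Longrightarrow> e $ i \<ge> 0" for S n e
    using that
  proof (induction S arbitrary: e)
    case empty
    then show ?case by (auto intro: lmon_in_lower)
  next
    case (insert k S)
    let ?v = "axis k 1 - negp (C $ k)"
    let ?e = "e + int (n k) *s ?v"
    have neg0: "negp (C $ k) $ i = 0" if "i \<in> I" for i
      using I[of k i] insert that by simp
    have "?h k = mutate_cluster k y C k * lmon y ?v"
    proof -
      have "lmon y ?v = y k * inverse (lmon y (negp (C $ k)))"
        using lmon_add[of y "axis k 1" "- negp (C $ k)", OF nz] by (simp add: lmon_axis lmon_minus)
      then have "mutate_cluster k y C k * lmon y ?v
          = inverse (lmon y (negp (C $ k))) * (y k * mutate_cluster k y C k)"
        by (simp only: mult_ac)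
      also have "\<dots> = ?h k"
        unfolding mutated_variable_times[of y k C, OF nz]
        using lmon_nonzero[of y "negp (C $ k)", OF nz] by (simp flip: mult.assoc)
      finally show ?thesis ..
    qed
    then have "lmon y e * ?h k ^ n k = mutate_cluster k y C k ^ n k * lmon y ?e"
      by (simp add: lmon_add[OF nz] lmon_scale power_mult_distrib)
    then have eq: "lmon y e * (\<Prod>i\<in>insert k S. ?h i ^ n i)
        = mutate_cluster k y C k ^ n k * (lmon y ?e * (\<Prod>i\<in>S. ?h i ^ n i))"
      using insert(1,2) by (simp add: mult_ac)
    have rest: "lmon y ?e * (\<Prod>i\<in>S. ?h i ^ n i) \<in> lower y C I"
    proof (rule insert.IH)
      show "S \<subseteq> I" using insert by simp
      show "?e $ i + int (n i) \<ge> 0" if "i \<in> I" "i \<in> S" for i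
        using insert that neg0[of i] by (auto simp: axis_def)
      show "?e $ i \<ge> 0" if "i \<in> I" "i \<notin> S" for i
        using insert that neg0[of i] by (auto simp: axis_def)
    qed
    have "k \<in> I" using insert.prems by simp
    then show ?case
      unfolding eq by (intro sub_mult[OF sub sub_power[OF sub] rest] lower_gens(3))
  qed
  have "\<phi> g \<in> lower y C I" for g
  proof -
    let ?S = "{i\<in>I. g $ i < 0}"
    let ?Q = "\<Prod>i\<in>?S. ?h i ^ nat (- g $ i)"
    obtain t where t: "t \<in> laurent y UNIV" "\<phi> g = ?Q * t" using prod_divides[of ?S g] by auto
    obtain H \<tau> where H: "finite H" "\<And>g. g \<notin> H \<Longrightarrow> \<tau> g = 0"
      "\<And>g. \<tau> g \<in> laurent y (UNIV \<inter> grade r g)" "t = (\<Sum>g\<in>H. \<tau> g)"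
      by (rule laurent_decompose[OF t(1), of r]) blast
    have sum1: "(\<Sum>m\<in>insert g H. if m = g then \<phi> g else 0) = \<phi> g"
      using H(1) by (subst sum.delta) auto
    have sum2: "(\<Sum>m\<in>insert g H. \<tau> m) = t"
      using H by (cases "g \<in> H") (auto simp: insert_absorb)
    have Q: "?Q \<in> laurent y (grade r 0)"
      by (rule binomial_product_grade[OF nz r_add]) (use r_row in auto)
    have "(if g = g then \<phi> g else 0) = ?Q * \<tau> g"
    proof (rule graded_unique[OF y, where G = "insert g H" and w = r and g = g and
          \<phi> = "\<lambda>m. if m = g then \<phi> g else 0" and \<psi> = "\<lambda>m. ?Q * \<tau> m"])
      show "(\<Sum>m\<in>insert g H. if m = g then \<phi> g else 0) = (\<Sum>m\<in>insert g H. ?Q * \<tau> m)"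
        unfolding sum_distrib_left[symmetric] sum1 sum2 by (rule t(2))
      show "(if m = g then \<phi> g else 0) \<in> laurent y (grade r m)" for m using G3[of g] by auto
      show "?Q * \<tau> m \<in> laurent y (grade r m)" for m
        by (rule laurent_mult[OF nz Q H(3)[of m]]) (auto simp: r_add)
    qed (use H(1) in auto)
    then have \<phi>: "\<phi> g = \<tau> g * ?Q" by (simp add: mult.commute)
    obtain S c where S: "finite S" "S \<subseteq> grade r g" "\<tau> g = (\<Sum>e\<in>S. const (c e) * lmon y e)"
      using H(3)[of g] unfolding laurent_explicit by auto
    have "lmon y e * ?Q \<in> lower y C I" if "e \<in> S" for e
    proof (rule clear[where S = ?S and n = "\<lambda>i. nat (- g $ i)"])
      have r: "r e = g" using S that by auto
      have "e $ i = g $ i" if "i \<in> I" for i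
        using that unfolding r[symmetric] by (simp add: r_def)
      then show "e $ i + int (nat (- g $ i)) \<ge> 0" if "i \<in> I" for i using that by simp
      show "e $ i \<ge> 0" if "i \<in> I" "i \<notin> ?S" for i
        using that \<open>\<And>i. i \<in> I \<Longrightarrow> e $ i = g $ i\<close>[of i] by auto
    qed auto
    then show ?thesis
      unfolding \<phi> S(3) sum_distrib_right
      by (intro sub_sum[OF sub]) (simp add: mult.assoc sub_mult[OF sub] sub_const[OF sub])
  qed
  then show ?thesis unfolding G(4) by (intro sub_sum[OF sub])
qed

text \<open>
  Induction on \<open>p + q\<close>: for \<open>u * f\<close> and for \<open>v * f\<close> one of the two exponents is smaller, and \<open>f\<close> is a
  combination of these two elements.
\<close>

lemma comaximal_powers:
  assumes R: "is_subalgebra R" and ab: "a \<in> R" "b \<in> R" and one: "a * u + b * v = 1"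
  shows "u ^ p * f \<in> R \<Longrightarrow> v ^ q * f \<in> R \<Longrightarrow> u \<in> R \<Longrightarrow> v \<in> R \<Longrightarrow> f \<in> R"
proof (induction "p + q" arbitrary: p q f)
  case 0
  then show ?case by simp
next
  case (Suc n)
  show ?case
  proof (cases "p = 0 \<or> q = 0")
    case True
    then show ?thesis using Suc.prems by auto
  next
    case False
    then obtain p' q' where pq: "p = Suc p'" "q = Suc q'" by (meson not0_implies_Suc)
    have "u * f \<in> R"
    proof (rule Suc.hyps(1)[of p' q])
      show "u ^ p' * (u * f) \<in> R" using Suc.prems(1) pq by (simp add: mult_ac)
      show "v ^ q * (u * f) \<in> R" using sub_mult[OF R Suc.prems(3,2)] by (simp add: mult_ac)
    qed (use Suc pq in auto)
    moreover have "v * f \<in> R"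
    proof (rule Suc.hyps(1)[of p q'])
      show "v ^ q' * (v * f) \<in> R" using Suc.prems(2) pq by (simp add: mult_ac)
      show "u ^ p * (v * f) \<in> R" using sub_mult[OF R Suc.prems(4,1)] by (simp add: mult_ac)
    qed (use Suc pq in auto)
    ultimately have "a * (u * f) + b * (v * f) \<in> R"
      using sub_add[OF R sub_mult[OF R ab(1)] sub_mult[OF R ab(2)]] by blast
    also have "a * (u * f) + b * (v * f) = (a * u + b * v) * f" by (simp add: algebra_simps)
    finally show ?thesis by (simp add: one)
  qed
qed

text \<open>
  The functions with a power of \<open>y\<^sub>i\<close> as denominator form a subalgebra that contains all generators
  of the lower bound in which \<open>i\<close> is frozen.
\<close>

lemma lower_localize:
  assumes y: "\<And>j. y j \<noteq> 0" and f: "f \<in> lower y C (K - {i})"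
  shows "\<exists>N. y i ^ N * f \<in> lower y C K"
proof -
  let ?R = "lower y C K"
  note sub = is_subalgebra_lower[of y C K]
  define L where "L = {f. \<exists>N. y i ^ N * f \<in> ?R}"
  have up: "\<exists>N. y i ^ N * f \<in> ?R" if "f \<in> ?R" for f
    using that by (intro exI[of _ 0]) simp
  have L: "is_subalgebra L"
    unfolding is_subalgebra_def
  proof (intro conjI ballI)
    show "range const \<subseteq> L" using up[OF sub_const[OF sub]] unfolding L_def by blast
    fix f g assume "f \<in> L" "g \<in> L"
    then obtain N M where fg: "y i ^ N * f \<in> ?R" "y i ^ M * g \<in> ?R" unfolding L_def by blast
    have "y i ^ M * (y i ^ N * f) + y i ^ N * (y i ^ M * g) \<in> ?R"
      using sub_add[OF sub sub_mult[OF sub sub_power[OF sub lower_gens(1)] fg(1)]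
          sub_mult[OF sub sub_power[OF sub lower_gens(1)] fg(2)]] .
    then have "y i ^ (N + M) * (f + g) \<in> ?R" by (simp add: power_add algebra_simps)
    then show "f + g \<in> L" unfolding L_def by blast
    have "(y i ^ N * f) * (y i ^ M * g) \<in> ?R" using fg by (rule sub_mult[OF sub])
    then have "y i ^ (N + M) * (f * g) \<in> ?R" by (simp add: power_add algebra_simps)
    then show "f * g \<in> L" unfolding L_def by blast
  qed
  have "lower y C (K - {i}) \<subseteq> L"
    unfolding lower_def
  proof (rule hull_minimal)
    show "is_subalgebra L" by (rule L)
    have inv: "inverse (y j) \<in> L" if "j \<notin> K - {i}" for j
    proof (cases "j = i")
      case True
      then have "y i ^ 1 * inverse (y j) \<in> ?R" using y[of i] sub_1[OF sub] by simp
      then show ?thesis unfolding L_def by blast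
    next
      case False
      then show ?thesis using up[OF lower_gens(2)] that unfolding L_def by blast
    qed
    show "range y \<union> (\<lambda>j. inverse (y j)) ` (- (K - {i})) \<union> (\<lambda>i. mutate_cluster i y C i) ` (K - {i}) \<subseteq> L"
      using inv up[OF lower_gens(1)] up[OF lower_gens(3)] unfolding L_def by blast
  qed
  then show ?thesis using f by (auto simp: L_def)
qed

text \<open>
  Among the vertices of \<open>K\<close> with an outgoing arrow inside \<open>K\<close>, one that is minimal for the arrow
  relation has no incoming arrow from \<open>K\<close>.
\<close>

lemma acyclic_source:
  assumes ac: "acyclic {(i, j). i \<in> K \<and> j \<in> K \<and> C $ i $ j > (0::int)}"
    and skew: "skew_symmetric C" and ij: "i \<in> K" "j \<in> K" "C $ i $ j \<noteq> 0"
  obtains a b where "a \<in> K" "b \<in> K" "C $ a $ b > 0" "\<And>l. l \<in> K \<Longrightarrow> C $ a $ l \<ge> 0"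
proof -
  let ?r = "{(i, j). i \<in> K \<and> j \<in> K \<and> C $ i $ j > 0}"
  let ?Q = "{a \<in> K. \<exists>b\<in>K. C $ a $ b > 0}"
  have "wf ?r" by (rule finite_acyclic_wf[OF _ ac]) simp
  moreover have "?Q \<noteq> {}" using ij skew_nth[OF skew, of i j] by (cases "C $ i $ j > 0") force+
  ultimately obtain a where a: "a \<in> ?Q" "\<And>l. (l, a) \<in> ?r \<Longrightarrow> l \<notin> ?Q"
    unfolding wf_eq_minimal by (metis (no_types, lifting) ex_in_conv)
  show thesis
  proof -
    obtain b where b: "a \<in> K" "b \<in> K" "C $ a $ b > 0" using a by blast
    have "C $ a $ l \<ge> 0" if "l \<in> K" for l
      using a(2)[of l] that b skew_nth[OF skew, of l a] by (force simp: not_less)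
    with b show thesis by (rule that)
  qed
qed

text \<open>
  Induction on the number of mutable directions.  Let \<open>i \<rightarrow> j\<close> be an arrow inside \<open>K\<close> with \<open>i\<close> a
  source of \<open>K\<close>.  One monomial of the exchange polynomial at \<open>i\<close> is divisible by \<open>y\<^sub>j\<close> and the other
  consists of frozen variables, so it is a unit.  Thus \<open>y\<^sub>i\<close> and \<open>y\<^sub>j\<close> are comaximal, and it suffices
  that \<open>f\<close> belongs to the algebras in which \<open>i\<close>, respectively \<open>j\<close>, is frozen.  A quiver without
  arrows is the case of \<open>isolated_in_lower\<close>.
\<close>

lemma acyclic_in_lower:
  assumes good: "good_seed y C" and f: "f \<in> laurent y UNIV"
  shows "acyclic {(i, j). i \<in> K \<and> j \<in> K \<and> C $ i $ j > 0} \<Longrightarrow>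
    (\<And>i. i \<in> K \<Longrightarrow> f \<in> laurent (mutate_cluster i y C) UNIV) \<Longrightarrow> f \<in> lower y C K"
proof (induction "card K" arbitrary: K rule: less_induct)
  case less
  have y: "torus y" and skew: "skew_symmetric C" using good by (auto simp: good_seed_def)
  note nz = torus_nonzero[OF y]
  note sub = is_subalgebra_lower[of y C K]
  show ?case
  proof (cases "\<forall>i\<in>K. \<forall>j\<in>K. C $ i $ j = 0")
    case True
    then show ?thesis using less.prems by (intro isolated_in_lower[OF good _ f]) auto
  next
    case False
    then obtain i j where ij: "i \<in> K" "j \<in> K" "C $ i $ j > 0" and src: "\<And>l. l \<in> K \<Longrightarrow> C $ i $ l \<ge> 0"
      using acyclic_source[OF less.prems(1) skew] by metis
    have smaller: "\<exists>N. y l ^ N * f \<in> lower y C K" if l: "l \<in> K" for l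
    proof (rule lower_localize[OF nz less.hyps])
      show "card (K - {l}) < card K" using l by (intro psubset_card_mono) auto
      show "acyclic {(i, j). i \<in> K - {l} \<and> j \<in> K - {l} \<and> C $ i $ j > 0}"
        by (rule acyclic_subset[OF less.prems(1)]) auto
    qed (use less.prems in auto)
    let ?n = "negp (C $ i)" and ?p = "posp (C $ i)"
    let ?a = "lmon y (- ?n) * mutate_cluster i y C i"
    let ?b = "- (lmon y (- ?n) * lmon y (?p - axis j 1))"
    have ex: "y i * mutate_cluster i y C i = lmon y ?p + lmon y ?n"
      using nz by (simp add: mutate_cluster_same exchange_poly_lmon)
    have p: "lmon y ?p = lmon y (?p - axis j 1) * y j"
      using lmon_add[of y "?p - axis j 1" "axis j 1", OF nz] by (simp add: lmon_axis)
    have "?a * y i + ?b * y j = lmon y (- ?n) * (y i * mutate_cluster i y C i)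
        - lmon y (- ?n) * (lmon y (?p - axis j 1) * y j)"
      by (simp add: mult_ac)
    also have "\<dots> = lmon y (- ?n) * lmon y ?n"
      unfolding ex p[symmetric] by (simp add: distrib_left)
    also have "\<dots> = 1"
      using lmon_nonzero[of y, OF nz] by (simp add: lmon_minus)
    finally have one: "?a * y i + ?b * y j = 1" .
    have n: "lmon y (- ?n) \<in> lower y C K"
      using src by (intro lmon_in_lower) (simp add: max_def)
    have p: "lmon y (?p - axis j 1) \<in> lower y C K"
      using src ij by (intro lmon_in_lower) (auto simp: axis_def)
    have "?a \<in> lower y C K" "?b \<in> lower y C K"
      using n p ij by (auto intro!: sub_minus[OF sub] sub_mult[OF sub] lower_gens)
    from comaximal_powers[OF sub this one] smaller[OF ij(1)] smaller[OF ij(2)] show ?thesis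
      using lower_gens(1)[of y i C K] lower_gens(1)[of y j C K] by blast
  qed
qed

section \<open>Mutation invariance of the upper bound\<close>

lemma lmon_cong: "(\<And>j. e $ j \<noteq> 0 \<Longrightarrow> y j = z j) \<Longrightarrow> lmon y e = lmon z e"
  unfolding lmon_def
proof (rule prod.cong)
  fix j
  assume "\<And>j. e $ j \<noteq> 0 \<Longrightarrow> y j = z j"
  then show "y j powi (e $ j) = z j powi (e $ j)" by (cases "e $ j = 0") auto
qed simp

lemma exchange_poly_in_laurent:
  assumes "C $ k $ k = 0" "\<And>j. j \<noteq> k \<Longrightarrow> y j = z j"
  shows "exchange_poly y C k \<in> laurent z UNIV"
proof -
  have "lmon y (posp (C $ k)) = lmon z (posp (C $ k))" "lmon y (negp (C $ k)) = lmon z (negp (C $ k))"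
    by (rule lmon_cong; use assms in force)+
  then show ?thesis unfolding exchange_poly_lmon by (auto intro!: laurent_add laurent_lmon)
qed

lemma inverse_in_laurent: "inverse (z i) \<in> laurent z UNIV"
  using laurent_lmon[of "axis i (- 1)" UNIV z] by (simp add: lmon_axis power_int_minus)

lemma var_in_laurent: "z i \<in> laurent z UNIV"
  using laurent_lmon[of "axis i 1" UNIV z] by (simp add: lmon_axis)

lemma mutated_back:
  assumes "torus y"
  shows "y k = exchange_poly y C k * inverse (mutate_cluster k y C k)"
  using torus_nonzero[OF assms, of k] exchange_poly_nonzero[OF assms, of C k]
  by (simp add: mutate_cluster_same field_simps)

lemma cluster_in_mutated_laurent:
  assumes y: "torus y" and C: "C $ k $ k = 0"
  shows "y j \<in> laurent (mutate_cluster k y C) UNIV"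
proof (cases "j = k")
  case True
  have "exchange_poly y C k \<in> laurent (mutate_cluster k y C) UNIV"
    by (rule exchange_poly_in_laurent[OF C]) (simp add: mutate_cluster_other)
  then have "exchange_poly y C k * inverse (mutate_cluster k y C k)
      \<in> laurent (mutate_cluster k y C) UNIV"
    by (rule sub_mult[OF is_subalgebra_laurent[of "mutate_cluster k y C", OF mutate_cluster_nonzero[OF y]] _ inverse_in_laurent])
  then show ?thesis
    unfolding mutated_back[OF y, of k C, symmetric] by (simp add: True)
next
  case False
  then show ?thesis using var_in_laurent[of "mutate_cluster k y C" j] by (simp add: mutate_cluster_other)
qed

lemma double_mutation_old_variables:
  fixes y :: "'n::{finite,linorder} \<Rightarrow> 'n ratfun"
  assumes y: "torus y" and skew: "skew_symmetric C" and ik: "i \<noteq> k"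
  defines "y1 \<equiv> mutate_cluster k y C" and "C1 \<equiv> mutate_matrix k C"
  defines "z \<equiv> mutate_cluster i y1 C1"
  shows "y j \<in> laurent z UNIV"
    and "j \<noteq> i \<Longrightarrow> j \<noteq> k \<Longrightarrow> inverse (y j) \<in> laurent z UNIV"
proof -
  have y1: "torus y1" unfolding y1_def by (rule torus_mutate[OF y skew_diag[OF skew]])
  have C1: "C1 $ i $ i = 0" unfolding C1_def by (rule skew_diag[OF mutate_matrix_skew[OF skew]])
  have z: "torus z" unfolding z_def by (rule torus_mutate[OF y1 C1])
  note sub = is_subalgebra_laurent[of z, OF torus_nonzero[OF z]]
  have y1z: "y1 j \<in> laurent z UNIV" for j
    unfolding z_def by (rule cluster_in_mutated_laurent[OF y1 C1])
  have other: "y j \<in> laurent z UNIV" if "j \<noteq> k" for j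
    using y1z[of j] that by (simp add: y1_def mutate_cluster_other)
  show "y j \<in> laurent z UNIV"
  proof (cases "j = k")
    case True
    have "lmon (y(k := 1)) e \<in> laurent z UNIV" if "\<And>j. e $ j \<ge> 0" for e
      by (rule lmon_in_subalgebra[OF sub])
        (use other sub_1[OF sub] that in \<open>auto simp: not_less[symmetric]\<close>)
    moreover have "lmon y (posp (C $ k)) = lmon (y(k := 1)) (posp (C $ k))"
      "lmon y (negp (C $ k)) = lmon (y(k := 1)) (negp (C $ k))"
      by (rule lmon_cong; use skew_diag[OF skew, of k] in force)+
    ultimately have "exchange_poly y C k \<in> laurent z UNIV"
      unfolding exchange_poly_lmon by (simp add: laurent_add)
    moreover have "inverse (y1 k) \<in> laurent z UNIV"
      using inverse_in_laurent[of z k] ik by (simp add: z_def mutate_cluster_other)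
    ultimately have "exchange_poly y C k * inverse (y1 k) \<in> laurent z UNIV"
      by (rule sub_mult[OF sub])
    then show ?thesis
      unfolding y1_def mutated_back[OF y, of k C, symmetric] by (simp add: True)
  qed (rule other)
  show "inverse (y j) \<in> laurent z UNIV" if "j \<noteq> i" "j \<noteq> k"
    using inverse_in_laurent[of z j] that by (simp add: z_def y1_def mutate_cluster_other)
qed

text \<open>
  Put \<open>b = C\<^sub>i\<^sub>k\<close> and let \<open>u\<^sub>i\<close> be \<open>y\<close> to the power of the \<open>i\<close>-th row of \<open>C\<close>.  Mutation at \<open>k\<close> replaces \<open>u\<^sub>i\<close> by
  \<open>u\<^sub>i u\<^sub>k\<^sup>b / (1 + u\<^sub>k)\<^sup>b\<close>.  Let \<open>M\<close> be the monomial of the exchange polynomial \<open>P\<close> at \<open>k\<close> that does not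
  contain \<open>y\<^sub>i\<close>.  The formula for \<open>u\<^sub>i\<close> shows that \<open>M\<^sup>b\<close> times the variable obtained by mutating \<open>y\<^sub>i\<close>
  directly is a Laurent polynomial in \<open>z\<close> minus a monomial times \<open>(P\<^sup>b - M\<^sup>b) / y\<^sub>i\<close>.  Here the
  numerator is divisible by the other monomial of \<open>P\<close>, hence by \<open>y\<^sub>i\<close>.
\<close>

lemma double_mutation_exchange:
  fixes y :: "'n::{finite,linorder} \<Rightarrow> 'n ratfun"
  assumes y: "torus y" and skew: "skew_symmetric C" and ik: "i \<noteq> k" and pos: "C $ i $ k > 0"
  defines "y1 \<equiv> mutate_cluster k y C" and "C1 \<equiv> mutate_matrix k C"
  defines "z \<equiv> mutate_cluster i y1 C1"
  shows "mutate_cluster i y C i \<in> laurent z UNIV"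
proof -
  note nz = torus_nonzero[OF y]
  have y1: "torus y1" unfolding y1_def by (rule torus_mutate[OF y skew_diag[OF skew]])
  note nz1 = torus_nonzero[OF y1]
  have C1: "C1 $ i $ i = 0" unfolding C1_def by (rule skew_diag[OF mutate_matrix_skew[OF skew]])
  have z: "torus z" unfolding z_def by (rule torus_mutate[OF y1 C1])
  note sub = is_subalgebra_laurent[of z, OF torus_nonzero[OF z]]
  note old = double_mutation_old_variables[OF y skew ik, folded y1_def C1_def, folded z_def]
  let ?T = "laurent z UNIV"
  have mon: "lmon y e \<in> ?T" if "e $ i \<ge> 0" "e $ k \<ge> 0" for e
    by (rule lmon_in_subalgebra[OF sub old(1)]) (use old(2) that not_less in metis)
  have mon1: "lmon y1 e \<in> ?T" if "e $ i = 0" for e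
  proof -
    have "lmon y1 e = lmon z e"
      by (rule lmon_cong) (use that in \<open>auto simp: z_def mutate_cluster_def\<close>)
    then show ?thesis by (simp add: laurent_lmon)
  qed
  define b where "b = nat (C $ i $ k)"
  have b: "C $ i $ k = int b" "b > 0" and cki: "C $ k $ i = - int b" and ckk: "C $ k $ k = 0"
    using pos skew_nth[OF skew, of k i] skew_diag[OF skew] by (auto simp: b_def)
  let ?h = "1 + lmon y (C $ k)"
  have h: "?h \<noteq> 0" by (rule binomial_nonzero[OF y])
  let ?p = "lmon y (posp (C $ k))" and ?n = "lmon y (negp (C $ k))"
  let ?N = "lmon y (negp (C $ i))" and ?N1 = "lmon y1 (negp (C1 $ i))"
  let ?P = "?n * ?h"
  have "reflect_exponent k (C $ k) (C1 $ i) = C $ i + int b *s C $ k"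
    using ik b ckk skew_diag[OF skew]
    by (auto simp: vec_eq_iff reflect_exponent_def C1_def mutate_matrix_nth max_def algebra_simps)
  moreover have "C1 $ i $ k = - int b" using b by (simp add: C1_def mutate_matrix_nth)
  ultimately have hat1: "lmon y1 (C1 $ i) = lmon y (C $ i) * lmon y (C $ k) ^ b * inverse (?h ^ b)"
    unfolding y1_def lmon_mutate_cluster[of y C k, OF nz ckk]
    by (simp add: lmon_add[of y, OF nz] lmon_scale power_int_minus)
  have P: "?P = ?p + ?n"
    by (simp add: posp_eq lmon_add[of y, OF nz] distrib_left)
  have p: "?p = ?n * lmon y (C $ k)"
    by (simp add: posp_eq lmon_add[of y, OF nz])
  have ex1: "y i * z i = ?N1 * (1 + lmon y1 (C1 $ i))"
    using mutated_variable_times[of y1 i C1, OF nz1] ik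
    by (simp add: z_def y1_def mutate_cluster_other)
  have ex: "y i * mutate_cluster i y C i = ?N * (1 + lmon y (C $ i))"
    by (rule mutated_variable_times[of y, OF nz])
  have N1: "?N1 \<noteq> 0" by (rule lmon_nonzero[OF nz1])
  have "?P ^ b * (1 + lmon y1 (C1 $ i)) = ?n ^ b * (?h ^ b + lmon y (C $ i) * lmon y (C $ k) ^ b)"
    using h unfolding hat1 power_mult_distrib by (simp add: field_simps)
  also have "\<dots> = ?P ^ b - ?p ^ b + ?p ^ b * (1 + lmon y (C $ i))"
    unfolding p power_mult_distrib by (simp add: algebra_simps)
  finally have key: "?p ^ b * (1 + lmon y (C $ i)) = ?P ^ b * (1 + lmon y1 (C1 $ i)) - (?P ^ b - ?p ^ b)"
    by simp
  define s where "s = (\<Sum>t<b. ?p ^ (b - Suc t) * ?P ^ t)"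
  have Pp: "?P - ?p = ?n" unfolding P by simp
  have n: "?n = y i * lmon y (negp (C $ k) - axis i 1)"
    using lmon_add[of y "axis i 1" "negp (C $ k) - axis i 1", OF nz] by (simp add: lmon_axis)
  have "?P ^ b - ?p ^ b = (?P - ?p) * s"
    unfolding s_def by (rule power_diff_sumr2)
  also have "\<dots> = y i * (lmon y (negp (C $ k) - axis i 1) * s)"
    unfolding Pp by (simp only: n mult.assoc)
  finally have diff: "?P ^ b - ?p ^ b = y i * (lmon y (negp (C $ k) - axis i 1) * s)" .
  have "y i * (?p ^ b * mutate_cluster i y C i) = ?N * (?p ^ b * (1 + lmon y (C $ i)))"
    unfolding mult.left_commute[of "y i"] ex by (simp only: mult_ac)
  also have "\<dots> = ?N * ?P ^ b * (inverse ?N1 * (y i * z i)) - ?N * (?P ^ b - ?p ^ b)"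
    unfolding key ex1 using N1 by (simp add: right_diff_distrib mult.assoc)
  also have "\<dots> = y i * (?N * ?P ^ b * (inverse ?N1 * z i)
      - ?N * (lmon y (negp (C $ k) - axis i 1) * s))"
    unfolding diff right_diff_distrib by (simp only: mult_ac)
  finally have main: "?p ^ b * mutate_cluster i y C i = ?N * ?P ^ b * (inverse ?N1 * z i)
      - ?N * (lmon y (negp (C $ k) - axis i 1) * s)"
    using nz[of i] by simp
  have in_T: "?p \<in> ?T" "?n \<in> ?T" "?N \<in> ?T" "lmon y (negp (C $ k) - axis i 1) \<in> ?T"
    using cki ckk b ik skew_diag[OF skew, of i] by (auto intro!: mon simp: axis_def)
  have P_T: "?P \<in> ?T" unfolding P using in_T by (simp add: laurent_add)
  have s: "s \<in> ?T" unfolding s_def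
    by (intro sub_sum[OF sub] sub_mult[OF sub] sub_power[OF sub] in_T P_T)
  have N1_T: "inverse ?N1 \<in> ?T"
    unfolding lmon_minus[symmetric] by (rule mon1) (simp add: C1)
  have "?p ^ b * mutate_cluster i y C i \<in> ?T"
    unfolding main
    by (intro sub_diff[OF sub] sub_mult[OF sub] sub_power[OF sub] in_T P_T s N1_T var_in_laurent)
  moreover have "inverse ?p \<in> ?T"
    unfolding lmon_minus[symmetric] by (rule mon) (simp_all add: cki ckk)
  ultimately have "inverse ?p ^ b * (?p ^ b * mutate_cluster i y C i) \<in> ?T"
    using sub_mult[OF sub sub_power[OF sub]] by blast
  moreover have "inverse ?p ^ b * ?p ^ b = 1"
    using lmon_nonzero[of y "posp (C $ k)", OF nz] by (simp flip: power_mult_distrib)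
  ultimately show ?thesis by (simp flip: mult.assoc)
qed

lemma mutate_cluster_uminus: "mutate_cluster k y (- C) = mutate_cluster k y C"
  by (simp add: mutate_cluster_def exchange_poly_lmon posp_uminus negp_uminus add.commute)

lemma mutate_matrix_uminus: "mutate_matrix k (- C) = - mutate_matrix k C"
  by (auto simp: vec_eq_iff mutate_matrix_nth max_def algebra_simps)

text \<open>
  The matrices \<open>C\<close> and \<open>- C\<close> have the same mutations, so the sign of \<open>C\<^sub>i\<^sub>k\<close> does not matter.
\<close>

lemma double_mutation_exchange_any:
  assumes y: "torus y" and skew: "skew_symmetric C" and ik: "i \<noteq> k"
  shows "mutate_cluster i y C i
    \<in> laurent (mutate_cluster i (mutate_cluster k y C) (mutate_matrix k C)) UNIV"
proof (cases "C $ i $ k" "0 :: int" rule: linorder_cases)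
  case less
  have "skew_symmetric (- C)"
    unfolding skew_symmetric_iff
  proof (intro allI)
    fix i j show "(- C) $ i $ j = - (- C) $ j $ i" using skew_nth[OF skew, of j i] by simp
  qed
  from double_mutation_exchange[OF y this ik] less show ?thesis
    by (simp add: mutate_cluster_uminus mutate_matrix_uminus)
next
  case greater
  then show ?thesis by (rule double_mutation_exchange[OF y skew ik])
next
  case equal
  let ?y1 = "mutate_cluster k y C"
  have "mutate_matrix k C $ i = C $ i" using equal ik by (simp add: vec_eq_iff mutate_matrix_nth)
  moreover have "lmon ?y1 e = lmon y e" if "e $ k = 0" for e
    by (rule lmon_cong) (use that in \<open>auto simp: mutate_cluster_def\<close>)
  ultimately have "exchange_poly ?y1 (mutate_matrix k C) i = exchange_poly y C i"
    using equal by (simp add: exchange_poly_lmon)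
  then have "mutate_cluster i ?y1 (mutate_matrix k C) i = mutate_cluster i y C i"
    using ik by (simp add: mutate_cluster_def)
  then show ?thesis using var_in_laurent by metis
qed

definition upper ::
    "('n::{finite,linorder} \<Rightarrow> 'n ratfun) \<Rightarrow> 'n int_matrix \<Rightarrow> 'n ratfun set" where
  "upper y C = laurent y UNIV \<inter> (\<Inter>i. laurent (mutate_cluster i y C) UNIV)"

text \<open>
  What has to be shown is that \<open>f\<close> is Laurent in the seed obtained by mutation at \<open>k\<close> and then at some
  \<open>i \<noteq> k\<close>.  A quiver on two vertices is acyclic, so \<open>f\<close> lies in the lower bound with the two mutable
  directions \<open>i\<close> and \<open>k\<close>, and the generators of that algebra are Laurent in the new seed.
\<close>

lemma upper_subset_mutate:
  assumes good: "good_seed y C"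
  shows "upper y C \<subseteq> upper (mutate_cluster k y C) (mutate_matrix k C)"
proof
  fix f assume f: "f \<in> upper y C"
  have y: "torus y" and skew: "skew_symmetric C" using good by (auto simp: good_seed_def)
  let ?y1 = "mutate_cluster k y C" and ?C1 = "mutate_matrix k C"
  have y1: "torus ?y1" by (rule torus_mutate[OF y skew_diag[OF skew]])
  have C1: "?C1 $ i $ i = 0" for i by (rule skew_diag[OF mutate_matrix_skew[OF skew]])
  have "f \<in> laurent (mutate_cluster i ?y1 ?C1) UNIV" for i
  proof (cases "i = k")
    case True
    then show ?thesis
      using f unfolding True mutate_cluster_involutive[OF y skew_diag[OF skew]] by (simp add: upper_def)
  next
    case ik: False
    let ?z = "mutate_cluster i ?y1 ?C1"
    note old = double_mutation_old_variables[OF y skew ik]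
    have "acyclic {(a, b). a \<in> {i, k} \<and> b \<in> {i, k} \<and> C $ a $ b > 0}"
    proof -
      have "{(a, b). a \<in> {i, k} \<and> b \<in> {i, k} \<and> C $ a $ b > 0} \<subseteq> (if C $ i $ k > 0 then {(i, k)} else {(k, i)})"
        using skew_diag[OF skew] skew_nth[OF skew, of i k] by auto
      moreover have "acyclic (if C $ i $ k > 0 then {(i, k)} else {(k, i)})"
        using ik by (auto simp: acyclic_insert acyclic_def[of "{}"])
      ultimately show ?thesis by (rule acyclic_subset[rotated])
    qed
    then have "f \<in> lower y C {i, k}"
      using f by (intro acyclic_in_lower[OF good]) (auto simp: upper_def)
    moreover have "lower y C {i, k} \<subseteq> laurent ?z UNIV"
      unfolding lower_def
    proof (rule hull_minimal)
      show "is_subalgebra (laurent ?z UNIV)"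
        by (rule is_subalgebra_laurent[of ?z, OF mutate_cluster_nonzero[OF y1]])
      have "mutate_cluster k y C k \<in> laurent ?z UNIV"
        by (rule cluster_in_mutated_laurent[OF y1 C1])
      then show "range y \<union> (\<lambda>j. inverse (y j)) ` (- {i, k}) \<union> (\<lambda>i. mutate_cluster i y C i) ` {i, k}
          \<subseteq> laurent ?z UNIV"
        using old double_mutation_exchange_any[OF y skew ik] by auto
    qed
    ultimately show ?thesis by blast
  qed
  then show "f \<in> upper ?y1 ?C1"
    using f by (auto simp: upper_def)
qed

lemma cluster_in_upper:
  assumes "good_seed y C"
  shows "y i \<in> upper y C"
  using assms cluster_in_mutated_laurent[of y C _ i] skew_diag[of C] var_in_laurent[of y i]
  by (simp add: upper_def good_seed_def)

text \<open>
  Mutation is an involution, so \<open>upper_subset_mutate\<close> also leads back from a seed towards the initial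
  one.
\<close>

lemma mutation_equivalent_upper:
  assumes "good_seed var B" and "mutation_equivalent B y C"
  shows "good_seed y C \<and> upper y C \<subseteq> upper var B"
  using assms(2)
proof induction
  case initial
  then show ?case using assms(1) by simp
next
  case (mutate y C k)
  then have good: "good_seed y C" and sub: "upper y C \<subseteq> upper var B" by auto
  have y: "torus y" and C: "C $ k $ k = 0" using good by (auto simp: good_seed_def skew_diag)
  have good': "good_seed (mutate_cluster k y C) (mutate_matrix k C)" by (rule good_seed_mutate[OF good])
  have "upper (mutate_cluster k y C) (mutate_matrix k C) \<subseteq> upper y C"
    using upper_subset_mutate[OF good', of k]
    by (simp add: mutate_cluster_involutive[OF y C] mutate_matrix_involutive[OF C])
  then show ?case using good' sub by blast
qed

text \<open>
  A cluster variable lies in the upper bound of its own seed, hence in that of the initial seed, and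
  acyclicity puts the latter into the lower bound.
\<close>

lemma cluster_algebra_eq_lower:
  assumes good: "good_seed var B" and ac: "acyclic {(i, j). B $ i $ j > 0}"
  shows "cluster_algebra B = lower var B UNIV"
proof
  show "cluster_algebra B \<subseteq> lower var B UNIV"
    unfolding cluster_algebra_def
  proof (rule hull_minimal)
    show "is_subalgebra (lower var B UNIV)" by (rule is_subalgebra_lower)
    show "{y i |y C i. mutation_equivalent B y C} \<subseteq> lower var B UNIV"
    proof clarify
      fix y C i assume "mutation_equivalent B y C"
      then have "y i \<in> upper var B"
        using mutation_equivalent_upper[OF good] cluster_in_upper by blast
      then show "y i \<in> lower var B UNIV"
        using ac by (intro acyclic_in_lower[OF good]) (auto simp: upper_def)
    qed
  qed
  have "var i \<in> cluster_algebra B" "mutate_cluster i var B i \<in> cluster_algebra B" for i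
    unfolding cluster_algebra_def
    by (rule hull_inc; use mutation_equivalent.intros in blast)+
  then show "lower var B UNIV \<subseteq> cluster_algebra B"
    unfolding lower_def
    by (intro hull_minimal) (auto simp: cluster_algebra_def is_subalgebra_alg)
qed

section \<open>Polynomials inside the function field\<close>

definition poly_emb :: "'n::{finite,linorder} cpoly \<Rightarrow> 'n ratfun" where
  "poly_emb p = Fract p 1"

lemma poly_emb_0 [simp]: "poly_emb 0 = 0" and poly_emb_1 [simp]: "poly_emb 1 = 1"
  by (simp_all add: poly_emb_def Zero_fract_def One_fract_def)

lemma poly_emb_add: "poly_emb (p + q) = poly_emb p + poly_emb q"
  and poly_emb_mult: "poly_emb (p * q) = poly_emb p * poly_emb q"
  by (simp_all add: poly_emb_def)

lemma poly_emb_sum: "poly_emb (sum f S) = (\<Sum>i\<in>S. poly_emb (f i))"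
  by (induction S rule: infinite_finite_induct) (simp_all add: poly_emb_add)

lemma poly_emb_eq_0_iff: "poly_emb p = 0 \<longleftrightarrow> p = 0"
  by (simp add: poly_emb_def Zero_fract_def eq_fract)

lemma const_poly_emb: "const c = poly_emb (Poly_Mapping.single 0 c)"
  by (simp add: const_def poly_emb_def)

lemma var_poly_emb: "var i = poly_emb (Poly_Mapping.single (Poly_Mapping.single i 1) 1)"
  by (simp add: var_def poly_emb_def)

lemma var_nonzero: "var i \<noteq> 0"
  unfolding var_poly_emb poly_emb_eq_0_iff by (metis lookup_single_eq lookup_zero zero_neq_one)

lemma var_power: "var i ^ k = poly_emb (Poly_Mapping.single (Poly_Mapping.single i k) 1)"
proof (induction k)
  case (Suc k)
  then show ?case
    by (simp add: var_poly_emb mult_single single_add[symmetric] flip: poly_emb_mult)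
qed (simp add: single_zero)

lemma var_power_prod:
  "(\<Prod>j\<in>S. var j ^ k j) = poly_emb (Poly_Mapping.single (\<Sum>j\<in>S. Poly_Mapping.single j (k j)) 1)"
  by (induction S rule: infinite_finite_induct)
    (simp_all add: var_power mult_single flip: poly_emb_mult)

lemma lookup_sum_single: "finite S \<Longrightarrow> Poly_Mapping.lookup (\<Sum>j\<in>S. Poly_Mapping.single j (k j)) i =
    (if i \<in> S then k i else (0::nat))"
  by (simp add: lookup_sum lookup_single when_def)

lemma poly_decompose:
  fixes p :: "'a \<Rightarrow>\<^sub>0 'b::comm_monoid_add"
  shows "p = (\<Sum>m\<in>Poly_Mapping.keys p. Poly_Mapping.single m (Poly_Mapping.lookup p m))"
  by (rule poly_mapping_eqI) (simp add: lookup_sum lookup_single when_def in_keys_iff)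

lemma poly_emb_monomial:
  fixes m :: "'n::{finite,linorder} \<Rightarrow>\<^sub>0 nat"
  shows "poly_emb (Poly_Mapping.single m c) = const c * (\<Prod>j\<in>UNIV. var j ^ Poly_Mapping.lookup m j)"
proof -
  have "(\<Sum>j\<in>UNIV. Poly_Mapping.single j (Poly_Mapping.lookup m j)) = m"
    by (rule poly_mapping_eqI) (simp add: lookup_sum_single)
  then show ?thesis
    by (simp add: var_power_prod const_poly_emb mult_single flip: poly_emb_mult)
qed

text \<open>
  Multiplication by a monomial makes all exponents of a given relation nonnegative; then it is a
  relation between distinct monomials of the polynomial ring.
\<close>

lemma torus_var: "torus (var :: 'n::{finite,linorder} \<Rightarrow> 'n ratfun)"
  unfolding torus_def
proof (intro conjI allI impI ballI)
  show "var j \<noteq> 0" for j :: 'n by (rule var_nonzero)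
  fix S :: "(int, 'n) vec set" and c e0
  assume S: "finite S" and sum0: "(\<Sum>e\<in>S. const (c e) * lmon (var :: 'n \<Rightarrow> 'n ratfun) e) = 0"
    and e0: "e0 \<in> S"
  define N :: "(int, 'n) vec" where "N = (\<chi> j. \<Sum>e\<in>S. \<bar>e $ j\<bar>)"
  have N: "e $ j + N $ j \<ge> 0" if "e \<in> S" for e j
  proof -
    have "\<bar>e $ j\<bar> \<le> (\<Sum>e\<in>S. \<bar>e $ j\<bar>)" by (rule member_le_sum) (use S that in auto)
    then show ?thesis by (simp add: N_def)
  qed
  define m where "m e = (\<Sum>j\<in>UNIV. Poly_Mapping.single j (nat (e $ j + N $ j)))" for e :: "(int, 'n) vec"
  have inj: "m e = m e0 \<longleftrightarrow> e = e0" if "e \<in> S" for e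
  proof
    assume eq: "m e = m e0"
    have "Poly_Mapping.lookup (m e) j = nat (e $ j + N $ j)" for e j
      by (simp add: m_def lookup_sum_single)
    then have q: "nat (e $ j + N $ j) = nat (e0 $ j + N $ j)" for j using eq by metis
    have "e $ j = e0 $ j" for j
      using q[of j] N[OF that, of j] N[OF e0, of j] by (simp only: eq_nat_nat_iff add_right_cancel)
    then show "e = e0" by (simp add: vec_eq_iff)
  qed simp
  have mon: "lmon var (e + N) = poly_emb (Poly_Mapping.single (m e) 1)" if "e \<in> S" for e
    using N[OF that] by (simp add: lmon_def power_int_nonneg_exp var_power_prod m_def)
  have "poly_emb (\<Sum>e\<in>S. Poly_Mapping.single (m e) (c e)) = (\<Sum>e\<in>S. const (c e) * lmon var (e + N))"
    by (simp add: poly_emb_sum mon const_poly_emb mult_single flip: poly_emb_mult)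
  also have "\<dots> = (\<Sum>e\<in>S. const (c e) * lmon var e) * lmon var N"
    by (simp add: lmon_add[of var, OF var_nonzero] sum_distrib_right mult.assoc)
  finally have "(\<Sum>e\<in>S. Poly_Mapping.single (m e) (c e)) = 0"
    by (simp add: sum0 poly_emb_eq_0_iff)
  then have "0 = Poly_Mapping.lookup (\<Sum>e\<in>S. Poly_Mapping.single (m e) (c e)) (m e0)" by simp
  also have "\<dots> = (\<Sum>e\<in>S. if e = e0 then c e else 0)"
    unfolding lookup_sum by (rule sum.cong) (auto simp: lookup_single when_def inj)
  also have "\<dots> = c e0" using S e0 by simp
  finally show "c e0 = 0" by simp
qed

section \<open>Derivations\<close>

definition derivation :: "('n::{finite,linorder} ratfun \<Rightarrow> 'n ratfun) \<Rightarrow> bool" where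
  "derivation D \<longleftrightarrow> (\<forall>f g. D (f + g) = D f + D g) \<and> (\<forall>f g. D (f * g) = D f * g + f * D g) \<and>
     (\<forall>c. D (const c) = 0)"

lemma derivationD:
  assumes "derivation D"
  shows "D (f + g) = D f + D g" "D (f * g) = D f * g + f * D g" "D (const c) = 0"
  using assms by (auto simp: derivation_def)

lemma derivation_0: "derivation D \<Longrightarrow> D 0 = 0" and derivation_1: "derivation D \<Longrightarrow> D 1 = 0"
  using derivationD(3)[of D 0] derivationD(3)[of D 1] by auto

lemma derivation_sum: "derivation D \<Longrightarrow> D (sum f S) = (\<Sum>i\<in>S. D (f i))"
  by (induction S rule: infinite_finite_induct) (auto simp: derivation_0 derivationD(1))

lemma derivation_scale: "derivation D \<Longrightarrow> D (const c * f) = const c * D f"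
  by (simp add: derivationD)

lemma derivation_of_int: "derivation D \<Longrightarrow> D (of_int k) = 0"
  using derivationD(3)[of D "of_int k"] by (simp add: const_of_int)

text \<open>
  The Leibniz rule reduces polynomials to variables and, through \<open>f * b = a\<close>, fractions to
  polynomials.
\<close>

lemma derivation_eq_0:
  assumes D: "derivation D" and var: "\<And>i. D (var i) = 0"
  shows "D f = 0"
proof -
  have mult: "D (f * g) = 0" if "D f = 0" "D g = 0" for f g using that by (simp add: derivationD[OF D])
  have pow: "D (f ^ k) = 0" if "D f = 0" for f k
    using that by (induction k) (auto simp: derivation_1[OF D] mult)
  have prod: "D (prod h S) = 0" if "\<And>i. D (h i) = 0" for h and S :: "'a set"
    using that by (induction S rule: infinite_finite_induct) (auto simp: derivation_1[OF D] mult)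
  have emb: "D (poly_emb p) = 0" for p
  proof -
    have "D (poly_emb (Poly_Mapping.single m c)) = 0" for m c
      unfolding poly_emb_monomial by (intro mult prod pow var derivationD(3)[OF D])
    then show ?thesis
      by (subst poly_decompose[of p]) (simp add: poly_emb_sum derivation_sum[OF D])
  qed
  show ?thesis
  proof (cases f)
    case (Fract a b)
    then have "f * poly_emb b = poly_emb a" by (simp add: poly_emb_def eq_fract)
    then have "D f * poly_emb b + f * D (poly_emb b) = D (poly_emb a)"
      by (metis derivationD(2)[OF D])
    then show ?thesis using Fract emb poly_emb_eq_0_iff[of b] by simp
  qed
qed

lemma derivation_log_mult:
  "derivation D \<Longrightarrow> D f = a * f \<Longrightarrow> D g = b * g \<Longrightarrow> D (f * g) = (a + b) * (f * g)"
  by (simp add: derivationD algebra_simps)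

lemma derivation_log_power_int:
  assumes D: "derivation D" and f: "D f = of_int a * f" "f \<noteq> 0"
  shows "D (f powi m) = of_int (m * a) * f powi m"
proof -
  have pow: "D (f ^ k) = of_int (int k * a) * f ^ k" for k
  proof (induction k)
    case (Suc k)
    show ?case using derivation_log_mult[OF D f(1) Suc.IH] by (simp add: algebra_simps)
  qed (simp add: derivation_1[OF D])
  show ?thesis
  proof (cases "m \<ge> 0")
    case True
    then show ?thesis using pow[of "nat m"] by (simp add: power_int_nonneg_exp)
  next
    case False
    define k where "k = nat (- m)"
    have m: "m = - int k" using False by (simp add: k_def)
    have "f ^ k * f powi m = 1" using f(2) by (simp add: m power_int_minus)
    then have "D (f ^ k) * f powi m + f ^ k * D (f powi m) = 0"
      using derivationD(2)[OF D, of "f ^ k" "f powi m"] by (simp add: derivation_1[OF D])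
    then have "f ^ k * D (f powi m) = f ^ k * (of_int (m * a) * f powi m)"
      by (simp add: pow m algebra_simps eq_neg_iff_add_eq_0)
    then show ?thesis using f(2) by simp
  qed
qed

lemma derivation_log_prod:
  fixes h :: "'n::{finite,linorder} \<Rightarrow> 'n ratfun"
  assumes D: "derivation D" and "\<And>i. D (h i) = of_int (a i) * h i"
  shows "D (prod h S) = of_int (sum a S) * prod h S"
  using assms(2)
  by (induction S rule: infinite_finite_induct)
    (auto simp: derivation_1[OF D] derivation_log_mult[OF D])

text \<open>
  The operator \<open>x\<^sub>i \<partial>/\<partial>x\<^sub>i\<close>.
\<close>

definition euler_poly :: "'n::{finite,linorder} \<Rightarrow> 'n cpoly \<Rightarrow> 'n cpoly" where
  "euler_poly i = Poly_Mapping.mapp (\<lambda>m c. of_nat (Poly_Mapping.lookup m i) * c)"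

lemma lookup_euler_poly:
  "Poly_Mapping.lookup (euler_poly i p) m = of_nat (Poly_Mapping.lookup m i) * Poly_Mapping.lookup p m"
  by (simp add: euler_poly_def lookup_mapp when_def in_keys_iff)

lemma euler_poly_add: "euler_poly i (p + q) = euler_poly i p + euler_poly i q"
  by (rule poly_mapping_eqI) (simp add: lookup_euler_poly lookup_add distrib_left)

lemma euler_poly_sum: "euler_poly i (sum f S) = (\<Sum>x\<in>S. euler_poly i (f x))"
proof -
  have "euler_poly i 0 = 0" by (rule poly_mapping_eqI) (simp add: lookup_euler_poly)
  then show ?thesis
    by (induction S rule: infinite_finite_induct) (simp_all add: euler_poly_add)
qed

lemma euler_poly_single:
  "euler_poly i (Poly_Mapping.single m c) = Poly_Mapping.single m (of_nat (Poly_Mapping.lookup m i) * c)"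
  by (rule poly_mapping_eqI) (simp add: lookup_euler_poly lookup_single when_def)

lemma euler_poly_1: "euler_poly i 1 = 0"
  using euler_poly_single[of i 0 1] by simp

lemma euler_poly_mult: "euler_poly i (p * q) = euler_poly i p * q + p * euler_poly i q"
proof -
  have mono: "euler_poly i (Poly_Mapping.single m c * Poly_Mapping.single n d)
      = euler_poly i (Poly_Mapping.single m c) * Poly_Mapping.single n d
        + Poly_Mapping.single m c * euler_poly i (Poly_Mapping.single n d)" for m n c d
    by (simp add: euler_poly_single mult_single lookup_add distrib_right algebra_simps flip: single_add)
  have right: "euler_poly i (Poly_Mapping.single m c * q)
      = euler_poly i (Poly_Mapping.single m c) * q + Poly_Mapping.single m c * euler_poly i q" for m c
    by (subst (1 2 3) poly_decompose[of q])
      (simp only: sum_distrib_left euler_poly_sum mono sum.distrib)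
  show ?thesis
    by (subst (1 2 3) poly_decompose[of p])
      (simp only: sum_distrib_right euler_poly_sum right sum.distrib)
qed

text \<open>
  The extension to fractions by the quotient rule.  By \<open>euler_well_defined\<close> the value is the same for
  all representations of a fraction.
\<close>

definition euler :: "'n::{finite,linorder} \<Rightarrow> 'n ratfun \<Rightarrow> 'n ratfun" where
  "euler i q = (THE r. \<exists>a b. b \<noteq> 0 \<and> q = Fract a b \<and>
     r = Fract (euler_poly i a * b - a * euler_poly i b) (b * b))"

lemma euler_well_defined:
  fixes a b a' b' :: "'n::{finite,linorder} cpoly"
  assumes nz: "b \<noteq> 0" "b' \<noteq> 0" and eq: "a * b' = a' * b"
  shows "Fract (euler_poly i a * b - a * euler_poly i b) (b * b)
    = Fract (euler_poly i a' * b' - a' * euler_poly i b') (b' * b')"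
proof -
  let ?D = "euler_poly i"
  have D: "?D a * b' + a * ?D b' = ?D a' * b + a' * ?D b"
    using arg_cong[OF eq, of ?D] by (simp add: euler_poly_mult)
  have "(?D a * b - a * ?D b) * (b' * b')
      = b * b' * (?D a * b' + a * ?D b') - b * (a * b') * ?D b' - (a * b') * b' * ?D b"
    by (simp add: algebra_simps)
  also have "\<dots> = b * b' * (?D a' * b + a' * ?D b) - b * (a' * b) * ?D b' - (a' * b) * b' * ?D b"
    by (simp only: D eq)
  also have "\<dots> = (?D a' * b' - a' * ?D b') * (b * b)"
    by (simp add: algebra_simps)
  finally show ?thesis
    using nz eq_fract(1)[of "b * b" "b' * b'"] by (simp only: mult_eq_0_iff simp_thms)
qed

lemma euler_Fract:
  assumes "b \<noteq> 0"
  shows "euler i (Fract a b) = Fract (euler_poly i a * b - a * euler_poly i b) (b * b)"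
  unfolding euler_def
proof (rule the_equality)
  fix r
  assume "\<exists>a' b'. b' \<noteq> 0 \<and> Fract a b = Fract a' b' \<and>
     r = Fract (euler_poly i a' * b' - a' * euler_poly i b') (b' * b')"
  then obtain a' b' where b': "b' \<noteq> 0" and eq: "Fract a b = Fract a' b'"
    and r: "r = Fract (euler_poly i a' * b' - a' * euler_poly i b') (b' * b')" by blast
  have "a * b' = a' * b" using eq unfolding eq_fract(1)[OF assms b'] .
  from euler_well_defined[OF assms b' this] r
  show "r = Fract (euler_poly i a * b - a * euler_poly i b) (b * b)" by simp
qed (use assms in blast)

lemma derivation_euler: "derivation (euler i)"
  unfolding derivation_def
proof (intro conjI allI)
  let ?D = "euler_poly i"
  fix f g :: "'a ratfun"
  obtain a b where f: "f = Fract a b" "b \<noteq> 0" by (cases f)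
  obtain c d where g: "g = Fract c d" "d \<noteq> 0" by (cases g)
  show "euler i (f + g) = euler i f + euler i g"
    using f g by (simp add: euler_Fract eq_fract euler_poly_add euler_poly_mult) (simp add: algebra_simps)
  show "euler i (f * g) = euler i f * g + f * euler i g"
    using f g by (simp add: euler_Fract eq_fract euler_poly_add euler_poly_mult) (simp add: algebra_simps)
  show "euler i (const c) = 0" for c
    by (simp add: const_def euler_Fract Zero_fract_def eq_fract euler_poly_single euler_poly_1)
qed

lemma euler_var: "euler i (var j) = of_int (if i = j then 1 else 0) * var j"
proof -
  have "euler i (var j) = poly_emb (euler_poly i (Poly_Mapping.single (Poly_Mapping.single j 1) 1))"
    by (simp add: var_def euler_Fract poly_emb_def euler_poly_single euler_poly_1)
  also have "\<dots> = of_int (if i = j then 1 else 0) * var j"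
    by (simp add: euler_poly_single lookup_single when_def var_poly_emb)
  finally show ?thesis .
qed

text \<open>
  The commutator of two derivations is a derivation, and this one annihilates the variables.
\<close>

lemma euler_commute: "euler i (euler j f) = euler j (euler i f)"
proof -
  let ?D = "\<lambda>f. euler i (euler j f) + const (- 1) * euler j (euler i f)"
  have "derivation ?D"
    unfolding derivation_def by (simp add: derivationD[OF derivation_euler] derivation_0[OF derivation_euler]
        const_minus algebra_simps)
  moreover have "?D (var k) = 0" for k
    by (simp add: euler_var derivationD[OF derivation_euler] derivation_0[OF derivation_euler]
        derivation_1[OF derivation_euler] const_minus)
  ultimately have "?D f = 0" by (rule derivation_eq_0)
  then show ?thesis by (simp add: const_minus)
qed

lemma euler_lmon: "euler i (lmon var e) = of_int (e $ i) * lmon var e"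
proof -
  have "euler i (var j powi (e $ j)) = of_int (e $ j * (if i = j then 1 else 0)) * var j powi (e $ j)" for j
    by (rule derivation_log_power_int[OF derivation_euler euler_var var_nonzero])
  from derivation_log_prod[OF derivation_euler this, where S = UNIV]
  show ?thesis by (simp add: lmon_def if_distrib cong: if_cong)
qed

section \<open>The Poisson bracket\<close>

text \<open>
  In logarithmic coordinates the bracket has constant coefficients.
\<close>

definition log_bracket ::
    "('n::{finite,linorder}) int_matrix \<Rightarrow> 'n ratfun \<Rightarrow> 'n ratfun \<Rightarrow> 'n ratfun" where
  "log_bracket L f g = (\<Sum>i\<in>UNIV. \<Sum>j\<in>UNIV. of_int (L $ i $ j) * euler i f * euler j g)"

definition pairing :: "('n::finite) int_matrix \<Rightarrow> (int, 'n) vec \<Rightarrow> (int, 'n) vec \<Rightarrow> int" where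
  "pairing L e e' = (\<Sum>i\<in>UNIV. \<Sum>j\<in>UNIV. L $ i $ j * e $ i * e' $ j)"

lemma log_bracket_lmon:
  "log_bracket L (lmon var e) (lmon var e') = of_int (pairing L e e') * (lmon var e * lmon var e')"
  by (simp add: log_bracket_def pairing_def euler_lmon sum_distrib_left sum_distrib_right mult_ac)

lemma log_bracket_derivation: "derivation (log_bracket L f)"
  unfolding derivation_def log_bracket_def
  by (simp add: derivationD[OF derivation_euler] sum.distrib sum_distrib_left sum_distrib_right algebra_simps)

lemma log_bracket_antisym:
  assumes "skew_symmetric L"
  shows "log_bracket L f g = - log_bracket L g f"
proof -
  have "log_bracket L f g = (\<Sum>j\<in>UNIV. \<Sum>i\<in>UNIV. of_int (L $ i $ j) * euler i f * euler j g)"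
    unfolding log_bracket_def by (rule sum.swap)
  also have "\<dots> = (\<Sum>j\<in>UNIV. \<Sum>i\<in>UNIV. - (of_int (L $ j $ i) * euler j g * euler i f))"
  proof (intro sum.cong refl)
    fix i j
    show "of_int (L $ i $ j) * euler i f * euler j g = - (of_int (L $ j $ i) * euler j g * euler i f)"
      unfolding skew_nth[OF assms, of i j] by (simp add: mult_ac)
  qed
  finally show ?thesis by (simp add: log_bracket_def sum_negf)
qed

text \<open>
  Because the Euler operators commute, a double bracket is a difference of two expressions \<open>S\<close>, in
  which the second derivatives fall on the middle argument.  These are symmetric in the two outer
  arguments, so the six terms of the cyclic sum cancel in pairs.
\<close>

lemma log_bracket_jacobi:
  assumes skew: "skew_symmetric L"
  shows "log_bracket L f (log_bracket L g h) + log_bracket L g (log_bracket L h f)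
    + log_bracket L h (log_bracket L f g) = 0"
proof -
  define X where "X j f = (\<Sum>i\<in>UNIV. of_int (L $ i $ j) * euler i f)" for j and f :: "'a ratfun"
  have br: "log_bracket L f g = (\<Sum>j\<in>UNIV. X j f * euler j g)" for f g
    unfolding log_bracket_def X_def by (subst sum.swap) (simp add: sum_distrib_right)
  define S where "S f g h = (\<Sum>j\<in>UNIV. \<Sum>k\<in>UNIV. X j f * euler j (euler k g) * X k h)"
    for f g h :: "'a ratfun"
  have sym: "S f g h = S h g f" for f g h
    unfolding S_def by (subst sum.swap) (simp add: euler_commute mult_ac)
  have EX: "euler j (X k g) = (\<Sum>l\<in>UNIV. of_int (L $ l $ k) * euler j (euler l g))" for j k g
    unfolding X_def
    by (simp add: derivation_sum[OF derivation_euler] derivationD[OF derivation_euler]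
        derivation_of_int[OF derivation_euler])
  have XL: "(\<Sum>k\<in>UNIV. of_int (L $ l $ k) * euler k h) = - X l h" for l h
    unfolding X_def sum_negf[symmetric]
  proof (rule sum.cong)
    fix k show "of_int (L $ l $ k) * euler k h = - (of_int (L $ k $ l) * euler k h)"
      unfolding skew_nth[OF skew, of l k] by simp
  qed simp
  have inner: "(\<Sum>k\<in>UNIV. euler j (X k g) * euler k h) = - (\<Sum>l\<in>UNIV. euler j (euler l g) * X l h)" for g h j
  proof -
    have "(\<Sum>k\<in>UNIV. euler j (X k g) * euler k h)
        = (\<Sum>l\<in>UNIV. \<Sum>k\<in>UNIV. euler j (euler l g) * (of_int (L $ l $ k) * euler k h))"
      unfolding EX sum_distrib_right by (subst sum.swap) (simp add: mult_ac)
    also have "\<dots> = (\<Sum>l\<in>UNIV. euler j (euler l g) * - X l h)"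
      unfolding sum_distrib_left[symmetric] XL ..
    finally show ?thesis by (simp add: sum_negf)
  qed
  have double: "log_bracket L f (log_bracket L g h) = S f h g - S f g h" for f g h
  proof -
    have "log_bracket L f (log_bracket L g h)
        = (\<Sum>j\<in>UNIV. X j f * (\<Sum>k\<in>UNIV. euler j (X k g) * euler k h + X k g * euler j (euler k h)))"
      by (simp add: br derivation_sum[OF derivation_euler] derivationD[OF derivation_euler])
    also have "\<dots> = (\<Sum>j\<in>UNIV. X j f * (\<Sum>k\<in>UNIV. euler j (X k g) * euler k h)) + S f h g"
      by (simp add: S_def sum.distrib distrib_left sum_distrib_left mult_ac)
    also have "(\<Sum>j\<in>UNIV. X j f * (\<Sum>k\<in>UNIV. euler j (X k g) * euler k h)) = - S f g h"
      unfolding inner by (simp add: S_def sum_negf sum_distrib_left mult.assoc)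
    finally show ?thesis by simp
  qed
  show ?thesis
    unfolding double using sym[of f h g] sym[of f g h] sym[of g f h] by simp
qed

lemma log_bracket_poisson:
  assumes skew: "skew_symmetric L"
  shows "is_poisson_bracket (log_bracket L)"
proof -
  note R = derivationD[OF log_bracket_derivation]
  note A = log_bracket_antisym[OF skew]
  have add: "log_bracket L (f + g) h = log_bracket L f h + log_bracket L g h" for f g h
    using A[of "f + g" h] A[of f h] A[of g h] by (simp only: R(1) minus_add_distrib)
  have scale: "log_bracket L (const c * f) g = const c * log_bracket L f g" for c f g
    using A[of "const c * f" g] A[of f g]
    by (simp only: derivation_scale[OF log_bracket_derivation] mult_minus_right)
  show ?thesis
    unfolding is_poisson_bracket_def
    by (intro conjI allI add scale A R(2) log_bracket_jacobi[OF skew])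
qed

lemma poisson_bracket_derivation:
  assumes br: "is_poisson_bracket br"
  shows "derivation (br f)"
proof -
  have lin: "br (f + g) h = br f h + br g h" "br (const c * f) g = const c * br f g"
    "br f g = - br g f" "br f (g * h) = br f g * h + g * br f h" for f g h c
    using br unfolding is_poisson_bracket_def by blast+
  have "br f (g + h) = br f g + br f h" for g h
    using lin(3)[of f "g + h"] lin(3)[of f g] lin(3)[of f h] by (simp add: lin(1))
  moreover have "br f (const c) = 0" for c
  proof -
    have "br f 1 = 0" using lin(4)[of f 1 1]
      by (simp only: mult_1_right mult_1_left add_cancel_right_right)
    then show ?thesis using lin(2)[of c 1 f] lin(3)[of f "const c"] lin(3)[of f 1] by simp
  qed
  ultimately show ?thesis unfolding derivation_def using lin(4) by blast
qed

lemma derivation_unique: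
  assumes D: "derivation D" and D': "derivation D'" and eq: "\<And>i. D (var i) = D' (var i)"
  shows "D f = D' f"
proof -
  have "derivation (\<lambda>f. D f - D' f)"
    unfolding derivation_def by (simp add: derivationD[OF D] derivationD[OF D'] algebra_simps)
  then have "D f - D' f = 0" by (rule derivation_eq_0) (simp add: eq)
  then show ?thesis by simp
qed

lemma log_bracket_var: "log_bracket L (var i) (var j) = of_int (L $ i $ j) * var i * var j"
proof -
  have "log_bracket L (var i) (var j) = (\<Sum>k\<in>UNIV. \<Sum>l\<in>UNIV. if l = j then
      (if k = i then of_int (L $ i $ j) * var i * var j else 0) else 0)"
    unfolding log_bracket_def euler_var by (intro sum.cong refl) auto
  then show ?thesis by simp
qed

text \<open>
  A bracket is a derivation in each argument and therefore determined by its values on the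
  variables.
\<close>

lemma poisson_bracket_eq:
  assumes skew: "skew_symmetric L"
  shows "poisson_bracket L = log_bracket L"
  unfolding poisson_bracket_def
proof (rule the_equality)
  show "is_poisson_bracket (log_bracket L) \<and>
    (\<forall>i j. log_bracket L (var i) (var j) = of_int (L $ i $ j) * var i * var j)"
    by (simp add: log_bracket_poisson[OF skew] log_bracket_var)
  fix br assume br: "is_poisson_bracket br \<and>
    (\<forall>i j. br (var i) (var j) = of_int (L $ i $ j) * var i * var j)"
  then have anti: "br f g = - br g f" for f g unfolding is_poisson_bracket_def by blast
  have D: "derivation (br f)" for f using br by (simp add: poisson_bracket_derivation)
  have "br (var i) f = log_bracket L (var i) f" for i f
    by (rule derivation_unique[OF D log_bracket_derivation]) (simp add: br log_bracket_var)
  then have vars: "br f (var i) = log_bracket L f (var i)" for i f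
    using anti[of f "var i"] log_bracket_antisym[OF skew, of f "var i"] by simp
  show "br = log_bracket L"
  proof (intro ext)
    fix f g show "br f g = log_bracket L f g"
      by (rule derivation_unique[OF D log_bracket_derivation vars])
  qed
qed

section \<open>The bracket on the cluster algebra\<close>

text \<open>
  The elements of the subalgebra that the derivation maps into it form a subalgebra.
\<close>

lemma derivation_preserves_alg:
  assumes D: "derivation D" and gens: "\<And>s. s \<in> S \<Longrightarrow> D s \<in> alg S" and f: "f \<in> alg S"
  shows "D f \<in> alg S"
proof -
  let ?L = "{f \<in> alg S. D f \<in> alg S}"
  note sub = is_subalgebra_alg[of S]
  have "is_subalgebra ?L"
    unfolding is_subalgebra_def[of ?L]
    by (auto simp: derivationD[OF D] intro: sub_const[OF sub] sub_0[OF sub] sub_add[OF sub] sub_mult[OF sub])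
  moreover have "S \<subseteq> ?L" using gens by (auto intro: hull_inc)
  ultimately have "alg S \<subseteq> ?L" by (rule hull_minimal[rotated])
  then show ?thesis using f by blast
qed

lemma pairing_add_left: "pairing L (e + e') u = pairing L e u + pairing L e' u"
  and pairing_add_right: "pairing L u (e + e') = pairing L u e + pairing L u e'"
  by (simp_all add: pairing_def algebra_simps sum.distrib)

lemma pairing_antisym:
  assumes "skew_symmetric L"
  shows "pairing L e e' = - pairing L e' e"
proof -
  have "pairing L e e' = (\<Sum>j\<in>UNIV. \<Sum>i\<in>UNIV. L $ i $ j * e $ i * e' $ j)"
    unfolding pairing_def by (rule sum.swap)
  also have "\<dots> = (\<Sum>j\<in>UNIV. \<Sum>i\<in>UNIV. - (L $ j $ i * e' $ j * e $ i))"
  proof (intro sum.cong refl)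
    fix i j show "L $ i $ j * e $ i * e' $ j = - (L $ j $ i * e' $ j * e $ i)"
      unfolding skew_nth[OF assms, of i j] by (simp add: mult_ac)
  qed
  finally show ?thesis by (simp add: pairing_def sum_negf)
qed

lemma log_bracket_add_left: "log_bracket L (f + g) h = log_bracket L f h + log_bracket L g h"
  and log_bracket_scale_left: "log_bracket L (const c * f) h = const c * log_bracket L f h"
  and log_bracket_mult_left: "log_bracket L (f * g) h = log_bracket L f h * g + f * log_bracket L g h"
  and log_bracket_const_left: "log_bracket L (const c) h = 0"
  unfolding log_bracket_def
  by (simp_all add: derivationD[OF derivation_euler] sum.distrib sum_distrib_left
      sum_distrib_right algebra_simps)

locale acyclic_compatible =
  fixes B \<Lambda> :: "('n::{finite,linorder}) int_matrix"
  assumes skew: "skew_symmetric B" and inv: "invertible (rat_matrix B)"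
    and acyclic: "acyclic {(i, j). B $ i $ j > 0}" and compat: "compatible_pair B \<Lambda>"
begin

abbreviation xm :: "'n \<Rightarrow> 'n ratfun" where
  "xm i \<equiv> mutate_cluster i var B i"

abbreviation br :: "'n ratfun \<Rightarrow> 'n ratfun \<Rightarrow> 'n ratfun" where
  "br \<equiv> log_bracket \<Lambda>"

definition diag :: "'n \<Rightarrow> int" where
  "diag i = (B ** \<Lambda>) $ i $ i"

lemma skew_L: "skew_symmetric \<Lambda>"
  using compat by (simp add: compatible_pair_def)

lemma BL: "(B ** \<Lambda>) $ i $ j = (if i = j then diag i else 0)"
  using compat by (simp add: compatible_pair_def diag_def)

lemma diag_pos: "diag i > 0"
  using compat by (simp add: compatible_pair_def diag_def)

lemma cluster_algebra_alg: "cluster_algebra B = alg (range var \<union> range xm)"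
proof -
  have "good_seed var B" using skew inv torus_var by (simp add: good_seed_def)
  from cluster_algebra_eq_lower[OF this acyclic] show ?thesis
    by (simp add: lower_def)
qed

abbreviation A :: "'n ratfun set" where
  "A \<equiv> cluster_algebra B"

lemma sub_A: "is_subalgebra A"
  unfolding cluster_algebra_alg by (rule is_subalgebra_alg)

lemmas const_A = sub_const[OF sub_A]
  and add_A = sub_add[OF sub_A]
  and mult_A = sub_mult[OF sub_A]
  and minus_A = sub_minus[OF sub_A]
  and diff_A = sub_diff[OF sub_A]
  and sum_A = sub_sum[OF sub_A]

lemma var_A: "var i \<in> A" and xm_A: "xm i \<in> A"
  unfolding cluster_algebra_alg by (auto intro: hull_inc)

lemma lmon_A: "(\<And>j. e $ j \<ge> 0) \<Longrightarrow> lmon var e \<in> A"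
  by (rule lmon_in_subalgebra[OF sub_A var_A]) (simp add: not_less[symmetric])

lemma of_int_A: "of_int k \<in> A"
  using const_A[of "of_int k"] by (simp add: const_of_int)

text \<open>
  The form in which compatibility is used: the bracket of a monomial with \<open>x\<close> to the power of the
  \<open>i\<close>-th row of \<open>B\<close> only depends on its exponent at \<open>i\<close>.
\<close>

lemma pairing_row: "pairing \<Lambda> (B $ i) e = diag i * e $ i"
proof -
  have "pairing \<Lambda> (B $ i) e = (\<Sum>j\<in>UNIV. (B ** \<Lambda>) $ i $ j * e $ j)"
    unfolding pairing_def matrix_matrix_mult_def
    by (subst sum.swap) (simp add: sum_distrib_left sum_distrib_right mult_ac)
  also have "\<dots> = (\<Sum>j\<in>UNIV. if j = i then diag i * e $ i else 0)"
    by (rule sum.cong) (auto simp: BL)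
  finally show ?thesis by simp
qed

text \<open>
  The exponents of the two monomials of \<open>x\<^sub>i'\<close>.
\<close>

definition pos_exp :: "'n \<Rightarrow> (int, 'n) vec" where "pos_exp i = posp (B $ i) - axis i 1"
definition neg_exp :: "'n \<Rightarrow> (int, 'n) vec" where "neg_exp i = negp (B $ i) - axis i 1"

lemma pos_exp_eq: "pos_exp i = B $ i + neg_exp i"
  by (simp add: pos_exp_def neg_exp_def posp_eq)

lemma lmon_split: "lmon var (e + e') = lmon var e * lmon var e'"
  by (rule lmon_add) (rule var_nonzero)

lemma lmon_shift: "lmon var (e - axis i 1) * var i = lmon var e"
  using lmon_split[of "e - axis i 1" "axis i 1"] by (simp add: lmon_axis)

lemma xm_eq: "xm i = lmon var (neg_exp i) + lmon var (pos_exp i)"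
proof -
  have "xm i * var i = lmon var (posp (B $ i)) + lmon var (negp (B $ i))"
    by (simp add: mutate_cluster_same var_nonzero exchange_poly_lmon)
  also have "\<dots> = (lmon var (neg_exp i) + lmon var (pos_exp i)) * var i"
    by (simp add: neg_exp_def pos_exp_def distrib_right lmon_shift add.commute)
  finally have "xm i * var i = (lmon var (neg_exp i) + lmon var (pos_exp i)) * var i" .
  then show ?thesis by (simp add: var_nonzero)
qed

lemma var_xm: "var i * xm i = lmon var (posp (B $ i)) + lmon var (negp (B $ i))"
  by (simp add: mutate_cluster_same var_nonzero exchange_poly_lmon)

lemma br_xm_lmon: "br (xm i) (lmon var e) =
  of_int (pairing \<Lambda> (neg_exp i) e) * (xm i * lmon var e) + of_int (diag i * e $ i) * lmon var (pos_exp i + e)"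
  unfolding xm_eq log_bracket_add_left log_bracket_lmon
  by (simp add: pos_exp_eq pairing_add_left pairing_row lmon_split algebra_simps)

lemma br_xm_var: "br (xm i) (var j) =
  of_int (pairing \<Lambda> (neg_exp i) (axis j 1)) * (xm i * var j)
    + (if i = j then of_int (diag i) * lmon var (posp (B $ i)) else 0)"
proof -
  have "lmon var (axis j 1) = var j" by (simp add: lmon_axis)
  moreover have "pos_exp j + axis j 1 = posp (B $ j)" by (simp add: pos_exp_def)
  ultimately show ?thesis
    using br_xm_lmon[of i "axis j 1"] by (auto simp: axis_def)
qed

text \<open>
  If \<open>B\<^sub>i\<^sub>j \<ge> 0\<close> then both monomials of \<open>x\<^sub>j'\<close> have the same pairing with the first monomial of
  \<open>x\<^sub>i'\<close>, and only one of them contains \<open>x\<^sub>i\<close>.  So a single monomial remains besides the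
  log-canonical term.
\<close>

lemma br_xm_xm:
  assumes "B $ i $ j \<ge> 0" and ij: "i \<noteq> j"
  shows "br (xm i) (xm j) = of_int (pairing \<Lambda> (neg_exp i) (neg_exp j)) * (xm i * xm j)
    + of_int (diag i * B $ i $ j) * lmon var (pos_exp i + neg_exp j)"
proof -
  have comps: "neg_exp j $ i = B $ i $ j" "pos_exp j $ i = 0" "neg_exp i $ j = 0"
    using assms skew_nth[OF skew, of j i] by (auto simp: neg_exp_def pos_exp_def axis_def)
  have "pairing \<Lambda> (neg_exp i) (B $ j) = 0"
    using pairing_antisym[OF skew_L, of "neg_exp i" "B $ j"] by (simp add: pairing_row comps)
  then have eq: "pairing \<Lambda> (neg_exp i) (pos_exp j) = pairing \<Lambda> (neg_exp i) (neg_exp j)"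
    by (simp add: pos_exp_eq[of j] pairing_add_right)
  have "br (xm i) (xm j) = br (xm i) (lmon var (neg_exp j)) + br (xm i) (lmon var (pos_exp j))"
    unfolding xm_eq[of j] by (rule derivationD(1)[OF log_bracket_derivation])
  also have "\<dots> = of_int (pairing \<Lambda> (neg_exp i) (neg_exp j)) * (xm i * (lmon var (neg_exp j) + lmon var (pos_exp j)))
    + of_int (diag i * B $ i $ j) * lmon var (pos_exp i + neg_exp j)"
    unfolding br_xm_lmon comps eq by (simp add: algebra_simps)
  finally show ?thesis unfolding xm_eq[of j, symmetric] .
qed

text \<open>
  For \<open>B\<^sub>i\<^sub>j > 0\<close> the extra monomial is a polynomial: its denominators \<open>x\<^sub>i\<close> and \<open>x\<^sub>j\<close> are cancelled
  by the monomial of \<open>P\<^sub>j\<close> that contains \<open>x\<^sub>i\<close> and by the monomial of \<open>P\<^sub>i\<close> that contains \<open>x\<^sub>j\<close>.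
\<close>

lemma br_xm_xm_A: "br (xm i) (xm j) \<in> A"
proof -
  have pos: "br (xm i) (xm j) \<in> A" if "B $ i $ j \<ge> 0" "i \<noteq> j" for i j
  proof -
    have "of_int (diag i * B $ i $ j) * lmon var (pos_exp i + neg_exp j) \<in> A"
    proof (cases "B $ i $ j = 0")
      case True
      then show ?thesis by (simp add: sub_0[OF sub_A])
    next
      case False
      have "(pos_exp i + neg_exp j) $ k \<ge> 0" for k
        using False that skew_nth[OF skew, of j i] skew_diag[OF skew]
        by (auto simp: pos_exp_def neg_exp_def axis_def)
      then show ?thesis by (intro mult_A of_int_A lmon_A)
    qed
    then show ?thesis
      unfolding br_xm_xm[OF that]
      by (rule add_A[OF mult_A[OF of_int_A mult_A[OF xm_A xm_A]]])
  qed
  consider "i = j" | "i \<noteq> j" "B $ i $ j \<ge> 0" | "i \<noteq> j" "B $ j $ i \<ge> 0"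
    using skew_nth[OF skew, of i j] by linarith
  then show ?thesis
  proof cases
    case 1
    have "br (xm i) (xm i) + br (xm i) (xm i) = 0"
      using log_bracket_antisym[OF skew_L, of "xm i" "xm i"] by (simp only: eq_neg_iff_add_eq_0)
    then have "const (1 + 1) * br (xm i) (xm i) = 0"
      by (simp only: const_add const_1 distrib_right mult_1_left)
    then have "br (xm i) (xm i) = 0" unfolding mult_eq_0_iff const_eq_0_iff by simp
    then show ?thesis using 1 by (simp add: sub_0[OF sub_A])
  next
    case 2
    then show ?thesis by (intro pos)
  next
    case 3
    then have "br (xm j) (xm i) \<in> A" by (intro pos) auto
    then show ?thesis unfolding log_bracket_antisym[OF skew_L, of "xm i" "xm j"] by (rule minus_A)
  qed
qed

lemma br_var_var_A: "br (var i) (var j) \<in> A"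
  unfolding log_bracket_var by (intro mult_A of_int_A var_A)

lemma br_xm_var_A: "br (xm i) (var j) \<in> A"
  unfolding br_xm_var by (intro add_A mult_A of_int_A var_A xm_A)
    (auto intro!: mult_A of_int_A lmon_A sub_0[OF sub_A])

lemma br_closed:
  assumes f: "f \<in> A" and g: "g \<in> A"
  shows "br f g \<in> A"
proof -
  let ?S = "range var \<union> range xm"
  have swap: "br f g \<in> A" if "br g f \<in> A" for f g
    unfolding log_bracket_antisym[OF skew_L, of f g] using that by (rule minus_A)
  have gens: "br s t \<in> A" if "s \<in> ?S" "t \<in> ?S" for s t
    using that br_var_var_A br_xm_var_A br_xm_xm_A swap[OF br_xm_var_A] by auto
  have gen: "br s g \<in> A" if "s \<in> ?S" "g \<in> A" for s g
    using derivation_preserves_alg[OF log_bracket_derivation, of ?S \<Lambda> s g] gens[OF that(1)] that(2)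
    unfolding cluster_algebra_alg by blast
  have "br f s \<in> A" if "s \<in> ?S" for s
    using swap[OF gen[OF that f]] .
  then show ?thesis
    using derivation_preserves_alg[OF log_bracket_derivation, of ?S \<Lambda> f g] g
    unfolding cluster_algebra_alg by blast
qed

end

section \<open>Cotangent spaces\<close>

lemma ideal_square_0: "0 \<in> ideal_square I"
  unfolding ideal_square_def by (rule CollectI, rule exI[of _ 0]) simp

lemma ideal_square_prod: "f \<in> I \<Longrightarrow> g \<in> I \<Longrightarrow> f * g \<in> ideal_square I"
  unfolding ideal_square_def
  by (rule CollectI, rule exI[of _ 1], rule exI[of _ "\<lambda>_. f"], rule exI[of _ "\<lambda>_. g"]) simp

lemma ideal_square_add:
  assumes "q \<in> ideal_square I" "q' \<in> ideal_square I"
  shows "q + q' \<in> ideal_square I"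
proof -
  obtain k :: nat and f g where q: "q = (\<Sum>i<k. f i * g i)" "\<forall>i<k. f i \<in> I \<and> g i \<in> I"
    using assms(1) unfolding ideal_square_def by blast
  obtain k' :: nat and f' g' where q': "q' = (\<Sum>i<k'. f' i * g' i)" "\<forall>i<k'. f' i \<in> I \<and> g' i \<in> I"
    using assms(2) unfolding ideal_square_def by blast
  define F where "F i = (if i < k then f i else f' (i - k))" for i
  define G where "G i = (if i < k then g i else g' (i - k))" for i
  have "(\<Sum>i<k + k'. F i * G i) = (\<Sum>i<k. F i * G i) + (\<Sum>i<k'. F (k + i) * G (k + i))"
    by (induction k') (simp_all add: add.assoc)
  also have "\<dots> = q + q'" by (simp add: q(1) q'(1) F_def G_def)
  finally have "q + q' = (\<Sum>i<k + k'. F i * G i)" ..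
  moreover have "\<forall>i<k + k'. F i \<in> I \<and> G i \<in> I"
    using q(2) q'(2) by (auto simp: F_def G_def)
  ultimately show ?thesis unfolding ideal_square_def by blast
qed

lemma ideal_square_induct [consumes 1, case_names zero prod add]:
  assumes q: "q \<in> ideal_square I" and "P 0" and "\<And>f g. f \<in> I \<Longrightarrow> g \<in> I \<Longrightarrow> P (f * g)"
    and "\<And>a b. P a \<Longrightarrow> P b \<Longrightarrow> P (a + b)"
  shows "P q"
proof -
  obtain k :: nat and f g where q: "q = (\<Sum>i<k. f i * g i)" "\<forall>i<k. f i \<in> I \<and> g i \<in> I"
    using q unfolding ideal_square_def by blast
  have "(\<forall>i<k. f i \<in> I \<and> g i \<in> I) \<Longrightarrow> P (\<Sum>i<k. f i * g i)" for k
    by (induction k) (auto simp: assms)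
  with q show ?thesis by simp
qed

lemma ideal_square_mult:
  assumes I: "\<And>f. f \<in> I \<Longrightarrow> a * f \<in> I" and q: "q \<in> ideal_square I"
  shows "a * q \<in> ideal_square I"
  using q
proof (induction rule: ideal_square_induct)
  case (prod f g)
  then show ?case using ideal_square_prod[OF I[OF prod(1)] prod(2)] by (simp add: mult.assoc)
qed (auto simp: ideal_square_0 distrib_left intro: ideal_square_add)

text \<open>
  A point of the variety matters only through the evaluation homomorphism on the cluster algebra.
\<close>

locale acyclic_point = acyclic_compatible +
  fixes ev :: "'a ratfun \<Rightarrow> complex"
  assumes ev_const: "ev (const c) = c"
    and ev_add: "f \<in> cluster_algebra B \<Longrightarrow> g \<in> cluster_algebra B \<Longrightarrow> ev (f + g) = ev f + ev g"
    and ev_mult: "f \<in> cluster_algebra B \<Longrightarrow> g \<in> cluster_algebra B \<Longrightarrow> ev (f * g) = ev f * ev g"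
begin

lemma ev_0: "ev 0 = 0" and ev_1: "ev 1 = 1"
  using ev_const[of 0] ev_const[of 1] by auto

lemma ev_scale: "f \<in> A \<Longrightarrow> ev (const c * f) = c * ev f"
  by (simp add: ev_mult const_A ev_const)

lemma ev_of_int: "ev (of_int k) = of_int k"
  using ev_const[of "of_int k"] by (simp add: const_of_int)

lemma ev_of_int_mult: "f \<in> A \<Longrightarrow> ev (of_int k * f) = of_int k * ev f"
  using ev_scale[of f "of_int k"] by (simp add: const_of_int)

lemma ev_minus: "f \<in> A \<Longrightarrow> ev (- f) = - ev f"
  using ev_scale[of f "- 1"] by (simp add: const_minus)

lemma ev_diff: "f \<in> A \<Longrightarrow> g \<in> A \<Longrightarrow> ev (f - g) = ev f - ev g"
  using ev_add[of f "- g"] by (simp add: ev_minus minus_A)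

lemma ev_power: "f \<in> A \<Longrightarrow> ev (f ^ k) = ev f ^ k"
  by (induction k) (auto simp: ev_1 ev_mult sub_power[OF sub_A])

lemma ev_prod: "(\<And>i. i \<in> S \<Longrightarrow> f i \<in> A) \<Longrightarrow> ev (prod f S) = (\<Prod>i\<in>S. ev (f i))"
  by (induction S rule: infinite_finite_induct) (auto simp: ev_1 ev_mult sub_prod[OF sub_A])

lemma ev_lmon:
  assumes "\<And>j. e $ j \<ge> 0"
  shows "ev (lmon var e) = (\<Prod>j\<in>UNIV. ev (var j) ^ nat (e $ j))"
  using assms by (simp add: lmon_def power_int_nonneg_exp ev_prod ev_power sub_power[OF sub_A] var_A)

definition \<mm> :: "'a ratfun set" where
  "\<mm> = {f \<in> A. ev f = 0}"

abbreviation Q :: "'a ratfun set" where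
  "Q \<equiv> ideal_square \<mm>"

lemma \<mm>_add: "f \<in> \<mm> \<Longrightarrow> g \<in> \<mm> \<Longrightarrow> f + g \<in> \<mm>"
  and \<mm>_mult: "f \<in> A \<Longrightarrow> g \<in> \<mm> \<Longrightarrow> f * g \<in> \<mm>"
  and \<mm>_0: "0 \<in> \<mm>"
  by (auto simp: \<mm>_def ev_add ev_mult ev_0 add_A mult_A sub_0[OF sub_A])

lemma \<mm>_sum: "(\<And>i. i \<in> S \<Longrightarrow> f i \<in> \<mm>) \<Longrightarrow> sum f S \<in> \<mm>"
  by (induction S rule: infinite_finite_induct) (auto simp: \<mm>_0 \<mm>_add)

lemma Q_mult: "a \<in> A \<Longrightarrow> q \<in> Q \<Longrightarrow> a * q \<in> Q"
  by (rule ideal_square_mult) (rule \<mm>_mult)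

lemma Q_scale: "q \<in> Q \<Longrightarrow> const c * q \<in> Q"
  by (rule Q_mult[OF const_A])

lemma Q_minus: "q \<in> Q \<Longrightarrow> - q \<in> Q"
  using Q_scale[of q "- 1"] by (simp add: const_minus)

lemma Q_diff: "q \<in> Q \<Longrightarrow> q' \<in> Q \<Longrightarrow> q - q' \<in> Q"
  using ideal_square_add[of q \<mm> "- q'"] Q_minus[of q'] by simp

lemma Q_sum: "(\<And>i. i \<in> S \<Longrightarrow> f i \<in> Q) \<Longrightarrow> sum f S \<in> Q"
  by (induction S rule: infinite_finite_induct) (auto simp: ideal_square_0 ideal_square_add)

lemma Q_\<mm>: "q \<in> Q \<Longrightarrow> q \<in> \<mm>"
  by (induction rule: ideal_square_induct) (auto simp: \<mm>_0 \<mm>_add \<mm>_mult, auto simp: \<mm>_def ev_mult mult_A)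

lemma ev_br_Q:
  assumes q: "q \<in> Q" and h: "h \<in> A"
  shows "ev (br q h) = 0"
proof -
  have "br q h \<in> \<mm>"
    using q
  proof (induction rule: ideal_square_induct)
    case zero
    show ?case using log_bracket_const_left[of \<Lambda> 0 h] by (simp add: \<mm>_0)
  next
    case (prod f g)
    then have fg: "f \<in> A" "g \<in> A" "f \<in> \<mm>" "g \<in> \<mm>" by (auto simp: \<mm>_def)
    have "br f h * g + br g h * f \<in> \<mm>"
      using fg h by (intro \<mm>_add \<mm>_mult br_closed)
    then show ?case by (simp add: log_bracket_mult_left mult.commute)
  next
    case (add a b)
    then show ?case by (simp add: log_bracket_add_left \<mm>_add)
  qed
  then show ?thesis by (simp add: \<mm>_def)
qed

definition vanishing :: "'a set" where
  "vanishing = {i. ev (var i) = 0}"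

definition centred :: "'a ratfun \<Rightarrow> 'a ratfun" where
  "centred f = f - const (ev f)"

lemma centred_\<mm>: "f \<in> A \<Longrightarrow> centred f \<in> \<mm>"
  by (simp add: centred_def \<mm>_def diff_A const_A ev_diff ev_const)

lemma centred_of_\<mm>: "f \<in> \<mm> \<Longrightarrow> centred f = f"
  by (simp add: centred_def \<mm>_def)

lemma \<mm>_A: "f \<in> \<mm> \<Longrightarrow> f \<in> A"
  by (simp add: \<mm>_def)

lemma centred_add: "f \<in> A \<Longrightarrow> g \<in> A \<Longrightarrow> centred (f + g) = centred f + centred g"
  by (simp add: centred_def ev_add const_add)

lemma centred_scale: "f \<in> A \<Longrightarrow> centred (const c * f) = const c * centred f"
  by (simp add: centred_def ev_scale const_mult right_diff_distrib)

lemma centred_const: "centred (const c) = 0"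
  by (simp add: centred_def ev_const)

lemma centred_mult:
  assumes "f \<in> A" "g \<in> A"
  shows "centred (f * g) = const (ev f) * centred g + const (ev g) * centred f + centred f * centred g"
proof -
  have "u * v - a * b = a * (v - b) + b * (u - a) + (u - a) * (v - b)" for u v a b :: "'a ratfun"
    by (simp add: left_diff_distrib right_diff_distrib mult.commute)
  from this[of f g "const (ev f)" "const (ev g)"] assms show ?thesis
    by (simp only: centred_def ev_mult const_mult)
qed

lemma br_centred: "br (centred f) g = br f g"
proof -
  have "br (f + const (- ev f)) g = br f g"
    by (simp only: log_bracket_add_left log_bracket_const_left add_0_right)
  then show ?thesis by (simp add: centred_def const_minus)
qed

lemma ev_var_xm:
  "ev (var i) * ev (xm i) = ev (lmon var (posp (B $ i))) + ev (lmon var (negp (B $ i)))"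
proof -
  have "lmon var (posp (B $ i)) \<in> A" "lmon var (negp (B $ i)) \<in> A" by (auto intro!: lmon_A)
  then show ?thesis
    using ev_mult[OF var_A xm_A, of i i] by (simp only: var_xm ev_add)
qed

lemma ev_lmon_nonzero:
  assumes "\<And>j. e $ j \<ge> 0" "\<And>j. j \<in> vanishing \<Longrightarrow> e $ j = 0"
  shows "ev (lmon var e) \<noteq> 0"
  using assms by (auto simp: ev_lmon vanishing_def)

lemma ev_lmon_zero:
  assumes "\<And>j. e $ j \<ge> 0" "j \<in> vanishing" "e $ j > 0"
  shows "ev (lmon var e) = 0"
  using assms by (auto simp: ev_lmon vanishing_def intro!: bexI[of _ j])

text \<open>
  Otherwise some \<open>a\<close> in this set has an outgoing but no incoming arrow inside the set.  Then exactly
  one of the two monomials of \<open>P\<^sub>a\<close> is zero at the point, although \<open>P\<^sub>a = x\<^sub>a x\<^sub>a'\<close> is zero there.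
\<close>

lemma vanishing_independent:
  assumes ij: "i \<in> vanishing" "j \<in> vanishing"
  shows "B $ i $ j = 0"
proof (rule ccontr)
  assume nz: "B $ i $ j \<noteq> 0"
  have "acyclic {(i, j). i \<in> vanishing \<and> j \<in> vanishing \<and> B $ i $ j > 0}"
    by (rule acyclic_subset[OF acyclic]) auto
  then obtain a b where ab: "a \<in> vanishing" "b \<in> vanishing" "B $ a $ b > 0" "\<And>l. l \<in> vanishing \<Longrightarrow> B $ a $ l \<ge> 0"
    using acyclic_source[OF _ skew ij nz] by blast
  have "ev (lmon var (posp (B $ a))) = 0"
    by (rule ev_lmon_zero[of _ b]) (use ab in auto)
  moreover have "ev (lmon var (negp (B $ a))) \<noteq> 0"
    by (rule ev_lmon_nonzero) (use ab in force)+
  moreover have "ev (var a) = 0" using ab by (simp add: vanishing_def)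
  ultimately show False using ev_var_xm[of a] by simp
qed

definition plus_value :: "'a \<Rightarrow> complex" where
  "plus_value i = ev (lmon var (posp (B $ i)))"

lemma plus_value_nonzero: "i \<in> vanishing \<Longrightarrow> plus_value i \<noteq> 0"
  unfolding plus_value_def by (rule ev_lmon_nonzero) (auto simp: vanishing_independent)

lemma ev_lmon_neg: "i \<in> vanishing \<Longrightarrow> ev (lmon var (negp (B $ i))) = - plus_value i"
  using ev_var_xm[of i] by (simp add: plus_value_def vanishing_def eq_neg_iff_add_eq_0 add.commute)

text \<open>
  Logarithmic differentials, which turn products into sums modulo \<open>Q\<close>.
\<close>

definition dlog :: "'a ratfun \<Rightarrow> 'a ratfun" where
  "dlog f = const (inverse (ev f)) * centred f"

lemma centred_dlog: "ev f \<noteq> 0 \<Longrightarrow> centred f = const (ev f) * dlog f"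
  by (simp add: dlog_def flip: mult.assoc const_mult)

lemma dlog_mult:
  assumes "f \<in> A" "g \<in> A" "ev f \<noteq> 0" "ev g \<noteq> 0"
  shows "dlog (f * g) - (dlog f + dlog g) \<in> Q"
proof -
  have "const (inverse (ev f * ev g)) * (const (ev f) * centred g) = dlog g"
    "const (inverse (ev f * ev g)) * (const (ev g) * centred f) = dlog f"
    using assms unfolding dlog_def mult.assoc[symmetric] const_mult[symmetric]
    by (simp_all add: field_simps)
  then have "dlog (f * g) - (dlog f + dlog g) = const (inverse (ev f * ev g)) * (centred f * centred g)"
    unfolding dlog_def[of "f * g"] centred_mult[OF assms(1,2)] ev_mult[OF assms(1,2)] distrib_left
    by simp
  then show ?thesis
    by (simp add: Q_scale ideal_square_prod centred_\<mm> assms)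
qed

lemma dlog_1: "dlog 1 = 0"
  using centred_const[of 1] by (simp add: dlog_def)

lemma dlog_power:
  assumes "f \<in> A" "ev f \<noteq> 0"
  shows "dlog (f ^ k) - of_nat k * dlog f \<in> Q"
proof (induction k)
  case 0
  show ?case by (simp add: dlog_1 ideal_square_0)
next
  case (Suc k)
  have "dlog (f * f ^ k) - (dlog f + dlog (f ^ k)) \<in> Q"
    by (rule dlog_mult) (use assms in \<open>auto simp: ev_power sub_power[OF sub_A]\<close>)
  from ideal_square_add[OF this Suc.IH] show ?case by (simp add: algebra_simps)
qed

lemma dlog_prod:
  assumes "\<And>i. i \<in> S \<Longrightarrow> f i \<in> A" "\<And>i. i \<in> S \<Longrightarrow> ev (f i) \<noteq> 0"
  shows "dlog (prod f S) - (\<Sum>i\<in>S. dlog (f i)) \<in> Q"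
  using assms
proof (induction S rule: infinite_finite_induct)
  case (insert i S)
  have "dlog (f i * prod f S) - (dlog (f i) + dlog (prod f S)) \<in> Q"
    by (rule dlog_mult) (use insert in \<open>auto simp: ev_prod sub_prod[OF sub_A]\<close>)
  from ideal_square_add[OF this insert.IH] insert show ?case by (simp add: algebra_simps)
qed (auto simp: dlog_1 ideal_square_0)

lemma dlog_lmon:
  assumes e: "\<And>j. e $ j \<ge> 0" "\<And>j. j \<in> vanishing \<Longrightarrow> e $ j = 0"
  shows "dlog (lmon var e) - (\<Sum>j\<in>- vanishing. of_int (e $ j) * dlog (var j)) \<in> Q"
proof -
  have "lmon var e = (\<Prod>j\<in>- vanishing. var j ^ nat (e $ j))"
    unfolding lmon_def using e
    by (intro prod.mono_neutral_cong_right) (auto simp: power_int_nonneg_exp)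
  moreover have "dlog (\<Prod>j\<in>- vanishing. var j ^ nat (e $ j)) - (\<Sum>j\<in>- vanishing. dlog (var j ^ nat (e $ j))) \<in> Q"
    by (rule dlog_prod) (auto simp: vanishing_def ev_power var_A sub_power[OF sub_A])
  moreover have "(\<Sum>j\<in>- vanishing. dlog (var j ^ nat (e $ j)) - of_nat (nat (e $ j)) * dlog (var j)) \<in> Q"
    by (intro Q_sum dlog_power) (auto simp: vanishing_def var_A)
  ultimately have "dlog (lmon var e) - (\<Sum>j\<in>- vanishing. of_nat (nat (e $ j)) * dlog (var j)) \<in> Q"
    using ideal_square_add by (fastforce simp: sum_subtractf)
  then show ?thesis using e(1) by simp
qed

text \<open>
  The factor at the variables that do not vanish makes the centred generator a logarithmic
  differential.
\<close>

definition gen :: "'a \<Rightarrow> 'a ratfun" where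
  "gen l = (if l \<in> vanishing then xm l else const (inverse (ev (var l))) * var l)"

lemma gen_A: "gen l \<in> A"
  by (simp add: gen_def xm_A mult_A const_A var_A)

lemma centred_gen: "l \<notin> vanishing \<Longrightarrow> centred (gen l) = dlog (var l)"
  by (simp add: gen_def dlog_def centred_scale var_A)

text \<open>
  This would be the logarithmic differential of \<open>x\<close> to the power of the \<open>k\<close>-th row of \<open>B\<close>.  Where
  \<open>x\<^sub>l\<close> vanishes and \<open>dlog x\<^sub>l\<close> makes no sense, the differential of \<open>x\<^sub>l'\<close> stands in for it.
\<close>

definition row_form :: "'a \<Rightarrow> 'a ratfun" where
  "row_form k = (\<Sum>l\<in>UNIV. of_int (B $ k $ l) * centred (gen l))"

text \<open>
  If \<open>x\<^sub>k\<close> vanishes then the \<open>k\<close>-th row form is only a multiple of \<open>x\<^sub>k\<close> (\<open>row_relation\<close>), possibly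
  zero, and \<open>x\<^sub>k\<close> takes its place.
\<close>

definition cot_basis :: "'a \<Rightarrow> 'a ratfun" where
  "cot_basis k = (if k \<in> vanishing then var k else row_form k)"

lemma cot_basis_\<mm>: "cot_basis k \<in> \<mm>"
  unfolding cot_basis_def row_form_def
  by (auto intro!: \<mm>_sum \<mm>_mult of_int_A centred_\<mm> gen_A) (auto simp: \<mm>_def vanishing_def var_A)

text \<open>
  Let \<open>P\<^sub>i = M + N\<close>.  At the point \<open>x\<^sub>i = 0\<close> and \<open>N = - M\<close>, so the differential of \<open>x\<^sub>i x\<^sub>i' = P\<^sub>i\<close> is
  \<open>x\<^sub>i' dx\<^sub>i = M (dlog M - dlog N)\<close>.  The difference of logarithmic differentials is the row form,
  since \<open>B\<^sub>i\<^sub>j = 0\<close> for all \<open>j\<close> such that \<open>x\<^sub>j\<close> vanishes.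
\<close>

lemma row_relation:
  assumes i: "i \<in> vanishing"
  shows "row_form i - const (inverse (plus_value i) * ev (xm i)) * var i \<in> Q"
proof -
  let ?M = "lmon var (posp (B $ i))" and ?N = "lmon var (negp (B $ i))"
  have MA: "?M \<in> A" "?N \<in> A" by (auto intro!: lmon_A)
  have Pi: "plus_value i \<noteq> 0" by (rule plus_value_nonzero[OF i])
  have "row_form i = (\<Sum>j\<in>- vanishing. of_int (B $ i $ j) * dlog (var j))"
    unfolding row_form_def
    by (rule sum.mono_neutral_cong_right) (auto simp: vanishing_independent[OF i] centred_gen)
  also have "\<dots> = (\<Sum>j\<in>- vanishing. of_int (posp (B $ i) $ j) * dlog (var j))
      - (\<Sum>j\<in>- vanishing. of_int (negp (B $ i) $ j) * dlog (var j))"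
    unfolding sum_subtractf[symmetric] left_diff_distrib[symmetric] of_int_diff[symmetric]
    by (simp add: posp_eq del: posp_nth negp_nth)
  finally have row: "row_form i = \<dots>" .
  have "dlog ?M - (\<Sum>j\<in>- vanishing. of_int (posp (B $ i) $ j) * dlog (var j)) \<in> Q"
    "dlog ?N - (\<Sum>j\<in>- vanishing. of_int (negp (B $ i) $ j) * dlog (var j)) \<in> Q"
    by (rule dlog_lmon; simp add: vanishing_independent[OF i])+
  from Q_diff[OF this] have 1: "(dlog ?M - dlog ?N) - row_form i \<in> Q"
    unfolding row by (simp add: algebra_simps)
  have "centred (var i * xm i) = centred ?M + centred ?N"
    unfolding var_xm by (rule centred_add[OF MA])
  also have "\<dots> = const (plus_value i) * (dlog ?M - dlog ?N)"
    using centred_dlog[of ?M] centred_dlog[of ?N] Pi ev_lmon_neg[OF i]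
    by (simp add: plus_value_def[symmetric] const_minus algebra_simps)
  finally have centred: "centred (var i * xm i) = const (plus_value i) * (dlog ?M - dlog ?N)" .
  have 2: "dlog ?M - dlog ?N = const (inverse (plus_value i)) * centred (var i * xm i)"
    using Pi unfolding centred mult.assoc[symmetric] const_mult[symmetric] by simp
  have vi: "ev (var i) = 0" "var i \<in> \<mm>" using i by (auto simp: vanishing_def \<mm>_def var_A)
  have "centred (var i * xm i) - const (ev (xm i)) * var i = var i * centred (xm i)"
    unfolding centred_mult[OF var_A xm_A] by (simp add: vi centred_of_\<mm>)
  then have "centred (var i * xm i) - const (ev (xm i)) * var i \<in> Q"
    by (simp add: ideal_square_prod vi centred_\<mm> xm_A)
  from Q_scale[OF this, of "inverse (plus_value i)"]
  have 3: "(dlog ?M - dlog ?N) - const (inverse (plus_value i) * ev (xm i)) * var i \<in> Q"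
    unfolding 2 by (simp only: const_mult right_diff_distrib mult.assoc)
  from Q_diff[OF 3 1] show ?thesis by simp
qed

definition basis_span :: "'a ratfun set" where
  "basis_span = {f. \<exists>c. f - (\<Sum>k\<in>UNIV. const (c k) * cot_basis k) \<in> Q}"

lemma basis_span_Q: "q \<in> Q \<Longrightarrow> q \<in> basis_span"
  unfolding basis_span_def by (auto intro!: exI[of _ "\<lambda>_. 0"])

lemma basis_span_base: "cot_basis k \<in> basis_span"
  unfolding basis_span_def
  by (rule CollectI, rule exI[of _ "\<lambda>j. if j = k then 1 else 0"])
    (simp add: if_distrib[of const] if_distrib[of "\<lambda>x. x * _"] ideal_square_0 cong: if_cong)

lemma basis_span_add:
  assumes "f \<in> basis_span" "g \<in> basis_span"
  shows "f + g \<in> basis_span"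
proof -
  obtain c c' where "f - (\<Sum>k\<in>UNIV. const (c k) * cot_basis k) \<in> Q" "g - (\<Sum>k\<in>UNIV. const (c' k) * cot_basis k) \<in> Q"
    using assms unfolding basis_span_def by blast
  from ideal_square_add[OF this]
  have "f + g - (\<Sum>k\<in>UNIV. const (c k + c' k) * cot_basis k) \<in> Q"
    by (simp add: const_add distrib_right sum.distrib algebra_simps)
  then show ?thesis unfolding basis_span_def by (intro CollectI exI)
qed

lemma basis_span_scale:
  assumes "f \<in> basis_span"
  shows "const a * f \<in> basis_span"
proof -
  obtain c where "f - (\<Sum>k\<in>UNIV. const (c k) * cot_basis k) \<in> Q"
    using assms unfolding basis_span_def by blast
  from Q_scale[OF this, of a]
  have "const a * f - (\<Sum>k\<in>UNIV. const (a * c k) * cot_basis k) \<in> Q"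
    by (simp only: const_mult right_diff_distrib sum_distrib_left mult.assoc)
  then show ?thesis unfolding basis_span_def by (intro CollectI exI)
qed

lemma basis_span_sum: "(\<And>i. i \<in> S \<Longrightarrow> f i \<in> basis_span) \<Longrightarrow> sum f S \<in> basis_span"
  by (induction S rule: infinite_finite_induct) (auto simp: basis_span_Q ideal_square_0 basis_span_add)

lemma row_form_in_span: "row_form k \<in> basis_span"
proof (cases "k \<in> vanishing")
  case True
  have "(row_form k - const (inverse (plus_value k) * ev (xm k)) * var k) + const (inverse (plus_value k) * ev (xm k)) * cot_basis k \<in> basis_span"
    by (intro basis_span_add basis_span_Q basis_span_scale basis_span_base row_relation True)
  then show ?thesis using True by (simp add: cot_basis_def)
next
  case False
  then show ?thesis using basis_span_base[of k] by (simp add: cot_basis_def)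
qed

text \<open>
  All row forms lie in the span, and the matrix \<open>B\<close> that expresses them through the generators is
  invertible.
\<close>

lemma centred_gen_in_span: "centred (gen l) \<in> basis_span"
proof -
  obtain A' where A': "A' ** rat_matrix B = mat 1" using inv by (auto simp: invertible_def)
  have "(\<Sum>k\<in>UNIV. const (of_rat (A' $ l $ k)) * row_form k)
      = (\<Sum>k\<in>UNIV. \<Sum>j\<in>UNIV. const (of_rat (A' $ l $ k * of_int (B $ k $ j))) * centred (gen j))"
    unfolding row_form_def sum_distrib_left
    by (simp only: of_rat_mult of_rat_of_int_eq const_mult const_of_int mult.assoc)
  also have "\<dots> = (\<Sum>j\<in>UNIV. const (of_rat ((A' ** rat_matrix B) $ l $ j)) * centred (gen j))"
    by (subst sum.swap)
      (simp add: matrix_matrix_mult_def map_matrix_def of_rat_sum const_sum sum_distrib_right)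
  also have "\<dots> = (\<Sum>j\<in>UNIV. if j = l then centred (gen j) else 0)"
    unfolding A' by (rule sum.cong) (auto simp: mat_def)
  also have "\<dots> = centred (gen l)" by simp
  finally have "centred (gen l) = (\<Sum>k\<in>UNIV. const (of_rat (A' $ l $ k)) * row_form k)" ..
  then show ?thesis by (simp add: basis_span_sum basis_span_scale row_form_in_span)
qed

text \<open>
  The functions whose centred part lies in the span form a subalgebra.  Of the generators only the
  \<open>x\<^sub>k'\<close> with \<open>x\<^sub>k\<close> nonzero at the point are not among the previous ones; their differentials are
  obtained from \<open>x\<^sub>k x\<^sub>k' = P\<^sub>k\<close>.
\<close>

lemma centred_in_span:
  assumes "f \<in> A"
  shows "centred f \<in> basis_span"
proof -
  let ?S = "{f \<in> A. centred f \<in> basis_span}"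
  have prodQ: "centred f * centred g \<in> basis_span" if "f \<in> A" "g \<in> A" for f g
    by (intro basis_span_Q ideal_square_prod centred_\<mm> that)
  have sub: "is_subalgebra ?S"
    unfolding is_subalgebra_def[of ?S]
  proof (intro conjI ballI)
    show "range const \<subseteq> ?S" by (auto simp: const_A centred_const basis_span_Q ideal_square_0)
    fix f g assume fg: "f \<in> ?S" "g \<in> ?S"
    then show "f + g \<in> ?S" by (simp add: centred_add add_A basis_span_add)
    have "const (ev f) * centred g + const (ev g) * centred f + centred f * centred g \<in> basis_span"
      using fg by (intro basis_span_add basis_span_scale prodQ) auto
    then show "f * g \<in> ?S" using fg by (simp add: centred_mult mult_A)
  qed
  have var: "centred (var k) \<in> basis_span" for k
  proof (cases "k \<in> vanishing")
    case True
    then show ?thesis using basis_span_base[of k] by (simp add: cot_basis_def vanishing_def centred_def)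
  next
    case False
    then have "centred (var k) = const (ev (var k)) * centred (gen k)"
      by (simp add: centred_gen) (simp add: centred_dlog vanishing_def)
    then show ?thesis by (simp add: basis_span_scale centred_gen_in_span)
  qed
  have xm: "centred (xm k) \<in> basis_span" for k
  proof (cases "k \<in> vanishing")
    case True
    then show ?thesis using centred_gen_in_span[of k] by (simp add: gen_def)
  next
    case False
    then have nz: "ev (var k) \<noteq> 0" by (simp add: vanishing_def)
    have mon: "lmon var e \<in> ?S" if "\<And>j. e $ j \<ge> 0" for e
      by (rule lmon_in_subalgebra[OF sub]) (use var var_A that in \<open>auto simp: not_less[symmetric]\<close>)
    have "var k * xm k \<in> ?S" unfolding var_xm by (intro sub_add[OF sub] mon) auto
    then have "centred (var k * xm k) \<in> basis_span" by simp
    then have "const (inverse (ev (var k))) * (centred (var k * xm k) + (const (- ev (xm k)) * centred (var k)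
        + const (- 1) * (centred (var k) * centred (xm k)))) \<in> basis_span"
      by (intro basis_span_scale basis_span_add var prodQ var_A xm_A)
    also have "centred (var k * xm k) + (const (- ev (xm k)) * centred (var k)
        + const (- 1) * (centred (var k) * centred (xm k))) = const (ev (var k)) * centred (xm k)"
      by (simp add: centred_mult var_A xm_A const_minus)
    finally show ?thesis using nz by (simp flip: mult.assoc const_mult)
  qed
  have "A \<subseteq> ?S"
    unfolding cluster_algebra_alg
  proof (rule hull_minimal)
    show "range var \<union> range xm \<subseteq> {f \<in> alg (range var \<union> range xm). centred f \<in> basis_span}"
      using var xm var_A xm_A unfolding cluster_algebra_alg by blast
    show "is_subalgebra {f \<in> alg (range var \<union> range xm). centred f \<in> basis_span}"
      using sub unfolding cluster_algebra_alg .
  qed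
  then show ?thesis using assms by blast
qed

lemma ev_br_gen_var:
  "ev (br (gen k) (var l)) = (if k \<in> vanishing
     then of_int (pairing \<Lambda> (neg_exp k) (axis l 1)) * (ev (xm k) * ev (var l)) + (if k = l then of_int (diag k) * plus_value k else 0)
     else of_int (\<Lambda> $ k $ l) * ev (var l))"
proof (cases "k \<in> vanishing")
  case True
  have MA: "lmon var (posp (B $ k)) \<in> A" for k by (auto intro!: lmon_A)
  show ?thesis
    using True MA unfolding gen_def plus_value_def
    by (simp add: br_xm_var ev_add mult_A of_int_A xm_A var_A sub_0[OF sub_A] ev_of_int ev_mult ev_0)
next
  case False
  then have "ev (var k) \<noteq> 0" by (simp add: vanishing_def)
  then show ?thesis
    using False
    by (simp add: gen_def log_bracket_scale_left log_bracket_var mult.assoc ev_scale ev_of_int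
        ev_mult mult_A of_int_A var_A)
qed

lemma ev_br_sum:
  assumes "\<And>k. g k \<in> A" "h \<in> A"
  shows "ev (br (\<Sum>k\<in>S. const (c k) * g k) h) = (\<Sum>k\<in>S. c k * ev (br (g k) h))"
  by (induction S rule: infinite_finite_induct)
    (use log_bracket_const_left[of \<Lambda> 0 h] assms in \<open>auto simp: ev_0 log_bracket_add_left log_bracket_scale_left
      ev_add ev_scale br_closed mult_A const_A sum_A\<close>)

lemma ev_br_row_var: "ev (br (row_form k) (var l)) = (\<Sum>m\<in>UNIV. of_int (B $ k $ m) * ev (br (gen m) (var l)))"
proof -
  have "row_form k = (\<Sum>m\<in>UNIV. const (of_int (B $ k $ m)) * centred (gen m))"
    by (simp add: row_form_def const_of_int)
  then show ?thesis
    by (simp add: ev_br_sum \<mm>_A[OF centred_\<mm>] gen_A var_A br_centred)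
qed

text \<open>
  Let \<open>c'\<close> consist of the coefficients at the row forms, and \<open>\<tau> = c' B\<close>.  The bracket with a vanishing
  variable \<open>x\<^sub>l\<close> only sees \<open>x\<^sub>l'\<close> and gives \<open>\<tau>\<^sub>l = 0\<close>.  The brackets with the other variables give
  \<open>(\<tau> \<Lambda>)\<^sub>l = 0\<close>, and as \<open>B \<Lambda>\<close> is diagonal with nonzero entries, \<open>c' = 0\<close>.  There remains a combination
  of vanishing variables, in which the bracket with \<open>x\<^sub>l'\<close> singles out the coefficient of \<open>x\<^sub>l\<close>.
\<close>

lemma radical_trivial:
  assumes f: "f - (\<Sum>k\<in>UNIV. const (c k) * cot_basis k) \<in> Q"
    and var: "\<And>l. ev (br f (var l)) = 0" and xm: "\<And>l. ev (br f (xm l)) = 0"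
  shows "c k = 0"
proof -
  let ?e = "\<Sum>k\<in>UNIV. const (c k) * cot_basis k"
  have eA: "?e \<in> A" by (intro sum_A mult_A const_A \<mm>_A[OF cot_basis_\<mm>])
  have br_e: "ev (br ?e h) = ev (br f h)" if h: "h \<in> A" for h
  proof -
    have "br f h = br ((f - ?e) + ?e) h" by simp
    also have "\<dots> = br (f - ?e) h + br ?e h" by (rule log_bracket_add_left)
    finally show ?thesis
      using ev_br_Q[OF f h] ev_add[of "br (f - ?e) h" "br ?e h"] h eA \<mm>_A[OF Q_\<mm>[OF f]]
      by (simp add: br_closed)
  qed
  define c' where "c' k = (if k \<in> vanishing then 0 else c k)" for k
  define \<tau> where "\<tau> m = (\<Sum>k\<in>UNIV. c' k * of_int (B $ k $ m))" for m
  have lin: "(\<Sum>m\<in>UNIV. \<tau> m * ev (br (gen m) (var l))) = 0" for l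
  proof -
    have "0 = (\<Sum>k\<in>UNIV. c k * ev (br (cot_basis k) (var l)))"
      using br_e[OF var_A[of l]] var[of l] by (simp add: ev_br_sum \<mm>_A[OF cot_basis_\<mm>] var_A)
    also have "\<dots> = (\<Sum>k\<in>UNIV. c' k * ev (br (row_form k) (var l)))"
    proof (intro sum.cong refl)
      fix k
      have "ev (br (var k) (var l)) = 0" if "k \<in> vanishing"
        using that by (simp add: log_bracket_var mult.assoc ev_of_int_mult mult_A var_A ev_mult vanishing_def)
      then show "c k * ev (br (cot_basis k) (var l)) = c' k * ev (br (row_form k) (var l))"
        by (simp add: cot_basis_def c'_def)
    qed
    also have "\<dots> = (\<Sum>m\<in>UNIV. \<tau> m * ev (br (gen m) (var l)))"
      unfolding ev_br_row_var \<tau>_def sum_distrib_left sum_distrib_right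
      by (subst sum.swap) (simp add: mult.assoc)
    finally show ?thesis ..
  qed
  have \<tau>_I: "\<tau> l = 0" if l: "l \<in> vanishing" for l
  proof -
    have "(\<Sum>m\<in>UNIV. \<tau> m * ev (br (gen m) (var l))) = (\<Sum>m\<in>UNIV. if m = l then \<tau> l * (of_int (diag l) * plus_value l) else 0)"
      by (rule sum.cong) (use l in \<open>auto simp: ev_br_gen_var vanishing_def\<close>)
    then show ?thesis using lin[of l] plus_value_nonzero[OF l] diag_pos[of l] by simp
  qed
  have c'0: "c' l = 0" for l
  proof (cases "l \<in> vanishing")
    case False
    have "(\<Sum>m\<in>UNIV. \<tau> m * ev (br (gen m) (var l))) = (\<Sum>m\<in>UNIV. \<tau> m * of_int (\<Lambda> $ m $ l)) * ev (var l)"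
      unfolding sum_distrib_right
      by (rule sum.cong) (auto simp: \<tau>_I ev_br_gen_var)
    then have "(\<Sum>m\<in>UNIV. \<tau> m * of_int (\<Lambda> $ m $ l)) = 0"
      using lin[of l] False by (simp add: vanishing_def)
    also have "(\<Sum>m\<in>UNIV. \<tau> m * of_int (\<Lambda> $ m $ l))
        = (\<Sum>k\<in>UNIV. c' k * of_int ((B ** \<Lambda>) $ k $ l))"
      unfolding \<tau>_def sum_distrib_right matrix_matrix_mult_def
      by (subst sum.swap) (simp add: sum_distrib_left mult.assoc)
    also have "\<dots> = (\<Sum>k\<in>UNIV. if k = l then c' l * of_int (diag l) else 0)"
      by (rule sum.cong) (auto simp: BL)
    finally show ?thesis using diag_pos[of l] by simp
  qed (simp add: c'_def)
  show "c k = 0"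
  proof (cases "k \<in> vanishing")
    case True
    have "0 = (\<Sum>m\<in>UNIV. c m * ev (br (cot_basis m) (xm k)))"
      using br_e[OF xm_A[of k]] xm[of k] by (simp add: ev_br_sum \<mm>_A[OF cot_basis_\<mm>] xm_A)
    also have "\<dots> = (\<Sum>m\<in>UNIV. if m = k then c k * - (of_int (diag k) * plus_value k) else 0)"
    proof (rule sum.cong)
      fix m
      show "c m * ev (br (cot_basis m) (xm k)) = (if m = k then c k * - (of_int (diag k) * plus_value k) else 0)"
      proof (cases "m \<in> vanishing")
        case False
        then show ?thesis using c'0[of m] True by (auto simp: c'_def)
      next
        case m: True
        have "ev (br (xm k) (var m)) = (if m = k then of_int (diag k) * plus_value k else 0)"
          using ev_br_gen_var[of k m] True m by (simp add: gen_def vanishing_def)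
        moreover have "ev (br (var m) (xm k)) = - ev (br (xm k) (var m))"
          unfolding log_bracket_antisym[OF skew_L, of "var m" "xm k"]
          by (rule ev_minus[OF br_closed[OF xm_A var_A]])
        ultimately show ?thesis using m by (simp add: cot_basis_def)
      qed
    qed simp
    finally show ?thesis using plus_value_nonzero[OF True] diag_pos[of k] by simp
  next
    case False
    then show ?thesis using c'0[of k] by (simp add: c'_def)
  qed
qed

end

section \<open>The dimension of the variety\<close>

definition box :: "nat \<Rightarrow> (int, 'n::finite) vec set" where
  "box D = {e. \<forall>j. \<bar>e $ j\<bar> \<le> int D}"

lemma box_0: "0 \<in> box D" by (simp add: box_def)

lemma box_add: "e \<in> box D \<Longrightarrow> e' \<in> box D' \<Longrightarrow> e + e' \<in> box (D + D')"
  unfolding box_def by (auto intro: order_trans[OF abs_triangle_ineq] add_mono)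

lemma box_mono: "D \<le> D' \<Longrightarrow> box D \<subseteq> box D'"
  unfolding box_def by (auto intro: order_trans[OF _ of_nat_mono])

lemma finite_box: "finite (box D :: (int, 'n::finite) vec set)"
  and card_box: "card (box D :: (int, 'n) vec set) \<le> (2 * D + 1) ^ CARD('n)"
proof -
  let ?F = "PiE (UNIV :: 'n set) (\<lambda>_. {- int D..int D})"
  have sub: "box D \<subseteq> (\<lambda>g. \<chi> j. g j) ` ?F"
  proof
    fix e :: "(int, 'n) vec" assume "e \<in> box D"
    then have "($) e \<in> ?F" by (auto simp: box_def abs_le_iff minus_le_iff)
    moreover have "e = (\<chi> j. e $ j)" by simp
    ultimately show "e \<in> (\<lambda>g. \<chi> j. g j) ` ?F" by blast
  qed
  have fin: "finite ?F" by (simp add: finite_PiE)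
  then show "finite (box D :: (int, 'n) vec set)" using sub finite_subset by blast
  have "card (box D :: (int, 'n) vec set) \<le> card ?F"
    using surj_card_le[OF fin sub] .
  also have "\<dots> = (2 * D + 1) ^ CARD('n)"
  proof -
    have "nat (2 * int D + 1) = 2 * D + 1" by linarith
    then show ?thesis by (simp add: card_PiE)
  qed
  finally show "card (box D :: (int, 'n) vec set) \<le> (2 * D + 1) ^ CARD('n)" .
qed

lemma laurent_in_box:
  assumes "f \<in> laurent y UNIV"
  shows "\<exists>D. f \<in> laurent y (box D)"
proof -
  obtain S c where S: "finite S" "f = (\<Sum>e\<in>S. const (c e) * lmon y e)"
    using assms unfolding laurent_explicit by blast
  define D where "D = nat (\<Sum>e\<in>S. \<Sum>j\<in>UNIV. \<bar>e $ j\<bar>)"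
  have "S \<subseteq> box D"
  proof
    fix e assume e: "e \<in> S"
    have "\<bar>e $ j\<bar> \<le> (\<Sum>e\<in>S. \<Sum>j\<in>UNIV. \<bar>e $ j\<bar>)" for j
    proof -
      have "\<bar>e $ j\<bar> \<le> (\<Sum>j\<in>UNIV. \<bar>e $ j\<bar>)" by (rule member_le_sum) auto
      also have "\<dots> \<le> (\<Sum>e\<in>S. \<Sum>j\<in>UNIV. \<bar>e $ j\<bar>)"
        using member_le_sum[OF e, of "\<lambda>e. \<Sum>j\<in>UNIV. \<bar>e $ j\<bar>"] S(1) by (auto intro: sum_nonneg)
      finally show ?thesis .
    qed
    moreover have "0 \<le> (\<Sum>e\<in>S. \<Sum>j\<in>UNIV. \<bar>e $ j\<bar>)" by (intro sum_nonneg) auto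
    ultimately show "e \<in> box D" by (simp add: box_def D_def)
  qed
  then show ?thesis using S unfolding laurent_explicit by blast
qed

lemma laurent_box_mult:
  assumes "\<And>j. y j \<noteq> 0" "f \<in> laurent y (box D)" "g \<in> laurent y (box D')"
  shows "f * g \<in> laurent y (box (D + D'))"
  by (rule laurent_mult[OF assms]) (rule box_add)

lemma laurent_box_power:
  assumes "\<And>j. y j \<noteq> 0" "f \<in> laurent y (box D)"
  shows "f ^ k \<in> laurent y (box (k * D))"
proof (induction k)
  case (Suc k)
  show ?case using laurent_box_mult[OF assms(1) assms(2) Suc.IH] by simp
qed (simp add: laurent_1 box_0)

lemma laurent_box_prod:
  assumes "\<And>j. y j \<noteq> 0" "\<And>i. i \<in> S \<Longrightarrow> f i \<in> laurent y (box (D i))"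
  shows "(\<Prod>i\<in>S. f i) \<in> laurent y (box (\<Sum>i\<in>S. D i))"
  using assms(2)
proof (induction S rule: infinite_finite_induct)
  case (insert i S)
  then show ?case using laurent_box_mult[of y "f i" "D i" "prod f S", OF assms(1)] by simp
qed (simp_all add: laurent_1 box_0)

lemma monomials_independent:
  fixes f :: "nat \<Rightarrow> 'n::{finite,linorder} ratfun"
  assumes ind: "algebraically_independent d f" and T: "finite T" "T \<subseteq> extensional {..<d}"
    and sum0: "(\<Sum>a\<in>T. const (c a) * (\<Prod>i<d. f i ^ a i)) = 0" and a: "a \<in> T"
  shows "c a = 0"
proof -
  define pm where "pm a = (\<Sum>i<d. Poly_Mapping.single i (a i))" for a :: "nat \<Rightarrow> nat"
  have lookup_pm: "Poly_Mapping.lookup (pm a) i = (if i < d then a i else 0)" for a i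
    by (simp add: pm_def lookup_sum_single)
  have inj: "inj_on pm T"
  proof (rule inj_onI)
    fix a b assume ab: "a \<in> T" "b \<in> T" "pm a = pm b"
    have "a i = b i" if "i < d" for i
      using lookup_pm[of a i] lookup_pm[of b i] ab(3) that by simp
    then show "a = b"
      using ab T(2) by (intro extensionalityI[of a "{..<d}" b]) auto
  qed
  define q where "q = (\<Sum>a\<in>T. Poly_Mapping.single (pm a) (c a))"
  have lookup_q: "Poly_Mapping.lookup q (pm a) = c a" if "a \<in> T" for a
  proof -
    have "Poly_Mapping.lookup q (pm a) = (\<Sum>b\<in>T. if b = a then c b else 0)"
      unfolding q_def lookup_sum
      by (rule sum.cong) (use inj that in \<open>auto simp: lookup_single when_def inj_on_def\<close>)
    then show ?thesis using T(1) that by simp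
  qed
  have keys_q: "Poly_Mapping.keys q \<subseteq> pm ` T"
  proof
    fix m assume "m \<in> Poly_Mapping.keys q"
    then have "(\<Sum>b\<in>T. Poly_Mapping.lookup (Poly_Mapping.single (pm b) (c b)) m) \<noteq> 0"
      by (simp add: in_keys_iff q_def lookup_sum)
    then obtain b where "b \<in> T" "Poly_Mapping.lookup (Poly_Mapping.single (pm b) (c b)) m \<noteq> 0"
      by (meson sum.neutral)
    then show "m \<in> pm ` T" by (auto simp: lookup_single when_def split: if_splits)
  qed
  have keys_pm: "Poly_Mapping.keys (pm a) \<subseteq> {..<d}" for a
    by (auto simp: in_keys_iff lookup_pm split: if_splits)
  have mon: "(\<Prod>i\<in>Poly_Mapping.keys (pm a). f i ^ Poly_Mapping.lookup (pm a) i) = (\<Prod>i<d. f i ^ a i)" for a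
    by (rule prod.mono_neutral_cong_left) (use keys_pm in \<open>auto simp: in_keys_iff lookup_pm\<close>)
  have "cpoly_eval const f q = (\<Sum>m\<in>pm ` T. const (Poly_Mapping.lookup q m) *
      (\<Prod>i\<in>Poly_Mapping.keys m. f i ^ Poly_Mapping.lookup m i))"
    unfolding cpoly_eval_def
    by (rule sum.mono_neutral_left) (use T(1) keys_q in \<open>auto simp: in_keys_iff\<close>)
  also have "\<dots> = (\<Sum>a\<in>T. const (c a) * (\<Prod>i<d. f i ^ a i))"
    by (subst sum.reindex[OF inj]) (simp add: mon lookup_q)
  finally have "cpoly_eval const f q = 0" using sum0 by simp
  moreover have "\<forall>m\<in>Poly_Mapping.keys q. Poly_Mapping.keys m \<subseteq> {..<d}"
    using keys_q keys_pm by blast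
  ultimately have "q = 0" using ind unfolding algebraically_independent_def by blast
  then show ?thesis using lookup_q[OF a] by simp
qed

lemma linearly_independent_card_le:
  fixes M :: "'b \<Rightarrow> 'n::{finite,linorder} ratfun"
  assumes T: "finite T" and ind: "\<And>c a. (\<Sum>a\<in>T. const (c a) * M a) = 0 \<Longrightarrow> a \<in> T \<Longrightarrow> c a = 0"
    and sub: "M ` T \<subseteq> laurent y E" and E: "finite E"
  shows "card T \<le> card E"
proof -
  have inj: "inj_on M T"
  proof (rule inj_onI, rule ccontr)
    fix a b assume ab: "a \<in> T" "b \<in> T" "M a = M b" "a \<noteq> b"
    let ?c = "\<lambda>x. if x = a then 1 else if x = b then - 1 else (0 :: complex)"
    have "(\<Sum>x\<in>T. const (?c x) * M x) = (\<Sum>x\<in>{a, b}. const (?c x) * M x)"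
      by (rule sum.mono_neutral_right) (use ab T in auto)
    also have "\<dots> = 0" using ab by (simp add: const_minus)
    finally show False using ind[of ?c a] ab by simp
  qed
  have "cvs.independent (M ` T)"
    unfolding cvs.dependent_finite[OF finite_imageI[OF T]]
  proof (rule notI, elim exE conjE bexE)
    fix u v assume v: "v \<in> M ` T" "u v \<noteq> 0" and 0: "(\<Sum>v\<in>M ` T. const (u v) * v) = 0"
    then have "(\<Sum>a\<in>T. const (u (M a)) * M a) = 0" by (simp add: sum.reindex[OF inj])
    then show False using ind[of "\<lambda>a. u (M a)"] v by blast
  qed
  then have "card (M ` T) \<le> card (lmon y ` E)"
    using cvs.independent_span_bound[of "lmon y ` E" "M ` T"] sub E unfolding laurent_def by blast
  also have "\<dots> \<le> card E" by (rule card_image_le[OF E])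
  finally show ?thesis by (simp add: card_image[OF inj])
qed

text \<open>
  A count.  The monomials in \<open>f 0, \<dots>, f (d - 1)\<close> with exponents below \<open>N\<close> are \<open>N\<^sup>d\<close> linearly independent
  elements.  They are combinations of Laurent monomials with exponents bounded by a multiple of \<open>N\<close>,
  of which there are at most a constant times \<open>N\<^sup>n\<close>.
\<close>

lemma algebraically_independent_laurent_le:
  fixes f :: "nat \<Rightarrow> 'n::{finite,linorder} ratfun"
  assumes ind: "algebraically_independent d f" and f: "\<And>i. i < d \<Longrightarrow> f i \<in> laurent y UNIV"
    and y: "\<And>j. y j \<noteq> 0"
  shows "d \<le> CARD('n)"
proof (rule ccontr)
  assume "\<not> d \<le> CARD('n)"
  then have dn: "CARD('n) + 1 \<le> d" by simp
  have "\<forall>i\<in>{..<d}. \<exists>D. f i \<in> laurent y (box D)"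
    using f laurent_in_box by blast
  then obtain D where D: "\<forall>i\<in>{..<d}. f i \<in> laurent y (box (D i))"
    by (rule bchoice[THEN exE])
  define K where "K = (\<Sum>i<d. D i)"
  define c where "c = 2 * K + 1"
  \<comment> \<open>Large enough that \<open>N * N\<^sup>n\<close> exceeds \<open>(N * c)\<^sup>n\<close>.\<close>
  define N where "N = c ^ CARD('n) + 1"
  let ?T = "PiE {..<d} (\<lambda>_. {..<N})"
  let ?M = "\<lambda>a :: nat \<Rightarrow> nat. \<Prod>i<d. f i ^ a i"
  have "card ?T \<le> card (box (N * K) :: (int, 'n) vec set)"
  proof (rule linearly_independent_card_le[where M = ?M and y = y])
    show "finite ?T" by (simp add: finite_PiE)
    show "c a = 0" if "(\<Sum>a\<in>?T. const (c a) * ?M a) = 0" "a \<in> ?T" for c a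
    proof (rule monomials_independent[OF ind _ _ that])
      show "finite ?T" by (simp add: finite_PiE)
      show "?T \<subseteq> extensional {..<d}" by (auto simp: PiE_def)
    qed
    show "?M ` ?T \<subseteq> laurent y (box (N * K))"
    proof
      fix g assume "g \<in> ?M ` ?T"
      then obtain a where a: "a \<in> ?T" "g = ?M a" by blast
      have "g \<in> laurent y (box (\<Sum>i<d. a i * D i))"
        unfolding a(2) by (intro laurent_box_prod laurent_box_power y) (use D in auto)
      moreover have "(\<Sum>i<d. a i * D i) \<le> N * K"
        unfolding K_def sum_distrib_left
        by (intro sum_mono mult_right_mono) (use a(1) in \<open>auto simp: PiE_iff intro!: less_imp_le\<close>)
      ultimately show "g \<in> laurent y (box (N * K))"
        using laurent_mono[OF box_mono] by blast
    qed
  qed (rule finite_box)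
  then have "N ^ d \<le> card (box (N * K) :: (int, 'n) vec set)"
    by (simp add: card_PiE)
  also have "\<dots> \<le> (2 * (N * K) + 1) ^ CARD('n)" by (rule card_box)
  also have "\<dots> \<le> (N * c) ^ CARD('n)"
    by (rule power_mono) (simp_all add: c_def N_def algebra_simps)
  also have "\<dots> = N ^ CARD('n) * c ^ CARD('n)" by (rule power_mult_distrib)
  also have "\<dots> < N ^ CARD('n) * N" by (simp add: N_def)
  also have "\<dots> = N ^ (CARD('n) + 1)" by simp
  also have "\<dots> \<le> N ^ d" by (rule power_increasing[OF dn]) (simp add: N_def)
  finally show False by simp
qed

lemma vars_algebraically_independent:
  fixes h :: "nat \<Rightarrow> 'n::{finite,linorder}"
  assumes h: "bij_betw h {..<CARD('n)} UNIV"
  shows "algebraically_independent CARD('n) (\<lambda>i. var (h i))"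
  unfolding algebraically_independent_def
proof (intro allI impI)
  fix q :: "nat cpoly"
  let ?K = "Poly_Mapping.keys q"
  assume keys: "\<forall>m\<in>?K. Poly_Mapping.keys m \<subseteq> {..<CARD('n)}"
    and eval: "cpoly_eval const (\<lambda>i. var (h i)) q = 0"
  define g where "g = the_inv_into {..<CARD('n)} h"
  have hg: "h (g j) = j" "g j < CARD('n)" for j
    using h f_the_inv_into_f_bij_betw[OF h, of j] the_inv_into_into[of h "{..<CARD('n)}" j "{..<CARD('n)}"]
    by (auto simp: g_def bij_betw_def)
  have gh: "g (h i) = i" if "i < CARD('n)" for i
    using h that by (simp add: g_def the_inv_into_f_f bij_betw_def)
  define \<epsilon> :: "(nat \<Rightarrow>\<^sub>0 nat) \<Rightarrow> (int, 'n) vec"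
    where "\<epsilon> m = (\<chi> j. int (Poly_Mapping.lookup m (g j)))" for m
  have inj: "inj_on \<epsilon> ?K"
  proof (rule inj_onI, rule poly_mapping_eqI)
    fix m m' i assume m: "m \<in> ?K" "m' \<in> ?K" "\<epsilon> m = \<epsilon> m'"
    show "Poly_Mapping.lookup m i = Poly_Mapping.lookup m' i"
    proof (cases "i < CARD('n)")
      case True
      then show ?thesis using arg_cong[OF m(3), of "\<lambda>e. e $ h i"] gh by (simp add: \<epsilon>_def)
    next
      case False
      then have "i \<notin> Poly_Mapping.keys m" "i \<notin> Poly_Mapping.keys m'" using keys m by auto
      then show ?thesis by (simp add: in_keys_iff)
    qed
  qed
  have mon: "(\<Prod>i\<in>Poly_Mapping.keys m. var (h i) ^ Poly_Mapping.lookup m i) = lmon var (\<epsilon> m)"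
    if "m \<in> ?K" for m
  proof -
    have "(\<Prod>i\<in>Poly_Mapping.keys m. var (h i) ^ Poly_Mapping.lookup m i)
        = (\<Prod>i<CARD('n). var (h i) ^ Poly_Mapping.lookup m i)"
      by (rule prod.mono_neutral_left) (use keys that in \<open>auto simp: in_keys_iff\<close>)
    also have "\<dots> = (\<Prod>i<CARD('n). (\<lambda>j. var j ^ Poly_Mapping.lookup m (g j)) (h i))"
      by (rule prod.cong) (auto simp: gh)
    also have "\<dots> = (\<Prod>j\<in>UNIV. var j ^ Poly_Mapping.lookup m (g j))"
      by (rule prod.reindex_bij_betw[OF h])
    also have "\<dots> = lmon var (\<epsilon> m)" by (simp add: lmon_def \<epsilon>_def)
    finally show ?thesis .
  qed
  have "(\<Sum>e\<in>\<epsilon> ` ?K. const (Poly_Mapping.lookup q (inv_into ?K \<epsilon> e)) * lmon var e)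
      = (\<Sum>m\<in>?K. const (Poly_Mapping.lookup q m) * lmon var (\<epsilon> m))"
    by (subst sum.reindex[OF inj]) (simp add: inv_into_f_f[OF inj])
  also have "\<dots> = cpoly_eval const (\<lambda>i. var (h i)) q"
    unfolding cpoly_eval_def by (simp add: mon)
  finally have zero: "(\<Sum>e\<in>\<epsilon> ` ?K. const (Poly_Mapping.lookup q (inv_into ?K \<epsilon> e)) * lmon var e) = 0"
    using eval by simp
  have "Poly_Mapping.lookup q m = 0" if "m \<in> ?K" for m
    using torusD[OF torus_var _ zero, of "\<epsilon> m"] that by (simp add: inv_into_f_f[OF inj])
  then have "Poly_Mapping.lookup q m = 0" for m by (cases "m \<in> ?K") (auto simp: in_keys_iff)
  then show "q = 0" by (intro poly_mapping_eqI) simp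
qed

lemma (in acyclic_compatible) A_laurent: "A \<subseteq> laurent var UNIV"
  unfolding cluster_algebra_alg
proof (rule hull_minimal)
  show "is_subalgebra (laurent var UNIV)" by (rule is_subalgebra_laurent[of var, OF var_nonzero])
  show "range var \<union> range xm \<subseteq> laurent var UNIV"
    by (auto simp: xm_eq var_in_laurent intro!: laurent_add laurent_lmon)
qed

lemma (in acyclic_compatible) A_dimension: "has_dimension A CARD('n)"
  unfolding has_dimension_def
proof (intro conjI allI impI)
  obtain h where h: "bij_betw h {..<CARD('n)} (UNIV :: 'n set)"
    using ex_bij_betw_nat_finite[of "UNIV :: 'n set"] by (auto simp: atLeast0LessThan)
  show "\<exists>f. (\<forall>i<CARD('n). f i \<in> A) \<and> algebraically_independent CARD('n) f"
    using vars_algebraically_independent[OF h]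
    by (intro exI[of _ "\<lambda>i. var (h i)"]) (simp add: var_A)
  fix d' and f :: "nat \<Rightarrow> 'n ratfun"
  assume f: "(\<forall>i<d'. f i \<in> A) \<and> algebraically_independent d' f"
  show "d' \<le> CARD('n)"
    by (rule algebraically_independent_laurent_le[of d' f var, OF _ _ var_nonzero])
      (use f A_laurent in auto)
qed

section \<open>The symplectic form\<close>

context acyclic_point
begin

definition cotangents :: "'a ratfun set set" where
  "cotangents = \<mm> // {(f, g). f \<in> \<mm> \<and> g \<in> \<mm> \<and> f - g \<in> Q}"

lemma cotangentsE:
  assumes "\<alpha> \<in> cotangents"
  obtains f where "f \<in> \<mm>" "\<alpha> = {g \<in> \<mm>. f - g \<in> Q}"
  using assms unfolding cotangents_def quotient_def by blast

lemma cotangentsI: "f \<in> \<mm> \<Longrightarrow> {g \<in> \<mm>. f - g \<in> Q} \<in> cotangents"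
  unfolding cotangents_def quotient_def by blast

lemma cotangent_diff:
  assumes "\<alpha> \<in> cotangents" "f \<in> \<alpha>" "g \<in> \<alpha>"
  shows "f - g \<in> Q"
proof -
  obtain h where "\<alpha> = {g \<in> \<mm>. h - g \<in> Q}" using cotangentsE[OF assms(1)] by blast
  then have "h - g \<in> Q" "h - f \<in> Q" using assms by auto
  from Q_diff[OF this] show ?thesis by simp
qed

lemma cotangent_\<mm>: "\<alpha> \<in> cotangents \<Longrightarrow> f \<in> \<alpha> \<Longrightarrow> f \<in> \<mm>"
  by (erule cotangentsE) auto

lemma ev_br_Q_right:
  assumes "q \<in> Q" "h \<in> A"
  shows "ev (br h q) = 0"
  unfolding log_bracket_antisym[OF skew_L, of h q]
  using ev_minus[OF br_closed] ev_br_Q[OF assms] \<mm>_A[OF Q_\<mm>[OF assms(1)]] assms(2) by simp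

lemma br_cosets:
  assumes \<alpha>: "\<alpha> \<in> cotangents" "f \<in> \<alpha>" "f' \<in> \<alpha>" and \<beta>: "\<beta> \<in> cotangents" "g \<in> \<beta>" "g' \<in> \<beta>"
  shows "ev (br f g) = ev (br f' g')"
proof -
  have A: "f \<in> A" "f' \<in> A" "g \<in> A" "g' \<in> A" using cotangent_\<mm> \<mm>_A \<alpha> \<beta> by blast+
  have ff: "f - f' \<in> Q" and gg: "g - g' \<in> Q" using cotangent_diff \<alpha> \<beta> by blast+
  have "br f g = br (f - f') g + br f' g"
    using log_bracket_add_left[of \<Lambda> "f - f'" f' g] by simp
  also have "br f' g = br f' (g - g') + br f' g'"
    using derivationD(1)[OF log_bracket_derivation, of \<Lambda> f' "g - g'" g'] by simp
  finally show ?thesis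
    using ev_br_Q[OF ff A(3)] ev_br_Q_right[OF gg A(2)] A
    by (simp add: ev_add br_closed add_A diff_A)
qed

lemma the_elem_bracket:
  assumes \<alpha>: "\<alpha> \<in> cotangents" "f \<in> \<alpha>" and \<beta>: "\<beta> \<in> cotangents" "g \<in> \<beta>"
  shows "the_elem {ev (br f g) |f g. f \<in> \<alpha> \<and> g \<in> \<beta>} = ev (br f g)"
proof -
  have "{ev (br f g) |f g. f \<in> \<alpha> \<and> g \<in> \<beta>} = {ev (br f g)}"
    using br_cosets[OF \<alpha>(1) _ \<alpha>(2) \<beta>(1) _ \<beta>(2)] \<alpha>(2) \<beta>(2) by blast
  then show ?thesis by simp
qed

lemma cotangent_nonempty: "\<alpha> \<in> cotangents \<Longrightarrow> \<exists>f. f \<in> \<alpha> \<and> f \<in> \<mm>"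
  by (erule cotangentsE) (auto simp: ideal_square_0)

lemma bracket_antisym_cotangents:
  assumes "\<alpha> \<in> cotangents" "\<beta> \<in> cotangents"
  shows "the_elem {ev (br f g) |f g. f \<in> \<alpha> \<and> g \<in> \<beta>}
    = - the_elem {ev (br f g) |f g. f \<in> \<beta> \<and> g \<in> \<alpha>}"
proof -
  obtain f g where f: "f \<in> \<alpha>" "f \<in> \<mm>" and g: "g \<in> \<beta>" "g \<in> \<mm>"
    using cotangent_nonempty assms by blast
  have "ev (br f g) = ev (- br g f)" using log_bracket_antisym[OF skew_L, of f g] by simp
  also have "\<dots> = - ev (br g f)" by (rule ev_minus[OF br_closed]) (use f g \<mm>_A in auto)
  finally show ?thesis
    by (simp only: the_elem_bracket[OF assms(1) f(1) assms(2) g(1)] the_elem_bracket[OF assms(2) g(1) assms(1) f(1)])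
qed

text \<open>
  Constants have zero bracket with everything, so a cotangent vector in the radical has zero bracket
  with every element of the algebra at the point, and \<open>radical_trivial\<close> applies to it.
\<close>

lemma bracket_nondegenerate:
  assumes \<alpha>: "\<alpha> \<in> cotangents"
    and zero: "\<And>\<beta>. \<beta> \<in> cotangents \<Longrightarrow> the_elem {ev (br f g) |f g. f \<in> \<alpha> \<and> g \<in> \<beta>} = 0"
  shows "0 \<in> \<alpha>"
proof -
  obtain f where f: "f \<in> \<mm>" "\<alpha> = {g \<in> \<mm>. f - g \<in> Q}" by (rule cotangentsE[OF \<alpha>])
  have f\<alpha>: "f \<in> \<alpha>" using f by (simp add: ideal_square_0)
  have fA: "f \<in> A" by (rule \<mm>_A[OF f(1)])
  have br0: "ev (br f h) = 0" if h: "h \<in> A" for h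
  proof -
    have hm: "centred h \<in> \<mm>" by (rule centred_\<mm>[OF h])
    let ?\<beta> = "{g \<in> \<mm>. centred h - g \<in> Q}"
    have \<beta>: "?\<beta> \<in> cotangents" "centred h \<in> ?\<beta>" using hm by (auto simp: ideal_square_0 intro: cotangentsI)
    have "br f h = br f (centred h + const (ev h))" by (simp add: centred_def)
    also have "\<dots> = br f (centred h)" by (simp add: derivationD[OF log_bracket_derivation])
    finally show ?thesis using the_elem_bracket[OF \<alpha> f\<alpha> \<beta>] zero[OF \<beta>(1)] by simp
  qed
  obtain c where c: "f - (\<Sum>k\<in>UNIV. const (c k) * cot_basis k) \<in> Q"
    using centred_in_span[OF fA] by (auto simp: basis_span_def centred_of_\<mm>[OF f(1)])
  have "c k = 0" for k
    by (rule radical_trivial[OF c]) (simp_all add: br0 var_A xm_A)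
  then have "f \<in> Q" using c by simp
  then show ?thesis using f by (simp add: \<mm>_0)
qed

text \<open>
  The combination is congruent to \<open>0\<close> modulo \<open>Q\<close>, and \<open>0\<close> has zero bracket with everything.
\<close>

lemma cot_basis_independent:
  assumes "(\<Sum>k\<in>UNIV. const (c k) * cot_basis k) \<in> Q"
  shows "c k = 0"
proof (rule radical_trivial[of 0 c])
  show "0 - (\<Sum>k\<in>UNIV. const (c k) * cot_basis k) \<in> Q" using Q_minus[OF assms] by simp
qed (use log_bracket_const_left[of \<Lambda> 0] in \<open>simp_all add: ev_0\<close>)

lemma cotangent_basis:
  "\<exists>e. (\<forall>i<CARD('a). e i \<in> \<mm>) \<and> (\<forall>\<alpha>\<in>cotangents.
     \<exists>!c. c \<in> extensional {..<CARD('a)} \<and> (\<Sum>i<CARD('a). const (c i) * e i) \<in> \<alpha>)"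
proof -
  obtain h where h: "bij_betw h {..<CARD('a)} (UNIV :: 'a set)"
    using ex_bij_betw_nat_finite[of "UNIV :: 'a set"] by (auto simp: atLeast0LessThan)
  define g where "g = the_inv_into {..<CARD('a)} h"
  have hg: "h (g j) = j" "g j < CARD('a)" for j
    using h f_the_inv_into_f_bij_betw[OF h, of j] the_inv_into_into[of h "{..<CARD('a)}" j "{..<CARD('a)}"]
    by (auto simp: g_def bij_betw_def)
  have gh: "g (h i) = i" if "i < CARD('a)" for i
    using h that by (simp add: g_def the_inv_into_f_f bij_betw_def)
  have reindex: "(\<Sum>i<CARD('a). const (c i) * cot_basis (h i)) = (\<Sum>k\<in>UNIV. const (c (g k)) * cot_basis k)" for c
  proof -
    have "(\<Sum>i<CARD('a). const (c i) * cot_basis (h i)) = (\<Sum>i<CARD('a). (\<lambda>k. const (c (g k)) * cot_basis k) (h i))"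
      by (rule sum.cong) (auto simp: gh)
    also have "\<dots> = (\<Sum>k\<in>UNIV. const (c (g k)) * cot_basis k)"
      by (rule sum.reindex_bij_betw[OF h])
    finally show ?thesis .
  qed
  show ?thesis
  proof (intro exI[of _ "\<lambda>i. cot_basis (h i)"] conjI allI impI ballI)
    show "cot_basis (h i) \<in> \<mm>" for i by (rule cot_basis_\<mm>)
    fix \<alpha> assume \<alpha>: "\<alpha> \<in> cotangents"
    obtain f where f: "f \<in> \<mm>" "\<alpha> = {g \<in> \<mm>. f - g \<in> Q}" by (rule cotangentsE[OF \<alpha>])
    obtain c where c: "f - (\<Sum>k\<in>UNIV. const (c k) * cot_basis k) \<in> Q"
      using centred_in_span[OF \<mm>_A[OF f(1)]] by (auto simp: basis_span_def centred_of_\<mm>[OF f(1)])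
    have in_\<mm>: "(\<Sum>k\<in>UNIV. const (c k) * cot_basis k) \<in> \<mm>" for c
      by (intro \<mm>_sum \<mm>_mult const_A cot_basis_\<mm>)
    show "\<exists>!c. c \<in> extensional {..<CARD('a)} \<and> (\<Sum>i<CARD('a). const (c i) * cot_basis (h i)) \<in> \<alpha>"
    proof (rule ex1I)
      let ?c = "restrict (\<lambda>i. c (h i)) {..<CARD('a)}"
      have "?c (g k) = c k" for k by (simp add: hg)
      then show "?c \<in> extensional {..<CARD('a)} \<and> (\<Sum>i<CARD('a). const (?c i) * cot_basis (h i)) \<in> \<alpha>"
        unfolding reindex f(2) using c in_\<mm> by simp
      fix c' assume c': "c' \<in> extensional {..<CARD('a)} \<and> (\<Sum>i<CARD('a). const (c' i) * cot_basis (h i)) \<in> \<alpha>"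
      then have "f - (\<Sum>k\<in>UNIV. const (c' (g k)) * cot_basis k) \<in> Q" unfolding reindex f(2) by simp
      from Q_diff[OF c this] have "(\<Sum>k\<in>UNIV. const (c' (g k) - c k) * cot_basis k) \<in> Q"
        by (simp add: const_diff left_diff_distrib sum_subtractf)
      then have "c' (g k) - c k = 0" for k by (rule cot_basis_independent)
      then have "c' (g k) = c k" for k by simp
      then have "c' i = c (h i)" if "i < CARD('a)" for i using gh[OF that] by metis
      then show "c' = ?c" using c' by (intro extensionalityI[of c' "{..<CARD('a)}" ?c]) auto
    qed
  qed
qed

end

lemma acyclic_quiver_iff: "acyclic_quiver B \<longleftrightarrow> acyclic {(i, j). B $ i $ j > 0}"
proof -
  have "(\<lambda>(i, j, k). (i, j)) ` quiver_arrows B = {(i, j). B $ i $ j > 0}"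
  proof (rule set_eqI, clarify)
    fix i j
    have "(i, j, 0) \<in> quiver_arrows B" if "B $ i $ j > 0"
      using that by (simp add: quiver_arrows_def)
    then show "(i, j) \<in> (\<lambda>(i, j, k). (i, j)) ` quiver_arrows B \<longleftrightarrow> (i, j) \<in> {(i, j). B $ i $ j > 0}"
      by (auto simp: quiver_arrows_def intro!: image_eqI[of _ _ "(i, j, 0)"])
  qed
  then show ?thesis by (simp add: acyclic_quiver_def)
qed

theorem theorem1p2:
  fixes B \<Lambda> :: "('n::{finite,linorder}) int_matrix"
    and X :: "(complex^'m) set"
    and \<phi> :: "'n ratfun \<Rightarrow> complex^'m \<Rightarrow> complex"
  assumes "skew_symmetric B"
    and "invertible (rat_matrix B)"
    and "acyclic_quiver B"
    and "\<forall>i. (\<Sum>j\<in>UNIV. matrix_inv (rat_matrix B) $ i $ j *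
                of_int (max (B $ i $ j) 0 + min (B $ i $ j) 0)) \<noteq> 0"
    and "affine_variety X"
    and "coordinate_ring_iso (cluster_algebra B) X \<phi>"
    and "compatible_pair B \<Lambda>"
  shows "(\<forall>f\<in>cluster_algebra B. \<forall>g\<in>cluster_algebra B.
            poisson_bracket \<Lambda> f g \<in> cluster_algebra B) \<and>
         smooth_variety (cluster_algebra B) X \<phi> \<and>
         symplectic (cluster_algebra B) X \<phi> (bivector \<phi> (poisson_bracket \<Lambda>))"
proof -
  interpret acyclic_compatible B \<Lambda>
    using assms by unfold_locales (auto simp: acyclic_quiver_iff)
  have bracket: "poisson_bracket \<Lambda> = br" by (rule poisson_bracket_eq[OF skew_L])
  have point: "acyclic_point B \<Lambda> (\<lambda>f. \<phi> f p)" if "p \<in> X" for p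
    using assms(6) that by unfold_locales (auto simp: coordinate_ring_iso_def)
  have cot: "cotangent_space A \<phi> p = acyclic_point.cotangents B (\<lambda>f. \<phi> f p)"
    and max: "max_ideal A \<phi> p = acyclic_point.\<mm> B (\<lambda>f. \<phi> f p)" if "p \<in> X" for p
  proof -
    interpret acyclic_point B \<Lambda> "\<lambda>f. \<phi> f p" by (rule point[OF that])
    show max: "max_ideal A \<phi> p = \<mm>" by (simp add: max_ideal_def \<mm>_def)
    show "cotangent_space A \<phi> p = cotangents" by (simp add: cotangent_space_def cotangents_def max Let_def)
  qed
  have "has_cotangent_dim A \<phi> p CARD('n)" if p: "p \<in> X" for p
    unfolding has_cotangent_dim_def cot[OF p] max[OF p]
    by (rule acyclic_point.cotangent_basis[OF point[OF p]])
  then have "smooth_variety A X \<phi>"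
    unfolding smooth_variety_def using A_dimension by blast
  moreover have "symplectic A X \<phi> (bivector \<phi> br)"
    unfolding symplectic_def bivector_def
  proof (intro ballI conjI impI)
    fix p \<alpha> \<beta>
    assume p: "p \<in> X" and cotangents: "\<alpha> \<in> cotangent_space A \<phi> p" "\<beta> \<in> cotangent_space A \<phi> p"
    show "the_elem {\<phi> (br f g) p |f g. f \<in> \<alpha> \<and> g \<in> \<beta>} = - the_elem {\<phi> (br f g) p |f g. f \<in> \<beta> \<and> g \<in> \<alpha>}"
      using cotangents unfolding cot[OF p]
      by (rule acyclic_point.bracket_antisym_cotangents[OF point[OF p]])
  next
    fix p \<alpha> assume p: "p \<in> X" and "\<alpha> \<in> cotangent_space A \<phi> p"
      and "\<forall>\<beta>\<in>cotangent_space A \<phi> p. the_elem {\<phi> (br f g) p |f g. f \<in> \<alpha> \<and> g \<in> \<beta>} = 0"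
    then show "0 \<in> \<alpha>"
      unfolding cot[OF p] by (intro acyclic_point.bracket_nondegenerate[OF point[OF p]]) auto
  qed
  ultimately show ?thesis
    unfolding bracket using br_closed by blast
qed

end
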